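(* Let $\boldsymbol X_a=(X_1^{(a)},\dots,X_r^{(a)})$, $a=1,\dots,n$, be i.i.d. from a Lebesgue absolutely continuous distribution $\mu$ on $\mathbb R^{d_0}$, $d_0=\sum_{i=1}^rd_i$, with absolutely continuous marginals $\mu_i$ on $\mathbb R^{d_i}$, $1\le i\le r$. Suppose that for every $1\le i\le r$ the empirical distribution of the grid $\mathcal H_n^{d_i}=\{h_1^{d_i},\dots,h_n^{d_i}\}\subset[0,1]^{d_i}$ converges weakly to $\mathrm{Unif}([0,1]^{d_i})$ as $n\to\infty$. Let $\boldsymbol C=(C_2,\dots,C_r)$ be a given vector of non-negative weights, fix $\alpha\in(0,1)$, and suppose the (fixed) number of resamples $B$ satisfies $B\ge1/\alpha-1$. Then, for any fixed such $\mu\ne\mu_1\otimes\cdots\otimes\mu_r$, the resampling test $\tilde\phi_n(\boldsymbol C)$ defined in the context satisfies $$\lim_{n\to\infty}\mathbb E_\mu[\tilde\phi_n(\boldsymbol C)]=1.$$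
   Context: Put $\mathrm dw_i=\dfrac{\mathrm dt_i}{c_{d_i}\|t_i\|^{1+d_i}}$ with $c_d=\pi^{(1+d)/2}/\Gamma((1+d)/2)$, $d_S=\sum_{i\in S}d_i$, $\iota=\sqrt{-1}$. For $S\subseteq\{1,\dots,r\}$ with $|S|\ge2$ and points $(x_i^{(a)})_{i\in S}\in\mathbb R^{d_S}$, $1\le a\le n$, let $$\theta_S\big((x_i^{(1)})_{i\in S},\dots,(x_i^{(n)})_{i\in S}\big)=\int_{\mathbb R^{d_S}}\left|\frac1n\sum_{b=1}^n\prod_{i\in S}\left(\frac1n\sum_{a=1}^ne^{\iota\langle t_i,x_i^{(a)}\rangle}-e^{\iota\langle t_i,x_i^{(b)}\rangle}\right)\right|^2\prod_{i\in S}\mathrm dw_i.$$ Empirical ranks: $\hat R_i(X_i^{(a)})=h^{d_i}_{\hat\sigma_i(a)}$, where $\hat\sigma_i$ minimizes $\sum_{a=1}^n\|X_i^{(a)}-h^{d_i}_{\sigma(a)}\|^2$ over all permutations $\sigma$ of $\{1,\dots,n\}$. The test statistic is $$T_n=\mathrm{RJdCov}_n^2(\boldsymbol X;\boldsymbol C)=\sum_{s=2}^rC_s\sum_{S\subseteq\{1,\dots,r\},\,|S|=s}\theta_S\big((\hat R_i(X_i^{(1)}))_{i\in S},\dots,(\hat R_i(X_i^{(n)}))_{i\in S}\big).$$ For each $1\le b\le B$, independently of each other and of the data, draw $r$ i.i.d. uniform random permutations $\pi_1,\dots,\pi_r$ of $\{1,\dots,n\}$ and set $$T_n^{(b)}=\sum_{s=2}^rC_s\sum_{S\subseteq\{1,\dots,r\},\,|S|=s}\theta_S\big((h^{d_i}_{\pi_i(1)})_{i\in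 S},\dots,(h^{d_i}_{\pi_i(n)})_{i\in S}\big).$$ Let $R$ be the rank of $T_n$ among $T_n,T_n^{(1)},\dots,T_n^{(B)}$, ties broken at random, where $R=1$ denotes the rank of the largest element. Put $p_B=R/(B+1)$ and $\tilde\phi_n(\boldsymbol C)=\mathbf 1\{p_B\le\alpha\}$.
   Formalization: The weights C_2,…,C_r are assumed strictly positive instead of non-negative: with C=0 all statistics tie and the power is at most α, and any zero weight C_s makes the test inconsistent for some μ different from the product of its marginals. *)

theory Defs
  imports "HOL-Probability.Probability"
begin

(* R^k is the space of extensional functions {1..k} -> real.  A point of R^(d_0), d_0 = d 1 + ... + d r,
   is kept as its tuple of blocks x 1, ..., x r with x i in R^(d i); a sample of such points is
   X with X a i in R^(d i). *)

definition lborel_vec :: "nat \<Rightarrow> (nat \<Rightarrow> real) measure" where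
  "lborel_vec k = PiM {1..k} (\<lambda>_. lborel)"

definition lborel_blocks :: "nat \<Rightarrow> (nat \<Rightarrow> nat) \<Rightarrow> (nat \<Rightarrow> nat \<Rightarrow> real) measure" where
  "lborel_blocks r d = PiM {1..r} (\<lambda>i. lborel_vec (d i))"

definition marginal :: "(nat \<Rightarrow> nat) \<Rightarrow> (nat \<Rightarrow> nat \<Rightarrow> real) measure \<Rightarrow> nat \<Rightarrow> (nat \<Rightarrow> real) measure" where
  "marginal d \<mu> i = distr \<mu> (lborel_vec (d i)) (\<lambda>x. x i)"

definition unit_cube :: "nat \<Rightarrow> (nat \<Rightarrow> real) set" where
  "unit_cube k = (\<Pi>\<^sub>E j\<in>{1..k}. {0..1})"

(* The library's weak_conv_m covers only measures on the real line.  On the extensional functions,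
   the topology of pointwise convergence is the Euclidean topology of R^k. *)
definition weak_conv_vec :: "nat \<Rightarrow> (nat \<Rightarrow> (nat \<Rightarrow> real) measure) \<Rightarrow> (nat \<Rightarrow> real) measure \<Rightarrow> bool" where
  "weak_conv_vec k M N \<longleftrightarrow>
     (\<forall>f :: (nat \<Rightarrow> real) \<Rightarrow> real.
        continuous_on (space (lborel_vec k)) f \<longrightarrow> bounded (f ` space (lborel_vec k)) \<longrightarrow>
        (\<lambda>n. \<integral>x. f x \<partial>M n) \<longlonglongrightarrow> (\<integral>x. f x \<partial>N))"

(* A grid is indexed by sample size n, dimension k and point number a in {1..n}; points are counted
   with multiplicity. *)
definition grid_empirical :: "(nat \<Rightarrow> nat \<Rightarrow> nat \<Rightarrow> nat \<Rightarrow> real) \<Rightarrow> nat \<Rightarrow> nat \<Rightarrow> (nat \<Rightarrow> real) measure" where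
  "grid_empirical h k n = distr (uniform_count_measure {1..n}) (lborel_vec k) (h n k)"

definition c_const :: "nat \<Rightarrow> real" where
  "c_const k = pi powr ((1 + real k) / 2) / Gamma ((1 + real k) / 2)"

definition dw :: "nat \<Rightarrow> (nat \<Rightarrow> real) measure" where
  "dw k = density (lborel_vec k) (\<lambda>t. ennreal (1 / (c_const k * L2_set t {1..k} ^ (1 + k))))"

definition vinner :: "nat \<Rightarrow> (nat \<Rightarrow> real) \<Rightarrow> (nat \<Rightarrow> real) \<Rightarrow> real" where
  "vinner k s t = (\<Sum>j=1..k. s j * t j)"

definition theta :: "(nat \<Rightarrow> nat) \<Rightarrow> nat \<Rightarrow> nat set \<Rightarrow> (nat \<Rightarrow> nat \<Rightarrow> nat \<Rightarrow> real) \<Rightarrow> real" where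
  "theta d n S x =
     (\<integral>t. (cmod ((1 / of_nat n) * (\<Sum>b=1..n. \<Prod>i\<in>S.
              (1 / of_nat n) * (\<Sum>a=1..n. exp (\<i> * complex_of_real (vinner (d i) (t i) (x a i))))
                - exp (\<i> * complex_of_real (vinner (d i) (t i) (x b i))))))\<^sup>2
        \<partial>(PiM S (\<lambda>i. dw (d i))))"

definition JdCov_stat ::
    "nat \<Rightarrow> (nat \<Rightarrow> nat) \<Rightarrow> nat \<Rightarrow> (nat \<Rightarrow> real) \<Rightarrow> (nat \<Rightarrow> nat \<Rightarrow> nat \<Rightarrow> real) \<Rightarrow> real" where
  "JdCov_stat r d n C x =
     (\<Sum>s=2..r. C s * (\<Sum>S | S \<subseteq> {1..r} \<and> card S = s. theta d n S x))"

(* When the minimiser is not unique, arg_min selects one.  For absolutely continuous data two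
   minimisers almost surely give the same ranks, so the choice has no effect on expectations. *)
definition opt_assignment ::
    "(nat \<Rightarrow> nat \<Rightarrow> nat \<Rightarrow> nat \<Rightarrow> real) \<Rightarrow> (nat \<Rightarrow> nat) \<Rightarrow> nat \<Rightarrow> (nat \<Rightarrow> nat \<Rightarrow> nat \<Rightarrow> real) \<Rightarrow> nat \<Rightarrow> nat \<Rightarrow> nat"
  where
  "opt_assignment h d n X i =
     arg_min (\<lambda>\<sigma>. \<Sum>a=1..n. (L2_set (\<lambda>j. X a i j - h n (d i) (\<sigma> a) j) {1..d i})\<^sup>2)
             (\<lambda>\<sigma>. \<sigma> permutes {1..n})"

definition RJdCov_stat ::
    "(nat \<Rightarrow> nat \<Rightarrow> nat \<Rightarrow> nat \<Rightarrow> real) \<Rightarrow> nat \<Rightarrow> (nat \<Rightarrow> nat) \<Rightarrow> nat \<Rightarrow> (nat \<Rightarrow> real)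
     \<Rightarrow> (nat \<Rightarrow> nat \<Rightarrow> nat \<Rightarrow> real) \<Rightarrow> real" where
  "RJdCov_stat h r d n C X =
     JdCov_stat r d n C (\<lambda>a i. h n (d i) (opt_assignment h d n X i a))"

definition resampled_stat ::
    "(nat \<Rightarrow> nat \<Rightarrow> nat \<Rightarrow> nat \<Rightarrow> real) \<Rightarrow> nat \<Rightarrow> (nat \<Rightarrow> nat) \<Rightarrow> nat \<Rightarrow> (nat \<Rightarrow> real)
     \<Rightarrow> (nat \<Rightarrow> nat \<Rightarrow> nat) \<Rightarrow> real" where
  "resampled_stat h r d n C \<pi> = JdCov_stat r d n C (\<lambda>a i. h n (d i) (\<pi> i a))"

(* Descending rank of T 0 among T 0, ..., T B; ties are ordered by a permutation tau of {0..B},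
   which is drawn uniformly in resampling_law. *)
definition desc_rank :: "nat \<Rightarrow> (nat \<Rightarrow> real) \<Rightarrow> (nat \<Rightarrow> nat) \<Rightarrow> nat" where
  "desc_rank B T \<tau> = 1 + card {b \<in> {1..B}. T b > T 0 \<or> T b = T 0 \<and> \<tau> b < \<tau> 0}"

definition resampling_test ::
    "(nat \<Rightarrow> nat \<Rightarrow> nat \<Rightarrow> nat \<Rightarrow> real) \<Rightarrow> nat \<Rightarrow> (nat \<Rightarrow> nat) \<Rightarrow> (nat \<Rightarrow> real) \<Rightarrow> real \<Rightarrow> nat \<Rightarrow> nat
     \<Rightarrow> (nat \<Rightarrow> nat \<Rightarrow> nat \<Rightarrow> real) \<times> (nat \<times> nat \<Rightarrow> nat \<Rightarrow> nat) \<times> (nat \<Rightarrow> nat) \<Rightarrow> real" where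
  "resampling_test h r d C \<alpha> B n = (\<lambda>(X, \<pi>, \<tau>).
     let T = (\<lambda>b. if b = 0 then RJdCov_stat h r d n C X
                  else resampled_stat h r d n C (\<lambda>i. \<pi> (b, i)));
         p = real (desc_rank B T \<tau>) / (real B + 1)
     in if p \<le> \<alpha> then 1 else 0)"

(* Joint law of the i.i.d. sample from mu, the independent uniform permutations pi (b, i) for
   1 <= b <= B and 1 <= i <= r, and the tie-breaking order. *)
definition resampling_law ::
    "nat \<Rightarrow> nat \<Rightarrow> nat \<Rightarrow> (nat \<Rightarrow> nat \<Rightarrow> real) measure
     \<Rightarrow> ((nat \<Rightarrow> nat \<Rightarrow> nat \<Rightarrow> real) \<times> (nat \<times> nat \<Rightarrow> nat \<Rightarrow> nat) \<times> (nat \<Rightarrow> nat)) measure" where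
  "resampling_law r B n \<mu> =
     PiM {1..n} (\<lambda>_. \<mu>) \<Otimes>\<^sub>M
       (PiM ({1..B} \<times> {1..r}) (\<lambda>_. uniform_count_measure {\<pi>. \<pi> permutes {1..n}}) \<Otimes>\<^sub>M
        uniform_count_measure {\<tau>. \<tau> permutes {0..B}})"

end

theory Submission
  imports Defs
begin

text \<open>Since \<open>1 / (B + 1) \<le> \<alpha>\<close>, it suffices that the statistic exceeds every resampled one with probability
  tending to 1.  A second-moment computation over one random permutation shows that the resampled
  statistics tend to 0.  That the statistic itself stays away from 0 is proved without the theory of
  optimal transport maps: optimality of the assignment is used only through two-point monotonicity of
  the pairing of data and ranks.  Along grid lines in a coordinate direction, monotonicity forces the
  data coordinate to cross a given threshold in only boundedly many cells, so up to a small fraction of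
  exceptional points, the event that a data block lies in a given orthant is a function of the cell of
  its rank.  If the statistic were small, then by Fourier inversion in the form of the
  Stone--Weierstrass theorem, the ranks of the blocks would be almost independent, hence so would be
  the orthant events, and the law of large numbers would make \<open>\<mu>\<close> a product.\<close>

text \<open>Only weak convergence of the grids is available, so the ranks are not compared with any
  population map; the argument stays at finite n. Once the cell scale \<open>N\<close> and the
  threshold \<open>\<kappa>\<close> are fixed, the factorization bound holds for every sample
  simultaneously when n is large, and the randomness of the sample enters only through laws of large
  numbers for finitely many bounded functions of one observation. The exceptional fraction is small
  by a dimension count: in dimension k about N^(k-1) of the N^k cells can be crossed by a threshold,
  each carrying a fraction O(N^(-k)) of the grid, which leaves O(1/N). The count needs a definite
  loss in the pairing at each crossing; hence the data are also kept bounded by M and out of a strip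
  of width \<open>\<eta>\<close> above each threshold. Cells are smoothed to tents because weak
  convergence and Stone--Weierstrass both speak of continuous functions.\<close>

section \<open>Integrability for the weight measure\<close>

lemma space_lborel_vec: "space (lborel_vec k) = PiE {1..k} (\<lambda>_. UNIV)"
  by (simp add: lborel_vec_def space_PiM)

lemma sets_lborel_vec[measurable_cong]: "sets (lborel_vec k) = sets (PiM {1..k} (\<lambda>_. borel))"
  unfolding lborel_vec_def by (intro sets_PiM_cong) auto

interpretation lborel_family: product_sigma_finite "\<lambda>_::nat. lborel :: real measure"
  by standard

lemma sigma_finite_lborel_vec: "sigma_finite_measure (lborel_vec k)"
  unfolding lborel_vec_def by (rule lborel_family.sigma_finite) simp

lemma emeasure_lborel_vec_box:
  assumes "\<And>j. j \<in> {1..k} \<Longrightarrow> a j \<le> b j"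
  shows "emeasure (lborel_vec k) (\<Pi>\<^sub>E j\<in>{1..k}. {a j..b j}) = ennreal (\<Prod>j=1..k. b j - a j)"
proof -
  have "emeasure (lborel_vec k) (\<Pi>\<^sub>E j\<in>{1..k}. {a j..b j}) = (\<Prod>j=1..k. ennreal (b j - a j))"
    unfolding lborel_vec_def using assms by (subst lborel_family.emeasure_PiM) auto
  also have "\<dots> = ennreal (\<Prod>j=1..k. b j - a j)"
    using assms by (intro prod_ennreal) auto
  finally show ?thesis .
qed

lemma L2_set_measurable[measurable]:
  "(\<lambda>t. L2_set t {1..k}) \<in> borel_measurable (lborel_vec k)"
proof -
  have "(\<lambda>t. sqrt (\<Sum>j\<in>{1..k}. (t j)\<^sup>2)) \<in> borel_measurable (PiM {1..k} (\<lambda>_. borel))"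
    by measurable
  then show ?thesis unfolding L2_set_def by (simp add: measurable_cong_sets[OF sets_lborel_vec refl])
qed

lemma dw_density_measurable[measurable]:
  "(\<lambda>t. ennreal (1 / (c_const k * L2_set t {1..k} ^ (1 + k)))) \<in> borel_measurable (lborel_vec k)"
  by measurable

lemma abs_le_L2_set: "finite A \<Longrightarrow> j \<in> A \<Longrightarrow> \<bar>t j\<bar> \<le> L2_set t A"
  using member_le_L2_set[of A j "\<lambda>j. \<bar>t j\<bar>"] by (simp add: L2_set_def)

lemma sets_dw[measurable_cong]: "sets (dw k) = sets (PiM {1..k} (\<lambda>_. borel))"
  by (simp add: dw_def sets_lborel_vec)

lemma c_const_pos: "c_const k > 0"
  by (simp add: c_const_def Gamma_real_pos)

text \<open>The weight has infinite mass near the origin when \<open>k\<close> is positive, but its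
  density is finite at every point (division by zero makes it 0 at the origin), and this is what
  sigma-finiteness of a density asks for.\<close>

lemma sigma_finite_dw: "sigma_finite_measure (dw k)"
  unfolding dw_def
  by (subst sigma_finite_measure.sigma_finite_iff_density_finite
        [OF sigma_finite_lborel_vec dw_density_measurable]) auto

text \<open>Squares the bound for |e^{i<t,v>} - e^{i<t,w>}| with v and w in the unit cube. Its
  quadratic decay at the origin compensates the singularity of the weight; at infinity its
  boundedness suffices.\<close>

definition gbound :: "nat \<Rightarrow> (nat \<Rightarrow> real) \<Rightarrow> real" where
  "gbound k t = (min 2 (\<Sum>j=1..k. \<bar>t j\<bar>))\<^sup>2"

lemma gbound_measurable[measurable]: "gbound k \<in> borel_measurable (PiM {1..k} (\<lambda>_. borel))"
  unfolding gbound_def by measurable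

lemma gbound_nonneg: "0 \<le> gbound k t" by (simp add: gbound_def)

lemma gbound_le: "gbound k t \<le> max 4 (real k ^ 2) * min 1 ((L2_set t {1..k})\<^sup>2)"
proof -
  let ?L = "L2_set t {1..k}"
  have "(\<Sum>j=1..k. \<bar>t j\<bar>) \<le> (\<Sum>j=1..k. ?L)"
    by (intro sum_mono abs_le_L2_set) auto
  then have s: "(\<Sum>j=1..k. \<bar>t j\<bar>) \<le> real k * ?L" by simp
  have "gbound k t \<le> 2\<^sup>2" unfolding gbound_def
    by (intro power_mono) (auto intro: sum_nonneg)
  moreover have "gbound k t \<le> (real k * ?L)\<^sup>2" unfolding gbound_def
    using s by (intro power_mono) (auto intro: sum_nonneg)
  moreover have "(real k * ?L)\<^sup>2 \<le> max 4 (real k ^ 2) * ?L\<^sup>2"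
    by (simp add: power_mult_distrib mult_right_mono)
  ultimately show ?thesis by (auto simp: min_def)
qed

text \<open>Presents the radial weight as a superposition of indicators of balls, so that later only
  volumes of balls have to be estimated.\<close>

lemma inverse_power_layer:
  fixes L :: real assumes "L > 0"
  shows "(\<integral>\<^sup>+\<rho>. ennreal (real (k+1) / \<rho> ^ (k+2)) * indicator {L..} \<rho> \<partial>lborel) = ennreal (1 / L ^ (k+1))"
proof -
  have "(\<integral>\<^sup>+\<rho>. ennreal (real (k+1) / \<rho> ^ (k+2)) * indicator {L..} \<rho> \<partial>lborel) = ennreal (0 - (- (1 / L ^ (k+1))))"
  proof (rule nn_integral_FTC_atLeast)
    show "((\<lambda>x::real. - (1 / x ^ (k+1))) \<longlongrightarrow> 0) at_top"
      by real_asymp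
  next
    fix x assume x: "L \<le> x"
    then have "x > 0" using assms by simp
    then have "((\<lambda>x::real. - (1 / x ^ (k+1))) has_real_derivative
        - ((0 * x ^ (k+1) - 1 * (real (k+1) * x ^ k)) / (x ^ (k+1) * x ^ (k+1)))) (at x)"
      by (intro DERIV_minus DERIV_divide DERIV_const) (use DERIV_pow[of "k+1" x] in auto)
    moreover have "x ^ (k+1) * x ^ (k+1) = x ^ k * x ^ (k+2)"
      by (simp flip: power_add)
    ultimately show "((\<lambda>x::real. - (1 / x ^ (k+1))) has_real_derivative real (k + 1) / x ^ (k + 2)) (at x)"
      using \<open>x > 0\<close> by simp
  qed (use assms in \<open>auto\<close>)
  then show ?thesis by simp
qed

lemma L2_ball_subset_box:
  "{t \<in> space (lborel_vec k). L2_set t {1..k} \<le> \<rho>} \<subseteq> (\<Pi>\<^sub>E j\<in>{1..k}. {-\<rho>..\<rho>})"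
proof
  fix t assume t: "t \<in> {t \<in> space (lborel_vec k). L2_set t {1..k} \<le> \<rho>}"
  have "t j \<in> {-\<rho>..\<rho>}" if "j \<in> {1..k}" for j
    using abs_le_L2_set[of "{1..k}" j t] that t by (simp add: abs_le_iff)
  then show "t \<in> (\<Pi>\<^sub>E j\<in>{1..k}. {-\<rho>..\<rho>})"
    using t unfolding space_lborel_vec PiE_iff by simp
qed

text \<open>Integrating \<open>layer k t \<rho>\<close> over \<open>\<rho>\<close> dominates \<open>min 1 (L\<^sup>2) / L ^ (k + 1)\<close> with \<open>L = L2_set t {1..k}\<close>; integrating
  over \<open>t\<close> first leaves a multiple of \<open>min 1 (\<rho>\<^sup>2) / \<rho>\<^sup>2\<close>.  This replaces polar coordinates.\<close>

definition layer :: "nat \<Rightarrow> (nat \<Rightarrow> real) \<Rightarrow> real \<Rightarrow> real" where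
  "layer k t \<rho> = (if L2_set t {1..k} \<le> \<rho> \<and> 0 < \<rho> then min 1 (\<rho>\<^sup>2) * (real (k+1) / \<rho> ^ (k+2)) else 0)"

lemma layer_aux:
  fixes g s :: "'a \<Rightarrow> real"
  assumes g[measurable]: "g \<in> borel_measurable M" and s[measurable]: "s \<in> borel_measurable M"
  shows "(\<lambda>x. ennreal (if g x \<le> s x \<and> 0 < s x then min 1 ((s x)\<^sup>2) * (real (k+1) / s x ^ (k+2)) else 0))
      \<in> borel_measurable M"
proof -
  have a[measurable]: "(\<lambda>x. min 1 ((s x)\<^sup>2) * (real (k+1) / s x ^ (k+2))) \<in> borel_measurable M"
    by (intro borel_measurable_times borel_measurable_min borel_measurable_power borel_measurable_divide s) auto
  have "{x\<in>space M. g x \<le> s x \<and> 0 < s x} \<in> sets M" by measurable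
  then show ?thesis
    by (intro measurable_compose[OF _ measurable_ennreal] measurable_If a) auto
qed
lemma layer_measurable[measurable]:
  "(\<lambda>(t, \<rho>). ennreal (layer k t \<rho>)) \<in> borel_measurable (lborel_vec k \<Otimes>\<^sub>M lborel)"
proof -
  have g: "(\<lambda>x. L2_set (fst x) {1..k}) \<in> borel_measurable (lborel_vec k \<Otimes>\<^sub>M (lborel :: real measure))"
    using measurable_compose[OF measurable_fst L2_set_measurable] .
  have s: "snd \<in> borel_measurable (lborel_vec k \<Otimes>\<^sub>M (lborel :: real measure))"
    using measurable_snd[of "lborel_vec k" "lborel :: real measure"] by simp
  show ?thesis
    using layer_aux[OF g s] unfolding layer_def case_prod_beta' .
qed

text \<open>For radii \<open>\<rho>\<close> above \<open>L\<close> the factor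
  \<open>min 1 (\<rho>\<^sup>2)\<close> is at least \<open>min 1 (L\<^sup>2)\<close>, so it may be
  moved inside the integral over radii.\<close>

lemma layer_lower:
  assumes L: "L2_set t {1..k} > 0"
  shows "ennreal (min 1 ((L2_set t {1..k})\<^sup>2) * (1 / L2_set t {1..k} ^ (k+1)))
     \<le> (\<integral>\<^sup>+\<rho>. ennreal (layer k t \<rho>) \<partial>lborel)"
proof -
  let ?L = "L2_set t {1..k}"
  let ?m = "\<lambda>x::real. min 1 (x\<^sup>2)"
  have "ennreal (?m ?L * (1 / ?L ^ (k+1))) = ennreal (?m ?L) * ennreal (1 / ?L ^ (k+1))"
    using L by (intro ennreal_mult) auto
  also have "\<dots> = (\<integral>\<^sup>+\<rho>. ennreal (?m ?L) * (ennreal (real (k+1) / \<rho> ^ (k+2)) * indicator {?L..} \<rho>) \<partial>lborel)"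
    by (subst nn_integral_cmult) (auto simp: inverse_power_layer[OF L, simplified])
  also have "\<dots> \<le> (\<integral>\<^sup>+\<rho>. ennreal (layer k t \<rho>) \<partial>lborel)"
  proof (intro nn_integral_mono)
    fix \<rho> :: real
    show "ennreal (?m ?L) * (ennreal (real (k+1) / \<rho> ^ (k+2)) * indicator {?L..} \<rho>) \<le> ennreal (layer k t \<rho>)"
    proof (cases "?L \<le> \<rho>")
      case True
      then have r: "\<rho> > 0" using L by linarith
      have "?m ?L \<le> ?m \<rho>" using True L by (intro min.mono power_mono) auto
      then have "?m ?L * (real (k+1) / \<rho> ^ (k+2)) \<le> ?m \<rho> * (real (k+1) / \<rho> ^ (k+2))"
        using r by (intro mult_right_mono) auto
      then show ?thesis using True r unfolding layer_def
        by (auto simp: ennreal_mult[symmetric] intro!: ennreal_leI)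
    qed simp
  qed
  finally show ?thesis .
qed

lemma layer_upper:
  "(\<integral>\<^sup>+t. ennreal (layer k t \<rho>) \<partial>lborel_vec k)
    \<le> ennreal (real (k+1) * 2 ^ k) * (indicator {0..1} \<rho> + ennreal (1 / \<rho>\<^sup>2) * indicator {1..} \<rho>)"
proof (cases "\<rho> > 0")
  case True
  let ?m = "\<lambda>x::real. min 1 (x\<^sup>2)"
  let ?A = "{t \<in> space (lborel_vec k). L2_set t {1..k} \<le> \<rho>}"
  have [measurable]: "?A \<in> sets (lborel_vec k)" by measurable
  have "(\<integral>\<^sup>+t. ennreal (layer k t \<rho>) \<partial>lborel_vec k)
     = (\<integral>\<^sup>+t. ennreal (?m \<rho> * (real (k+1) / \<rho> ^ (k+2))) * indicator ?A t \<partial>lborel_vec k)"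
    using True by (intro nn_integral_cong) (simp add: layer_def indicator_def)
  also have "\<dots> = ennreal (?m \<rho> * (real (k+1) / \<rho> ^ (k+2))) * emeasure (lborel_vec k) ?A"
    by (rule nn_integral_cmult_indicator) measurable
  \<comment> \<open>Ball volumes matter only up to a constant, so the circumscribed box of volume
    \<open>(2 * \<rho>) ^ k\<close> is enough; its power of \<open>\<rho>\<close> reduces
    \<open>\<rho> ^ (k+2)\<close> to the square.\<close>
  also have "\<dots> \<le> ennreal (?m \<rho> * (real (k+1) / \<rho> ^ (k+2))) * emeasure (lborel_vec k) (\<Pi>\<^sub>E j\<in>{1..k}. {-\<rho>..\<rho>})"
    by (intro mult_left_mono emeasure_mono L2_ball_subset_box)
      (auto simp: lborel_vec_def intro!: sets_PiM_I_finite)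
  also have "\<dots> = ennreal (?m \<rho> * (real (k+1) / \<rho> ^ (k+2))) * ennreal ((2 * \<rho>) ^ k)"
    using True by (subst emeasure_lborel_vec_box) auto
  also have "\<dots> = ennreal (?m \<rho> * (real (k+1) / \<rho> ^ (k+2)) * (2 * \<rho>) ^ k)"
    using True by (intro ennreal_mult[symmetric]) auto
  also have "?m \<rho> * (real (k+1) / \<rho> ^ (k+2)) * (2 * \<rho>) ^ k = real (k+1) * 2 ^ k * (?m \<rho> / \<rho>\<^sup>2)"
  proof -
    have "\<rho> ^ (k+2) = \<rho> ^ k * \<rho>\<^sup>2" by (rule power_add)
    then show ?thesis using True by (simp only: power_mult_distrib) (simp add: field_simps)
  qed
  also have "ennreal \<dots> = ennreal (real (k+1) * 2 ^ k) * ennreal (?m \<rho> / \<rho>\<^sup>2)"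
    using True by (intro ennreal_mult) auto
  also have "\<dots> \<le> ennreal (real (k+1) * 2 ^ k) * (indicator {0..1} \<rho> + ennreal (1 / \<rho>\<^sup>2) * indicator {1..} \<rho>)"
  proof (rule mult_left_mono)
    show "ennreal (?m \<rho> / \<rho>\<^sup>2) \<le> indicator {0..1} \<rho> + ennreal (1 / \<rho>\<^sup>2) * indicator {1..} \<rho>"
    proof (cases "\<rho> \<le> 1")
      case le: True
      have "?m \<rho> / \<rho>\<^sup>2 \<le> 1" using True by (simp add: field_simps)
      then have "ennreal (?m \<rho> / \<rho>\<^sup>2) \<le> ennreal 1" by (rule ennreal_leI)
      also have "\<dots> \<le> indicator {0..1} \<rho> + ennreal (1 / \<rho>\<^sup>2) * indicator {1..} \<rho>"
        using True le by (simp add: indicator_def)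
      finally show ?thesis .
    next
      case False
      have "?m \<rho> / \<rho>\<^sup>2 \<le> 1 / \<rho>\<^sup>2" by (intro divide_right_mono) auto
      then show ?thesis using False by (simp add: ennreal_leI)
    qed
  qed simp
  finally show ?thesis .
qed (simp add: layer_def)

text \<open>The layer integral dominates the weighted integrand, and Tonelli's theorem exchanges
  radius and frequency.\<close>

lemma gbound_integrable:
  assumes k: "k \<ge> 1"
  shows "integrable (dw k) (gbound k)"
proof -
  let ?L = "\<lambda>t. L2_set t {1..k}"
  let ?D = "max 4 (real k ^ 2) / c_const k"
  interpret V: sigma_finite_measure "lborel_vec k" by (rule sigma_finite_lborel_vec)
  interpret P: pair_sigma_finite "lborel_vec k" "lborel :: real measure" ..
  have D: "?D \<ge> 0" using c_const_pos[of k] by simp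
  have gb[measurable]: "gbound k \<in> borel_measurable (lborel_vec k)" by measurable
  have inner[measurable]: "(\<lambda>t. \<integral>\<^sup>+\<rho>. ennreal (layer k t \<rho>) \<partial>lborel) \<in> borel_measurable (lborel_vec k)"
    using lborel.borel_measurable_nn_integral[OF layer_measurable] by simp
  have "(\<integral>\<^sup>+t. ennreal (gbound k t) \<partial>dw k) =
      (\<integral>\<^sup>+t. ennreal (1 / (c_const k * ?L t ^ (1 + k))) * ennreal (gbound k t) \<partial>lborel_vec k)"
    unfolding dw_def by (rule nn_integral_density) measurable
  also have "\<dots> \<le> (\<integral>\<^sup>+t. ennreal ?D * (\<integral>\<^sup>+\<rho>. ennreal (layer k t \<rho>) \<partial>lborel) \<partial>lborel_vec k)"
  proof (intro nn_integral_mono)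
    fix t
    show "ennreal (1 / (c_const k * ?L t ^ (1 + k))) * ennreal (gbound k t)
      \<le> ennreal ?D * (\<integral>\<^sup>+\<rho>. ennreal (layer k t \<rho>) \<partial>lborel)"
    \<comment> \<open>At the origin the density is 0 by the convention for division by zero;
      everywhere else the layer bound applies.\<close>
    proof (cases "?L t = 0")
      case False
      then have L: "?L t > 0" by (metis L2_set_nonneg order_le_less)
      have "1 / (c_const k * ?L t ^ (1 + k)) * gbound k t
          \<le> 1 / (c_const k * ?L t ^ (1 + k)) * (max 4 (real k ^ 2) * min 1 ((?L t)\<^sup>2))"
        by (intro mult_left_mono gbound_le) (use L c_const_pos[of k] in auto)
      also have "\<dots> = ?D * (min 1 ((?L t)\<^sup>2) * (1 / ?L t ^ (k+1)))"
        by (simp add: add.commute)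
      finally have "ennreal (1 / (c_const k * ?L t ^ (1 + k)) * gbound k t)
          \<le> ennreal (?D * (min 1 ((?L t)\<^sup>2) * (1 / ?L t ^ (k+1))))"
        by (rule ennreal_leI)
      also have "\<dots> = ennreal ?D * ennreal (min 1 ((?L t)\<^sup>2) * (1 / ?L t ^ (k+1)))"
        by (rule ennreal_mult) (use D L in auto)
      also have "\<dots> \<le> ennreal ?D * (\<integral>\<^sup>+\<rho>. ennreal (layer k t \<rho>) \<partial>lborel)"
        by (rule mult_left_mono[OF layer_lower[OF L]]) simp
      also have "ennreal (1 / (c_const k * ?L t ^ (1 + k)) * gbound k t)
          = ennreal (1 / (c_const k * ?L t ^ (1 + k))) * ennreal (gbound k t)"
        by (rule ennreal_mult) (use L c_const_pos[of k] gbound_nonneg in auto)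
      finally show ?thesis .
    qed (use k in simp)
  qed
  also have "\<dots> = ennreal ?D * (\<integral>\<^sup>+t. (\<integral>\<^sup>+\<rho>. ennreal (layer k t \<rho>) \<partial>lborel) \<partial>lborel_vec k)"
    by (rule nn_integral_cmult[OF inner])
  also have "(\<integral>\<^sup>+t. (\<integral>\<^sup>+\<rho>. ennreal (layer k t \<rho>) \<partial>lborel) \<partial>lborel_vec k)
     = (\<integral>\<^sup>+\<rho>. (\<integral>\<^sup>+t. ennreal (layer k t \<rho>) \<partial>lborel_vec k) \<partial>lborel)"
    by (rule P.Fubini'[OF layer_measurable, symmetric])
  also have "\<dots> \<le> (\<integral>\<^sup>+\<rho>. ennreal (real (k+1) * 2 ^ k) * (indicator {0..1} \<rho> + ennreal (1 / \<rho>\<^sup>2) * indicator {1..} \<rho>) \<partial>lborel)"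
    by (intro nn_integral_mono layer_upper)
  also have "\<dots> = ennreal (real (k+1) * 2 ^ k) * (\<integral>\<^sup>+\<rho>. indicator {0..1} \<rho> + ennreal (1 / \<rho>\<^sup>2) * indicator {1..} \<rho> \<partial>lborel)"
    by (rule nn_integral_cmult) measurable
  also have "(\<integral>\<^sup>+\<rho>. indicator {0..1} \<rho> + ennreal (1 / \<rho>\<^sup>2) * indicator {1..} \<rho> \<partial>lborel) = ennreal 2"
  proof -
    have "(\<integral>\<^sup>+\<rho>. ennreal (1 / \<rho>\<^sup>2) * indicator {1..} \<rho> \<partial>lborel) = 1"
      using inverse_power_layer[of 1 0] by (simp add: power2_eq_square)
    moreover have "(\<integral>\<^sup>+\<rho>. indicator {0..1::real} \<rho> \<partial>lborel) = (1::ennreal)" by simp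
    ultimately show ?thesis by (subst nn_integral_add) auto
  qed
  finally have "(\<integral>\<^sup>+t. ennreal (gbound k t) \<partial>dw k) \<le> ennreal ?D * (ennreal (real (k+1) * 2 ^ k) * ennreal 2)"
    by (simp add: mult_left_mono)
  also have "\<dots> < \<infinity>"
    by (simp add: ennreal_mult_less_top)
  finally have fin: "(\<integral>\<^sup>+t. ennreal (gbound k t) \<partial>dw k) < \<infinity>" .
  show ?thesis
    by (rule integrableI_nonneg) (use fin in \<open>auto simp: gbound_nonneg\<close>)
qed

section \<open>Centred characteristic functions\<close>

definition cexp :: "nat \<Rightarrow> (nat \<Rightarrow> real) \<Rightarrow> (nat \<Rightarrow> real) \<Rightarrow> complex" where
  "cexp k t v = exp (\<i> * complex_of_real (vinner k t v))"

definition cdev :: "nat \<Rightarrow> nat \<Rightarrow> (nat \<Rightarrow> nat \<Rightarrow> real) \<Rightarrow> (nat \<Rightarrow> real) \<Rightarrow> nat \<Rightarrow> complex" where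
  "cdev n k p t b = (1 / of_nat n) * (\<Sum>a=1..n. cexp k t (p a)) - cexp k t (p b)"

definition zstat ::
    "(nat \<Rightarrow> nat) \<Rightarrow> nat \<Rightarrow> nat set \<Rightarrow> (nat \<Rightarrow> nat \<Rightarrow> nat \<Rightarrow> real) \<Rightarrow> (nat \<Rightarrow> nat \<Rightarrow> real) \<Rightarrow> complex" where
  "zstat d n S x t = (1 / of_nat n) * (\<Sum>b=1..n. \<Prod>i\<in>S. cdev n (d i) (\<lambda>a. x a i) (t i) b)"

lemma theta_zstat:
  "theta d n S x = (\<integral>t. (cmod (zstat d n S x t))\<^sup>2 \<partial>PiM S (\<lambda>i. dw (d i)))"
  unfolding theta_def zstat_def cdev_def cexp_def ..

lemma theta_nonneg: "0 \<le> theta d n S x"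
  unfolding theta_zstat by simp

lemma norm_cexp[simp]: "cmod (cexp k t v) = 1"
  unfolding cexp_def by (simp add: norm_exp_i_times)

lemma cmod_iexp_diff_le: "cmod (iexp a - iexp b) \<le> \<bar>a - b\<bar>"
proof -
  have "iexp a - iexp b = iexp b * (iexp (a - b) - 1)"
    by (simp add: algebra_simps flip: exp_add)
  then have "cmod (iexp a - iexp b) = cmod (iexp (a - b) - 1)"
    by (simp add: norm_mult)
  also have "\<dots> \<le> \<bar>a - b\<bar>"
    using iexp_approx1[of "a - b" 0] by simp
  finally show ?thesis .
qed

lemma cexp_diff_le:
  assumes "v \<in> unit_cube k" "w \<in> unit_cube k"
  shows "cmod (cexp k t v - cexp k t w) \<le> min 2 (\<Sum>j=1..k. \<bar>t j\<bar>)"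
proof -
  have "cmod (cexp k t v - cexp k t w) \<le> \<bar>vinner k t v - vinner k t w\<bar>"
    unfolding cexp_def by (rule cmod_iexp_diff_le)
  also have "\<dots> = \<bar>\<Sum>j=1..k. t j * (v j - w j)\<bar>"
    by (simp add: vinner_def sum_subtractf algebra_simps)
  also have "\<dots> \<le> (\<Sum>j=1..k. \<bar>t j * (v j - w j)\<bar>)" by (rule sum_abs)
  also have "\<dots> \<le> (\<Sum>j=1..k. \<bar>t j\<bar>)"
  proof (intro sum_mono)
    fix j assume j: "j \<in> {1..k}"
    then have "v j \<in> {0..1}" "w j \<in> {0..1}" using assms unfolding unit_cube_def by (auto simp: PiE_iff)
    then have "\<bar>v j - w j\<bar> \<le> 1" by auto
    then show "\<bar>t j * (v j - w j)\<bar> \<le> \<bar>t j\<bar>" by (simp add: abs_mult mult_left_le)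
  qed
  finally have "cmod (cexp k t v - cexp k t w) \<le> (\<Sum>j=1..k. \<bar>t j\<bar>)" .
  moreover have "cmod (cexp k t v - cexp k t w) \<le> 2"
    using norm_triangle_ineq4[of "cexp k t v" "cexp k t w"] by simp
  ultimately show ?thesis by simp
qed

lemma cdev_bound:
  assumes p: "\<And>a. a \<in> {1..n} \<Longrightarrow> p a \<in> unit_cube k" and b: "b \<in> {1..n}"
  shows "cmod (cdev n k p t b) \<le> min 2 (\<Sum>j=1..k. \<bar>t j\<bar>)"
proof -
  have n: "n \<noteq> 0" using b by auto
  have "cdev n k p t b = (1 / of_nat n) * (\<Sum>a=1..n. cexp k t (p a) - cexp k t (p b))"
    using n by (simp add: cdev_def sum_subtractf algebra_simps)
  then have "cmod (cdev n k p t b) = (1 / n) * cmod (\<Sum>a=1..n. cexp k t (p a) - cexp k t (p b))"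
    by (simp add: norm_mult norm_divide)
  also have "\<dots> \<le> (1 / n) * (\<Sum>a=1..n. min 2 (\<Sum>j=1..k. \<bar>t j\<bar>))"
    by (intro mult_left_mono sum_norm_le cexp_diff_le p b) auto
  also have "\<dots> = min 2 (\<Sum>j=1..k. \<bar>t j\<bar>)" using n by simp
  finally show ?thesis .
qed

text \<open>Centring is used twice: it yields the negative correlation under a random permutation,
  and it removes the one-element subsets in \<open>dep_jexp\<close>.\<close>

lemma sum_cdev: "(\<Sum>b=1..n. cdev n k p t b) = 0"
  by (cases "n = 0") (simp_all add: cdev_def sum_subtractf)

lemma vinner_measurable[measurable]: "(\<lambda>t. vinner k t v) \<in> borel_measurable (PiM {1..k} (\<lambda>_. borel))"
  unfolding vinner_def by measurable

lemma cdev_measurable[measurable]: "(\<lambda>t. cdev n k p t b) \<in> borel_measurable (PiM {1..k} (\<lambda>_. borel))"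
  unfolding cdev_def cexp_def by measurable

lemma zstat_measurable[measurable]:
  "(\<lambda>t. zstat d n S x t) \<in> borel_measurable (PiM S (\<lambda>i. dw (d i)))"
proof -
  have *: "(\<lambda>t. cdev n (d i) (\<lambda>a. x a i) (t i) b) \<in> borel_measurable (PiM S (\<lambda>i. dw (d i)))" if "i \<in> S" for i b
    by (rule measurable_compose[OF measurable_component_singleton[OF that]]) measurable
  show ?thesis unfolding zstat_def
    by (intro borel_measurable_times borel_measurable_sum borel_measurable_prod *) auto
qed

lemma zstat_bound:
  assumes x: "\<And>a i. a \<in> {1..n} \<Longrightarrow> i \<in> S \<Longrightarrow> x a i \<in> unit_cube (d i)"
  shows "(cmod (zstat d n S x t))\<^sup>2 \<le> (\<Prod>i\<in>S. gbound (d i) (t i))"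
proof -
  let ?m = "\<lambda>i. min 2 (\<Sum>j=1..d i. \<bar>t i j\<bar>)"
  have m: "0 \<le> ?m i" for i by (simp add: sum_nonneg)
  have "cmod (zstat d n S x t) = (1 / n) * cmod (\<Sum>b=1..n. \<Prod>i\<in>S. cdev n (d i) (\<lambda>a. x a i) (t i) b)"
    by (simp add: zstat_def norm_mult norm_divide)
  also have "\<dots> \<le> (1 / n) * (\<Sum>b=1..n. \<Prod>i\<in>S. ?m i)"
    by (intro mult_left_mono sum_norm_le)
      (auto simp: prod_norm[symmetric] intro!: prod_mono cdev_bound[simplified] x)
  also have "\<dots> \<le> (\<Prod>i\<in>S. ?m i)"
    using m by (cases "n = 0") (auto intro!: prod_nonneg)
  finally have "(cmod (zstat d n S x t))\<^sup>2 \<le> (\<Prod>i\<in>S. ?m i)\<^sup>2"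
    by (intro power_mono) auto
  also have "\<dots> = (\<Prod>i\<in>S. gbound (d i) (t i))"
    by (simp add: gbound_def prod_power_distrib)
  finally show ?thesis .
qed

lemma product_sigma_finite_dw: "product_sigma_finite (\<lambda>i. dw (d i))"
  unfolding product_sigma_finite_def by (simp add: sigma_finite_dw)

lemma prod_gbound_integrable:
  assumes "finite S" "\<And>i. i \<in> S \<Longrightarrow> d i \<ge> 1"
  shows "integrable (PiM S (\<lambda>i. dw (d i))) (\<lambda>t. \<Prod>i\<in>S. gbound (d i) (t i))"
  using product_sigma_finite.product_integrable_prod
    [OF product_sigma_finite_dw[of d] assms(1), of "\<lambda>i. gbound (d i)"] gbound_integrable assms(2)
  by simp

lemma zstat_integrable:
  assumes "finite S" "\<And>i. i \<in> S \<Longrightarrow> d i \<ge> 1"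
    and "\<And>a i. a \<in> {1..n} \<Longrightarrow> i \<in> S \<Longrightarrow> x a i \<in> unit_cube (d i)"
  shows "integrable (PiM S (\<lambda>i. dw (d i))) (\<lambda>t. (cmod (zstat d n S x t))\<^sup>2)"
  by (rule Bochner_Integration.integrable_bound[OF prod_gbound_integrable[of S d]])
    (use assms zstat_bound[of n S x d] in \<open>auto simp: prod_nonneg gbound_nonneg\<close>)

section \<open>Resampled statistics\<close>

text \<open>Second moments of a randomly permuted centred sequence: off the diagonal the correlations all
  agree, hence equal minus the diagonal one divided by n - 1.\<close>

lemma permuted_correlation:
  fixes \<xi> :: "nat \<Rightarrow> complex" and n :: nat
  defines "P \<equiv> {\<pi>. \<pi> permutes {1..n}}"
  assumes z: "(\<Sum>b=1..n. \<xi> b) = 0" and b: "b \<in> {1..n}" "b' \<in> {1..n}" "b \<noteq> b'"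
  shows "(of_nat n - 1) * (\<Sum>\<pi>\<in>P. \<xi> (\<pi> b) * cnj (\<xi> (\<pi> b'))) = - (\<Sum>\<pi>\<in>P. \<xi> (\<pi> b) * cnj (\<xi> (\<pi> b)))"
proof -
  let ?A = "\<lambda>c. \<Sum>\<pi>\<in>P. \<xi> (\<pi> b) * cnj (\<xi> (\<pi> c))"
  have eq: "?A c = ?A b'" if c: "c \<in> {1..n} - {b}" for c
  proof -
    \<comment> \<open>Composing with this transposition rearranges the summands; it fixes
      \<open>b\<close>, which differs from \<open>b'\<close> and \<open>c\<close>, and sends
      \<open>b'\<close> to \<open>c\<close>.\<close>
    let ?\<tau> = "Transposition.transpose b' c"
    have \<tau>: "?\<tau> permutes {1..n}" using b c by (intro permutes_swap_id) auto
    have "?A b' = (\<Sum>\<pi>\<in>P. \<xi> ((\<pi> \<circ> ?\<tau>) b) * cnj (\<xi> ((\<pi> \<circ> ?\<tau>) b')))"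
      unfolding P_def using sum_permutations_compose_right[OF \<tau>, of "\<lambda>\<pi>. \<xi> (\<pi> b) * cnj (\<xi> (\<pi> b'))"]
      by simp
    also have "\<dots> = ?A c" using b c by (simp add: Transposition.transpose_def)
    finally show ?thesis by simp
  qed
  \<comment> \<open>For one permutation the values at all indices \<open>c\<close> add up to the
    total of \<open>\<xi>\<close>, which is 0; this ties the diagonal term to the n - 1 equal
    off-diagonal ones.\<close>
  have "(\<Sum>c=1..n. ?A c) = (\<Sum>\<pi>\<in>P. \<xi> (\<pi> b) * cnj (\<Sum>c=1..n. \<xi> (\<pi> c)))"
    by (subst sum.swap) (simp add: sum_distrib_left)
  also have "\<dots> = 0"
  proof (intro sum.neutral ballI)
    fix \<pi> assume "\<pi> \<in> P"
    then have "(\<Sum>c=1..n. \<xi> (\<pi> c)) = (\<Sum>c=1..n. \<xi> c)"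
      unfolding P_def using sum.permute[of \<pi> "{1..n}" \<xi>] by (simp add: o_def)
    then show "\<xi> (\<pi> b) * cnj (\<Sum>c=1..n. \<xi> (\<pi> c)) = 0" using z by simp
  qed
  finally have "?A b + (\<Sum>c\<in>{1..n}-{b}. ?A c) = 0"
    using b by (subst sum.remove[symmetric]) auto
  moreover have "(\<Sum>c\<in>{1..n}-{b}. ?A c) = (\<Sum>c\<in>{1..n}-{b}. ?A b')"
    by (intro sum.cong refl eq)
  moreover have "\<dots> = (of_nat n - 1) * ?A b'"
    using b by (simp add: of_nat_diff)
  ultimately have "?A b + (of_nat n - 1) * ?A b' = 0" by (simp only:)
  then show ?thesis unfolding add_eq_0_iff .
qed

text \<open>Each of the n diagonal terms is at most v^2 g^2, and the bound for the n (n - 1)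
  off-diagonal ones is smaller by the factor n - 1, so both groups contribute n v^2 g^2. The gain
  over the trivial n^2 is what makes the resampled statistics vanish.\<close>

lemma permuted_sum_second_moment:
  fixes \<xi> w :: "nat \<Rightarrow> complex" and n :: nat and g v :: real
  defines "P \<equiv> {\<pi>. \<pi> permutes {1..n}}"
  assumes n: "n \<ge> 2" and z: "(\<Sum>b=1..n. \<xi> b) = 0"
    and G: "\<And>b. b \<in> {1..n} \<Longrightarrow> cmod (\<xi> b) \<le> g" and W: "\<And>b. b \<in> {1..n} \<Longrightarrow> cmod (w b) \<le> v"
  shows "(\<Sum>\<pi>\<in>P. (cmod (\<Sum>b=1..n. w b * \<xi> (\<pi> b)))\<^sup>2) \<le> card P * (2 * n * (v\<^sup>2 * g\<^sup>2))"
proof -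
  let ?A = "\<lambda>b c. \<Sum>\<pi>\<in>P. \<xi> (\<pi> b) * cnj (\<xi> (\<pi> c))"
  have g0: "0 \<le> g" using n by (intro order_trans[OF norm_ge_zero G[of 1]]) auto
  have v0: "0 \<le> v" using n by (intro order_trans[OF norm_ge_zero W[of 1]]) auto
  have diag: "cmod (?A b b) \<le> card P * g\<^sup>2" if b: "b \<in> {1..n}" for b
  proof -
    have "cmod (?A b b) \<le> (\<Sum>\<pi>\<in>P. g\<^sup>2)"
    proof (intro sum_norm_le)
      fix \<pi> assume "\<pi> \<in> P"
      then have "\<pi> b \<in> {1..n}" unfolding P_def using permutes_in_image[of \<pi> "{1..n}" b] b by simp
      then show "cmod (\<xi> (\<pi> b) * cnj (\<xi> (\<pi> b))) \<le> g\<^sup>2"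
        using G[of "\<pi> b"] by (auto simp: norm_mult power2_eq_square intro!: mult_mono g0)
    qed
    then show ?thesis by simp
  qed
  have off: "cmod (?A b c) \<le> card P * g\<^sup>2 / (n - 1)" if bc: "b \<in> {1..n}" "c \<in> {1..n}" "b \<noteq> c" for b c
  proof -
    have "(of_nat n - 1) * ?A b c = - ?A b b"
      unfolding P_def using permuted_correlation[OF z bc] .
    then have "cmod ((of_nat n - 1) * ?A b c) = cmod (?A b b)"
      by (simp add: norm_minus_cancel)
    moreover have "cmod (of_nat n - 1) = real n - 1"
      using n by (metis of_nat_1 of_nat_diff norm_of_nat one_le_numeral order_trans)
    ultimately have "(real n - 1) * cmod (?A b c) \<le> card P * g\<^sup>2"
      using diag[OF bc(1)] by (simp add: norm_mult)
    then show ?thesis using n by (simp add: pos_le_divide_eq mult.commute of_nat_diff)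
  qed
  have "complex_of_real (\<Sum>\<pi>\<in>P. (cmod (\<Sum>b=1..n. w b * \<xi> (\<pi> b)))\<^sup>2)
      = (\<Sum>\<pi>\<in>P. (\<Sum>b=1..n. w b * \<xi> (\<pi> b)) * cnj (\<Sum>b=1..n. w b * \<xi> (\<pi> b)))"
    by (simp only: of_real_sum complex_norm_square)
  also have "\<dots> = (\<Sum>\<pi>\<in>P. \<Sum>b=1..n. \<Sum>c=1..n. (w b * cnj (w c)) * (\<xi> (\<pi> b) * cnj (\<xi> (\<pi> c))))"
    unfolding cnj_sum complex_cnj_mult sum_product
    by (intro sum.cong refl) (simp only: mult.assoc mult.left_commute)
  also have "\<dots> = (\<Sum>b=1..n. \<Sum>\<pi>\<in>P. \<Sum>c=1..n. (w b * cnj (w c)) * (\<xi> (\<pi> b) * cnj (\<xi> (\<pi> c))))"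
    by (rule sum.swap)
  also have "\<dots> = (\<Sum>b=1..n. \<Sum>c=1..n. \<Sum>\<pi>\<in>P. (w b * cnj (w c)) * (\<xi> (\<pi> b) * cnj (\<xi> (\<pi> c))))"
    by (intro sum.cong refl sum.swap)
  also have "\<dots> = (\<Sum>b=1..n. \<Sum>c=1..n. (w b * cnj (w c)) * ?A b c)"
    by (simp only: sum_distrib_left)
  finally have e: "complex_of_real (\<Sum>\<pi>\<in>P. (cmod (\<Sum>b=1..n. w b * \<xi> (\<pi> b)))\<^sup>2)
      = (\<Sum>b=1..n. \<Sum>c=1..n. (w b * cnj (w c)) * ?A b c)" .
  have "0 \<le> (\<Sum>\<pi>\<in>P. (cmod (\<Sum>b=1..n. w b * \<xi> (\<pi> b)))\<^sup>2)" by (intro sum_nonneg) simp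
  then have "(\<Sum>\<pi>\<in>P. (cmod (\<Sum>b=1..n. w b * \<xi> (\<pi> b)))\<^sup>2)
      = cmod (\<Sum>b=1..n. \<Sum>c=1..n. (w b * cnj (w c)) * ?A b c)"
    unfolding e[symmetric] norm_of_real by (rule abs_of_nonneg[symmetric])
  also have "\<dots> \<le> (\<Sum>b=1..n. 2 * card P * (v\<^sup>2 * g\<^sup>2))"
  proof (intro sum_norm_le)
    fix b assume b: "b \<in> {1..n}"
    have ww: "cmod (w b * cnj (w c)) \<le> v\<^sup>2" if "c \<in> {1..n}" for c
      using W[OF b] W[OF that] v0 by (auto simp: norm_mult power2_eq_square intro!: mult_mono)
    have "cmod (\<Sum>c=1..n. (w b * cnj (w c)) * ?A b c) \<le> (\<Sum>c=1..n. v\<^sup>2 * cmod (?A b c))"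
    proof (intro sum_norm_le)
      fix c assume "c \<in> {1..n}"
      then show "cmod ((w b * cnj (w c)) * ?A b c) \<le> v\<^sup>2 * cmod (?A b c)"
        unfolding norm_mult[of _ "?A b c"] by (intro mult_right_mono ww norm_ge_zero)
    qed
    also have "\<dots> = v\<^sup>2 * cmod (?A b b) + (\<Sum>c\<in>{1..n}-{b}. v\<^sup>2 * cmod (?A b c))"
      using b by (intro sum.remove) auto
    also have "\<dots> \<le> v\<^sup>2 * (card P * g\<^sup>2) + (\<Sum>c\<in>{1..n}-{b}. v\<^sup>2 * (card P * g\<^sup>2 / (n - 1)))"
      using b by (intro add_mono mult_left_mono sum_mono diag off) auto
    also have "\<dots> = 2 * card P * (v\<^sup>2 * g\<^sup>2)"
      using b n by (simp add: field_simps)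
    finally show "cmod (\<Sum>c=1..n. (w b * cnj (w c)) * ?A b c) \<le> 2 * card P * (v\<^sup>2 * g\<^sup>2)" .
  qed
  also have "\<dots> = card P * (2 * n * (v\<^sup>2 * g\<^sup>2))" by simp
  finally show ?thesis .
qed

lemma theta_permutation_average:
  fixes n :: nat
  defines "P \<equiv> {\<pi>. \<pi> permutes {1..n}}"
  assumes n: "n \<ge> 2" and S: "finite S" "i0 \<in> S" and d: "\<And>i. i \<in> S \<Longrightarrow> d i \<ge> 1"
    and x: "\<And>a i. a \<in> {1..n} \<Longrightarrow> i \<in> S \<Longrightarrow> x a i \<in> unit_cube (d i)"
    and p: "\<And>a. a \<in> {1..n} \<Longrightarrow> p a \<in> unit_cube (d i0)"
  shows "(\<Sum>\<pi>\<in>P. theta d n S (\<lambda>a i. if i = i0 then p (\<pi> a) else x a i))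
    \<le> card P * (2 / n * (\<Prod>i\<in>S. \<integral>t. gbound (d i) t \<partial>dw (d i)))"
proof -
  let ?x = "\<lambda>\<pi> a i. if i = i0 then p (\<pi> a) else x a i"
  let ?\<nu> = "PiM S (\<lambda>i. dw (d i))"
  have cube: "?x \<pi> a i \<in> unit_cube (d i)" if "\<pi> \<in> P" "a \<in> {1..n}" "i \<in> S" for \<pi> a i
    using that x p permutes_in_image[of \<pi> "{1..n}" a] by (auto simp: P_def)
  have int: "integrable ?\<nu> (\<lambda>t. (cmod (zstat d n S (?x \<pi>) t))\<^sup>2)" if "\<pi> \<in> P" for \<pi>
    by (intro zstat_integrable S d cube that)
  have pw: "(\<Sum>\<pi>\<in>P. (cmod (zstat d n S (?x \<pi>) t))\<^sup>2) \<le> card P * (2 / n) * (\<Prod>i\<in>S. gbound (d i) (t i))" for t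
  proof -
    let ?\<xi> = "cdev n (d i0) p (t i0)"
    let ?w = "\<lambda>b. \<Prod>i\<in>S-{i0}. cdev n (d i) (\<lambda>a. x a i) (t i) b"
    let ?m = "\<lambda>i. min 2 (\<Sum>j=1..d i. \<bar>t i j\<bar>)"
    have m: "0 \<le> ?m i" for i by (simp add: sum_nonneg)
    \<comment> \<open>A permutation leaves the mean of the block unchanged, so the centred factor of
      the permuted block is the old one evaluated at \<open>\<pi> b\<close>.\<close>
    have z: "zstat d n S (?x \<pi>) t = (1 / of_nat n) * (\<Sum>b=1..n. ?w b * ?\<xi> (\<pi> b))" if "\<pi> \<in> P" for \<pi>
    proof -
      have "cdev n (d i0) (\<lambda>a. p (\<pi> a)) (t i0) b = ?\<xi> (\<pi> b)" for b
        using sum.permute[of \<pi> "{1..n}" "\<lambda>a. cexp (d i0) (t i0) (p a)"] that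
        by (simp add: cdev_def P_def o_def)
      then have "(\<Prod>i\<in>S. cdev n (d i) (\<lambda>a. ?x \<pi> a i) (t i) b) = ?w b * ?\<xi> (\<pi> b)" for b
        using S by (simp add: prod.remove[OF S] mult.commute)
      then show ?thesis unfolding zstat_def by simp
    qed
    have "(\<Sum>\<pi>\<in>P. (cmod (zstat d n S (?x \<pi>) t))\<^sup>2)
        = (1 / n)\<^sup>2 * (\<Sum>\<pi>\<in>P. (cmod (\<Sum>b=1..n. ?w b * ?\<xi> (\<pi> b)))\<^sup>2)"
      unfolding sum_distrib_left
      by (intro sum.cong refl, subst z) (simp_all add: norm_mult norm_divide power_mult_distrib power_divide)
    also have "\<dots> \<le> (1 / n)\<^sup>2 * (card P * (2 * n * ((\<Prod>i\<in>S-{i0}. ?m i)\<^sup>2 * (?m i0)\<^sup>2)))"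
      unfolding P_def
      by (intro mult_left_mono permuted_sum_second_moment n sum_cdev cdev_bound p)
        (auto simp: prod_norm[symmetric] intro!: prod_mono cdev_bound[simplified] x)
    also have "(\<Prod>i\<in>S-{i0}. ?m i)\<^sup>2 * (?m i0)\<^sup>2 = (\<Prod>i\<in>S. gbound (d i) (t i))"
      by (simp add: prod.remove[OF S] gbound_def prod_power_distrib mult.commute)
    also have "(1 / n)\<^sup>2 * (card P * (2 * n * (\<Prod>i\<in>S. gbound (d i) (t i))))
        = card P * (2 / n) * (\<Prod>i\<in>S. gbound (d i) (t i))"
      using n by (simp add: field_simps power2_eq_square)
    finally show ?thesis .
  qed
  have "(\<Sum>\<pi>\<in>P. theta d n S (?x \<pi>)) = (\<integral>t. (\<Sum>\<pi>\<in>P. (cmod (zstat d n S (?x \<pi>) t))\<^sup>2) \<partial>?\<nu>)"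
    unfolding theta_zstat by (intro Bochner_Integration.integral_sum[symmetric] int)
  also have "\<dots> \<le> (\<integral>t. card P * (2 / n) * (\<Prod>i\<in>S. gbound (d i) (t i)) \<partial>?\<nu>)"
    by (intro integral_mono Bochner_Integration.integrable_sum int pw
        Bochner_Integration.integrable_mult_right prod_gbound_integrable S d)
  also have "\<dots> = card P * (2 / n) * (\<Prod>i\<in>S. \<integral>t. gbound (d i) t \<partial>dw (d i))"
    using product_sigma_finite.product_integral_prod[OF product_sigma_finite_dw[of d] S(1), of "\<lambda>i. gbound (d i)"]
      gbound_integrable d by simp
  finally show ?thesis by (simp add: mult.assoc)
qed

section \<open>Finite product spaces of permutations\<close>

lemma sets_finite_discrete:
  assumes "finite (space M)" "\<And>x. x \<in> space M \<Longrightarrow> {x} \<in> sets M"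
  shows "sets M = Pow (space M)"
proof
  show "sets M \<subseteq> Pow (space M)" using sets.sets_into_space by blast
  show "Pow (space M) \<subseteq> sets M"
  proof
    fix A assume A: "A \<in> Pow (space M)"
    then have "finite A" using assms(1) finite_subset by blast
    then have "(\<Union>x\<in>A. {x}) \<in> sets M" using A assms(2) by (intro sets.finite_UN) auto
    then show "A \<in> sets M" by simp
  qed
qed

lemma sets_PiM_uniform_count:
  assumes "finite J" "finite P"
  shows "sets (PiM J (\<lambda>_. uniform_count_measure P)) = Pow (PiE J (\<lambda>_. P))"
proof -
  let ?M = "PiM J (\<lambda>_. uniform_count_measure P)"
  have sp: "space ?M = PiE J (\<lambda>_. P)" by (simp add: space_PiM space_uniform_count_measure)
  have "sets ?M = Pow (space ?M)"
  proof (rule sets_finite_discrete)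
    show "finite (space ?M)" unfolding sp using assms by (intro finite_PiE) auto
    fix x assume x: "x \<in> space ?M"
    then have "{x} = PiE J (\<lambda>j. {x j})"
      unfolding sp by (intro PiE_singleton[symmetric]) (simp add: PiE_iff)
    moreover have "PiE J (\<lambda>j. {x j}) \<in> sets ?M"
      using x assms by (intro sets_PiM_I_finite) (auto simp: sp sets_uniform_count_measure)
    ultimately show "{x} \<in> sets ?M" by simp
  qed
  then show ?thesis unfolding sp .
qed

lemma measurable_discrete:
  assumes "sets M = Pow (space M)" "f \<in> space M \<rightarrow> space N"
  shows "f \<in> measurable M N"
  using assms by (auto simp: measurable_def)

lemma JdCov_stat_nonneg:
  assumes "\<And>s. s \<in> {2..r} \<Longrightarrow> C s > 0"
  shows "0 \<le> JdCov_stat r d n C x"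
  unfolding JdCov_stat_def
  by (intro sum_nonneg mult_nonneg_nonneg theta_nonneg) (use assms in \<open>auto intro: less_imp_le\<close>)

text \<open>2 / n times this constant bounds the mean of a resampled statistic; the constant depends
  on the dimensions and the weights, but on neither n nor the grid.\<close>

definition resample_const :: "nat \<Rightarrow> (nat \<Rightarrow> nat) \<Rightarrow> (nat \<Rightarrow> real) \<Rightarrow> real" where
  "resample_const r d C = (\<Sum>s=2..r. C s * (\<Sum>S | S \<subseteq> {1..r} \<and> card S = s.
      (\<Prod>i\<in>S. \<integral>t. gbound (d i) t \<partial>dw (d i))))"

lemma prob_space_permutations:
  "finite A \<Longrightarrow> prob_space (uniform_count_measure {\<pi>. \<pi> permutes A})"
  by (intro prob_space_uniform_count_measure) (auto simp: finite_permutations intro: permutes_id)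

text \<open>Fubini's theorem isolates the permutation with index \<open>(b, i0)\<close> for one
  block \<open>i0\<close> of \<open>S\<close>; with all others fixed, the average over it is bounded
  by \<open>theta_permutation_average\<close>.\<close>

lemma resampled_theta_bound:
  fixes n :: nat and B r :: nat and h d
  defines "P \<equiv> {\<pi>. \<pi> permutes {1..n}}"
  defines "Q \<equiv> PiM ({1..B} \<times> {1..r}) (\<lambda>_. uniform_count_measure P)"
  assumes n: "n \<ge> 2" and S: "S \<subseteq> {1..r}" "S \<noteq> {}" and d: "\<And>i. i \<in> {1..r} \<Longrightarrow> d i \<ge> 1"
    and h: "\<And>i a. i \<in> {1..r} \<Longrightarrow> a \<in> {1..n} \<Longrightarrow> h n (d i) a \<in> unit_cube (d i)"
    and b: "b \<in> {1..B}"
  shows "(\<integral>\<^sup>+\<pi>. ennreal (theta d n S (\<lambda>a i. h n (d i) (\<pi> (b, i) a))) \<partial>Q)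
    \<le> ennreal (2 / n * (\<Prod>i\<in>S. \<integral>t. gbound (d i) t \<partial>dw (d i)))"
proof -
  have finP: "finite P" unfolding P_def by (simp add: finite_permutations)
  have cP: "card P > 0" unfolding P_def by (simp add: card_permutations[OF refl])
  interpret U: prob_space "uniform_count_measure P" unfolding P_def by (rule prob_space_permutations) simp
  interpret PU: product_prob_space "\<lambda>_. uniform_count_measure P" by standard
  obtain i0 where i0: "i0 \<in> S" using S by auto
  have finS: "finite S" using S finite_subset by blast
  let ?J = "{1..B} \<times> {1..r}"
  let ?J' = "?J - {(b, i0)}"
  let ?f = "\<lambda>\<pi>. ennreal (theta d n S (\<lambda>a i. h n (d i) (\<pi> (b, i) a)))"
  let ?K = "2 / n * (\<Prod>i\<in>S. \<integral>t. gbound (d i) t \<partial>dw (d i))"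
  have J: "?J = insert (b, i0) ?J'" using b i0 S by auto
  have fm: "?f \<in> borel_measurable (PiM (insert (b, i0) ?J') (\<lambda>_. uniform_count_measure P))"
    unfolding J[symmetric] using finP
    by (intro measurable_discrete) (auto simp: sets_PiM_uniform_count space_PiM space_uniform_count_measure)
  interpret R: prob_space "PiM ?J' (\<lambda>_. uniform_count_measure P)" by (rule prob_space_PiM) unfold_locales
  have "integral\<^sup>N Q ?f = (\<integral>\<^sup>+\<rho>. (\<integral>\<^sup>+\<sigma>. ?f (\<rho>((b, i0) := \<sigma>)) \<partial>uniform_count_measure P) \<partial>PiM ?J' (\<lambda>_. uniform_count_measure P))"
    unfolding Q_def by (subst J, rule PU.product_nn_integral_insert) (use fm in auto)
  also have "\<dots> \<le> (\<integral>\<^sup>+\<rho>. ennreal ?K \<partial>PiM ?J' (\<lambda>_. uniform_count_measure P))"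
  proof (intro nn_integral_mono)
    fix \<rho> assume \<rho>: "\<rho> \<in> space (PiM ?J' (\<lambda>_. uniform_count_measure P))"
    let ?x = "\<lambda>a i. if i = i0 then h n (d i0) a else h n (d i) (\<rho> (b, i) a)"
    have xx: "(\<lambda>a i. h n (d i) ((\<rho>((b, i0) := \<sigma>)) (b, i) a)) = (\<lambda>a i. if i = i0 then h n (d i0) (\<sigma> a) else ?x a i)" for \<sigma>
      by (auto simp: fun_eq_iff)
    have cube: "?x a i \<in> unit_cube (d i)" if "a \<in> {1..n}" "i \<in> S" for a i
    proof (cases "i = i0")
      case False
      then have "\<rho> (b, i) \<in> P" using \<rho> that S b by (auto simp: space_PiM space_uniform_count_measure PiE_iff)
      then have "\<rho> (b, i) a \<in> {1..n}" using that permutes_in_image[of "\<rho> (b,i)" "{1..n}" a] by (auto simp: P_def)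
      then show ?thesis using h that S False by auto
    qed (use h that S in auto)
    have "(\<integral>\<^sup>+\<sigma>. ?f (\<rho>((b, i0) := \<sigma>)) \<partial>uniform_count_measure P)
        = (\<Sum>\<sigma>\<in>P. ennreal (1 / card P) * ennreal (theta d n S (\<lambda>a i. if i = i0 then h n (d i0) (\<sigma> a) else ?x a i)))"
      unfolding xx uniform_count_measure_def using finP by (rule nn_integral_point_measure_finite)
    also have "\<dots> = ennreal ((\<Sum>\<sigma>\<in>P. theta d n S (\<lambda>a i. if i = i0 then h n (d i0) (\<sigma> a) else ?x a i)) / card P)"
      by (simp add: theta_nonneg sum_nonneg ennreal_mult[symmetric] sum_ennreal sum_divide_distrib)
    also have "\<dots> \<le> ennreal ?K"
    proof (rule ennreal_leI)
      have "(\<Sum>\<sigma>\<in>P. theta d n S (\<lambda>a i. if i = i0 then h n (d i0) (\<sigma> a) else ?x a i)) \<le> card P * ?K"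
        unfolding P_def
        by (rule theta_permutation_average[OF n finS i0 _ cube]) (use d h S i0 in auto)
      then show "(\<Sum>\<sigma>\<in>P. theta d n S (\<lambda>a i. if i = i0 then h n (d i0) (\<sigma> a) else ?x a i)) / card P \<le> ?K"
        using cP by (simp add: divide_le_eq mult.commute)
    qed
    finally show "(\<integral>\<^sup>+\<sigma>. ?f (\<rho>((b, i0) := \<sigma>)) \<partial>uniform_count_measure P) \<le> ennreal ?K" .
  qed
  also have "\<dots> = ennreal ?K" by (subst nn_integral_const) (simp only: R.emeasure_space_1 mult_1_right)
  finally show ?thesis .
qed

text \<open>Markov's inequality. Integrals are taken in \<open>ennreal\<close>: on this finite
  discrete space every function is measurable, and integration commutes with the nonnegative
  sums.\<close>

lemma resampled_stat_tail:
  fixes n :: nat and B r :: nat and h d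
  defines "Q \<equiv> PiM ({1..B} \<times> {1..r}) (\<lambda>_. uniform_count_measure {\<pi>. \<pi> permutes {1..n}})"
  assumes n: "n \<ge> 2" and d: "\<And>i. i \<in> {1..r} \<Longrightarrow> d i \<ge> 1"
    and h: "\<And>i a. i \<in> {1..r} \<Longrightarrow> a \<in> {1..n} \<Longrightarrow> h n (d i) a \<in> unit_cube (d i)"
    and C: "\<And>s. s \<in> {2..r} \<Longrightarrow> C s > 0" and b: "b \<in> {1..B}" and c: "c > 0"
  shows "measure Q {\<pi> \<in> space Q. c \<le> resampled_stat h r d n C (\<lambda>i. \<pi> (b, i))} \<le> 2 / n * resample_const r d C / c"
proof -
  let ?P = "{\<pi>. \<pi> permutes {1..n}}"
  let ?T = "\<lambda>\<pi>. resampled_stat h r d n C (\<lambda>i. \<pi> (b, i))"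
  let ?th = "\<lambda>S \<pi>. theta d n S (\<lambda>a i. h n (d i) (\<pi> (b, i) a))"
  let ?K = "\<lambda>S. \<Prod>i\<in>S. \<integral>t. gbound (d i) t \<partial>dw (d i)"
  have finP: "finite ?P" by (simp add: finite_permutations)
  interpret Q: prob_space Q unfolding Q_def by (intro prob_space_PiM prob_space_permutations) simp
  have meas: "f \<in> borel_measurable Q" for f :: "_ \<Rightarrow> ennreal"
    unfolding Q_def using finP
    by (intro measurable_discrete) (auto simp: sets_PiM_uniform_count space_PiM space_uniform_count_measure)
  have Kn: "0 \<le> ?K S" for S by (intro prod_nonneg ballI Bochner_Integration.integral_nonneg gbound_nonneg)
  have "(\<integral>\<^sup>+\<pi>. ennreal (?T \<pi>) \<partial>Q)
      = (\<integral>\<^sup>+\<pi>. (\<Sum>s=2..r. ennreal (C s) * (\<Sum>S | S \<subseteq> {1..r} \<and> card S = s. ennreal (?th S \<pi>))) \<partial>Q)"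
  proof (intro nn_integral_cong)
    fix \<pi>
    have "ennreal (?T \<pi>) = (\<Sum>s=2..r. ennreal (C s * (\<Sum>S | S \<subseteq> {1..r} \<and> card S = s. ?th S \<pi>)))"
      unfolding resampled_stat_def JdCov_stat_def
      by (intro sum_ennreal[symmetric] mult_nonneg_nonneg sum_nonneg theta_nonneg) (use C less_imp_le in blast)
    also have "\<dots> = (\<Sum>s=2..r. ennreal (C s) * (\<Sum>S | S \<subseteq> {1..r} \<and> card S = s. ennreal (?th S \<pi>)))"
      using C by (intro sum.cong refl)
        (simp add: ennreal_mult less_imp_le sum_nonneg theta_nonneg)
    finally show "ennreal (?T \<pi>) = \<dots>" .
  qed
  also have "\<dots> = (\<Sum>s=2..r. ennreal (C s) * (\<Sum>S | S \<subseteq> {1..r} \<and> card S = s. (\<integral>\<^sup>+\<pi>. ennreal (?th S \<pi>) \<partial>Q)))"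
    by (simp add: nn_integral_sum nn_integral_cmult meas)
  also have "\<dots> \<le> (\<Sum>s=2..r. ennreal (C s) * (\<Sum>S | S \<subseteq> {1..r} \<and> card S = s. ennreal (2 / n * ?K S)))"
  proof (intro sum_mono mult_left_mono)
    fix s S assume "s \<in> {2..r}" and S: "S \<in> {S. S \<subseteq> {1..r} \<and> card S = s}"
    then have "S \<noteq> {}" "S \<subseteq> {1..r}" by auto
    then show "(\<integral>\<^sup>+\<pi>. ennreal (?th S \<pi>) \<partial>Q) \<le> ennreal (2 / n * ?K S)"
      unfolding Q_def by (intro resampled_theta_bound n d h b)
  qed simp
  also have "\<dots> = (\<Sum>s=2..r. ennreal (C s * (\<Sum>S | S \<subseteq> {1..r} \<and> card S = s. 2 / n * ?K S)))"
    using C Kn by (intro sum.cong refl)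
      (simp add: ennreal_mult less_imp_le sum_nonneg)
  also have "\<dots> = ennreal (\<Sum>s=2..r. C s * (\<Sum>S | S \<subseteq> {1..r} \<and> card S = s. 2 / n * ?K S))"
    using Kn C by (intro sum_ennreal mult_nonneg_nonneg sum_nonneg) (auto intro: less_imp_le)
  also have "(\<Sum>s=2..r. C s * (\<Sum>S | S \<subseteq> {1..r} \<and> card S = s. 2 / n * ?K S)) = 2 / n * resample_const r d C"
    by (simp add: resample_const_def sum_distrib_left mult_ac)
  finally have I: "(\<integral>\<^sup>+\<pi>. ennreal (?T \<pi>) \<partial>Q) \<le> ennreal (2 / n * resample_const r d C)" .
  have rc: "0 \<le> resample_const r d C"
    unfolding resample_const_def using Kn C by (intro sum_nonneg mult_nonneg_nonneg) (auto intro: less_imp_le)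
  have "emeasure Q {\<pi> \<in> space Q. c \<le> ?T \<pi>} \<le> emeasure Q {\<pi> \<in> space Q. 1 \<le> ennreal (1 / c) * ennreal (?T \<pi>)}"
  proof (rule emeasure_mono)
    show "{\<pi> \<in> space Q. c \<le> ?T \<pi>} \<subseteq> {\<pi> \<in> space Q. 1 \<le> ennreal (1 / c) * ennreal (?T \<pi>)}"
      using c by (auto simp: ennreal_mult[symmetric] ennreal_1[symmetric] simp del: ennreal_1 intro!: ennreal_leI)
    show "{\<pi> \<in> space Q. 1 \<le> ennreal (1 / c) * ennreal (?T \<pi>)} \<in> sets Q"
      using meas[of "\<lambda>\<pi>. ennreal (1 / c) * ennreal (?T \<pi>)"] by measurable
  qed
  also have "\<dots> \<le> ennreal (1 / c) * (\<integral>\<^sup>+\<pi>. ennreal (?T \<pi>) * indicator (space Q) \<pi> \<partial>Q)"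
    by (rule nn_integral_Markov_inequality) (use meas in auto)
  also have "\<dots> = ennreal (1 / c) * (\<integral>\<^sup>+\<pi>. ennreal (?T \<pi>) \<partial>Q)"
    by (intro arg_cong2[where f = times] refl nn_integral_cong) simp
  also have "\<dots> \<le> ennreal (1 / c) * ennreal (2 / n * resample_const r d C)"
    by (intro mult_left_mono I) simp
  also have "\<dots> = ennreal (2 / n * resample_const r d C / c)"
    using c rc by (simp add: ennreal_mult[symmetric])
  finally show ?thesis
    using c rc unfolding Q.emeasure_eq_measure by (subst (asm) ennreal_le_iff) auto
qed

section \<open>Small statistics force joint characteristic functions to factorize\<close>

text \<open>Keeping the box off the coordinate hyperplanes keeps it off the origin, the point at
  which the density has the default value 0; elsewhere the density is strictly positive.\<close>

lemma dw_box_pos: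
  assumes k: "k \<ge> 1" and ab: "\<And>j. j \<in> {1..k} \<Longrightarrow> a j < b j \<and> 0 \<notin> {a j..b j}"
  shows "emeasure (dw k) (\<Pi>\<^sub>E j\<in>{1..k}. {a j..b j}) \<noteq> 0"
proof
  let ?A = "\<Pi>\<^sub>E j\<in>{1..k}. {a j..b j}"
  have A: "?A \<in> sets (lborel_vec k)"
    unfolding lborel_vec_def by (intro sets_PiM_I_finite) auto
  assume "emeasure (dw k) ?A = 0"
  then have "?A \<in> null_sets (dw k)" using A by (auto simp: null_sets_def dw_def)
  then have "AE t\<in>?A in lborel_vec k. ennreal (1 / (c_const k * L2_set t {1..k} ^ (1 + k))) = 0"
    unfolding dw_def by (subst (asm) null_sets_density_iff[OF dw_density_measurable]) auto
  then have "AE t in lborel_vec k. t \<notin> ?A"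
  proof eventually_elim
    case (elim t)
    show ?case
    proof
      assume t: "t \<in> ?A"
      have "t 1 \<in> {a 1..b 1}" using t k by (auto simp: PiE_iff)
      then have "t 1 \<noteq> 0" using ab[of 1] k by auto
      then have "L2_set t {1..k} > 0" using abs_le_L2_set[of "{1..k}" 1 t] k by auto
      then have "1 / (c_const k * L2_set t {1..k} ^ (1 + k)) > 0"
        using c_const_pos[of k] by simp
      then show False using elim t by (simp add: ennreal_eq_0_iff)
    qed
  qed
  then have "?A \<in> null_sets (lborel_vec k)" using A by (subst (asm) AE_iff_null_sets[symmetric]) auto
  then have "emeasure (lborel_vec k) ?A = 0" by (rule null_setsD1)
  moreover have "emeasure (lborel_vec k) ?A = ennreal (\<Prod>j=1..k. b j - a j)"
    using ab by (intro emeasure_lborel_vec_box) (auto intro: less_imp_le)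
  moreover have "(\<Prod>j=1..k. b j - a j) > 0" using ab by (intro prod_pos) auto
  ultimately show False by (metis ennreal_eq_0_iff not_le)
qed

section \<open>From an integrated bound to a bound at each frequency\<close>

lemma cexp_lipschitz:
  assumes v: "v \<in> unit_cube k" and t: "\<And>j. j \<in> {1..k} \<Longrightarrow> \<bar>t j - s j\<bar> \<le> \<delta>"
  shows "cmod (cexp k t v - cexp k s v) \<le> real k * \<delta>"
proof -
  have "cmod (cexp k t v - cexp k s v) \<le> \<bar>vinner k t v - vinner k s v\<bar>"
    unfolding cexp_def by (rule cmod_iexp_diff_le)
  also have "\<dots> = \<bar>\<Sum>j=1..k. (t j - s j) * v j\<bar>"
    by (simp add: vinner_def sum_subtractf algebra_simps)
  also have "\<dots> \<le> (\<Sum>j=1..k. \<delta>)"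
  proof (intro order_trans[OF sum_abs] sum_mono)
    fix j assume j: "j \<in> {1..k}"
    then have "v j \<in> {0..1}" using v unfolding unit_cube_def by (auto simp: PiE_iff)
    then have "\<bar>t j - s j\<bar> * \<bar>v j\<bar> \<le> \<bar>t j - s j\<bar>" by (simp add: mult_left_le)
    then show "\<bar>(t j - s j) * v j\<bar> \<le> \<delta>" using t[OF j] by (simp add: abs_mult)
  qed
  finally show ?thesis by simp
qed

lemma cdev_lipschitz:
  assumes p: "\<And>a. a \<in> {1..n} \<Longrightarrow> p a \<in> unit_cube k" and b: "b \<in> {1..n}"
    and t: "\<And>j. j \<in> {1..k} \<Longrightarrow> \<bar>t j - s j\<bar> \<le> \<delta>"
  shows "cmod (cdev n k p t b - cdev n k p s b) \<le> 2 * (real k * \<delta>)"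
proof -
  have n: "n \<noteq> 0" using b by auto
  let ?s = "\<Sum>a=1..n. cexp k t (p a) - cexp k s (p a)"
  let ?u = "cexp k t (p b) - cexp k s (p b)"
  have eq: "cdev n k p t b - cdev n k p s b = (1 / of_nat n) * ?s - ?u"
    by (simp add: cdev_def sum_subtractf algebra_simps diff_divide_distrib)
  have "cmod ?s \<le> (\<Sum>a=1..n. real k * \<delta>)"
  proof (rule sum_norm_le)
    fix a assume "a \<in> {1..n}"
    from cexp_lipschitz[OF p[OF this], of t s \<delta>] t
    show "cmod (cexp k t (p a) - cexp k s (p a)) \<le> real k * \<delta>" by blast
  qed
  then have "cmod ((1 / of_nat n) * ?s) \<le> real k * \<delta>"
    using n by (simp add: norm_mult norm_divide divide_le_eq mult.commute)
  moreover have "cmod ?u \<le> real k * \<delta>"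
    using cexp_lipschitz[OF p[OF b], of t s \<delta>] t by blast
  ultimately show ?thesis
    unfolding eq using norm_triangle_ineq4[of "(1 / of_nat n) * ?s" ?u] by linarith
qed

text \<open>The Lipschitz constant involves neither n nor the sample, because all points lie in the
  unit cubes. This uniformity is what later gives one \<open>\<kappa>\<close> for all n and
  x.\<close>

lemma zstat_lipschitz:
  assumes x: "\<And>a i. a \<in> {1..n} \<Longrightarrow> i \<in> S \<Longrightarrow> x a i \<in> unit_cube (d i)"
    and t: "\<And>i j. i \<in> S \<Longrightarrow> j \<in> {1..d i} \<Longrightarrow> \<bar>t i j - s i j\<bar> \<le> \<delta>" and \<delta>: "\<delta> \<ge> 0"
  shows "cmod (zstat d n S x t - zstat d n S x s) \<le> 2 ^ card S * (\<Sum>i\<in>S. real (d i)) * \<delta>"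
proof -
  let ?c = "\<lambda>t b i. cdev n (d i) (\<lambda>a. x a i) (t i) b"
  \<comment> \<open>The product estimate \<open>norm_prod_diff\<close> is for factors of modulus at
    most 1, whereas these are bounded by 2. They are halved; \<open>2 ^ card S\<close> compensates,
    and one half absorbs the factor 2 of \<open>cdev_lipschitz\<close>.\<close>
  have le1: "cmod (?c t b i / 2) \<le> 1" if "b \<in> {1..n}" "i \<in> S" for t b i
    using cdev_bound[of n "\<lambda>a. x a i" "d i" b "t i"] x that by (simp add: norm_divide)
  have tm: "cmod ((\<Prod>i\<in>S. ?c t b i) - (\<Prod>i\<in>S. ?c s b i)) \<le> 2 ^ card S * (\<Sum>i\<in>S. real (d i)) * \<delta>"
    if b: "b \<in> {1..n}" for b
  proof -
    have "(\<Prod>i\<in>S. ?c t b i) - (\<Prod>i\<in>S. ?c s b i) = 2 ^ card S * ((\<Prod>i\<in>S. ?c t b i / 2) - (\<Prod>i\<in>S. ?c s b i / 2))"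
      by (simp add: prod_dividef algebra_simps)
    then have "cmod ((\<Prod>i\<in>S. ?c t b i) - (\<Prod>i\<in>S. ?c s b i))
        = 2 ^ card S * cmod ((\<Prod>i\<in>S. ?c t b i / 2) - (\<Prod>i\<in>S. ?c s b i / 2))"
      by (simp add: norm_mult norm_power)
    also have "\<dots> \<le> 2 ^ card S * (\<Sum>i\<in>S. cmod (?c t b i / 2 - ?c s b i / 2))"
      using b by (intro mult_left_mono norm_prod_diff le1) auto
    also have "\<dots> \<le> 2 ^ card S * (\<Sum>i\<in>S. real (d i) * \<delta>)"
    proof (intro mult_left_mono sum_mono)
      fix i assume i: "i \<in> S"
      have "cmod (?c t b i / 2 - ?c s b i / 2) = cmod (?c t b i - ?c s b i) / 2"
        by (metis diff_divide_distrib norm_divide norm_numeral)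
      also have "\<dots> \<le> real (d i) * \<delta>"
        using cdev_lipschitz[of n "\<lambda>a. x a i" "d i" b "t i" "s i" \<delta>] x t b i by simp
      finally show "cmod (?c t b i / 2 - ?c s b i / 2) \<le> real (d i) * \<delta>" .
    qed simp
    also have "\<dots> = 2 ^ card S * (\<Sum>i\<in>S. real (d i)) * \<delta>" by (simp add: sum_distrib_right)
    finally show ?thesis .
  qed
  have "cmod (zstat d n S x t - zstat d n S x s)
      = (1 / n) * cmod (\<Sum>b=1..n. (\<Prod>i\<in>S. ?c t b i) - (\<Prod>i\<in>S. ?c s b i))"
    unfolding zstat_def right_diff_distrib[symmetric] sum_subtractf[symmetric]
    by (simp add: norm_mult norm_divide)
  also have "\<dots> \<le> (1 / n) * (\<Sum>b=1..n. 2 ^ card S * (\<Sum>i\<in>S. real (d i)) * \<delta>)"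
    by (intro mult_left_mono sum_norm_le tm) auto
  also have "\<dots> \<le> 2 ^ card S * (\<Sum>i\<in>S. real (d i)) * \<delta>"
    using \<delta> by (cases "n = 0") (auto intro!: mult_nonneg_nonneg sum_nonneg)
  finally show ?thesis .
qed

text \<open>A value of modulus at least \<open>\<epsilon>\<close> at \<open>t\<close> persists as
  \<open>\<epsilon> / 2\<close> on a box near \<open>t\<close> that does not depend on the sample,
  and this box has positive weight; hence \<open>theta\<close> cannot be small.\<close>

lemma zstat_small:
  assumes S: "finite S" and d: "\<And>i. i \<in> S \<Longrightarrow> d i \<ge> 1" and \<epsilon>: "\<epsilon> > 0"
  shows "\<exists>\<kappa>>0. \<forall>n x. (\<forall>a\<in>{1..n}. \<forall>i\<in>S. x a i \<in> unit_cube (d i)) \<longrightarrow> theta d n S x < \<kappa>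
            \<longrightarrow> cmod (zstat d n S x t) < \<epsilon>"
proof -
  let ?L = "2 ^ card S * (\<Sum>i\<in>S. real (d i)) :: real"
  have L0: "?L \<ge> 0" by (intro mult_nonneg_nonneg sum_nonneg) auto
  \<comment> \<open>Makes the oscillation of \<open>zstat\<close> within distance
    \<open>\<delta>\<close> less than half of \<open>\<epsilon>\<close>; the added 1 covers a
    Lipschitz constant equal to 0.\<close>
  define \<delta> where "\<delta> = \<epsilon> / (2 * (?L + 1))"
  have \<delta>: "\<delta> > 0" using \<epsilon> L0 by (simp add: \<delta>_def)
  have L\<delta>: "?L * \<delta> < \<epsilon> / 2"
  proof -
    have "?L * \<delta> < (?L + 1) * \<delta>" using \<delta> by simp
    also have "\<dots> = \<epsilon> / 2" unfolding \<delta>_def using L0 by (simp add: field_simps)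
    finally show ?thesis .
  qed
  let ?\<nu> = "PiM S (\<lambda>i. dw (d i))"
  \<comment> \<open>Each coordinate is moved away from 0 by between \<open>\<delta> / 2\<close> and
    \<open>\<delta>\<close>, so the box stays within \<open>\<delta>\<close> of \<open>t\<close> and
    avoids 0 in every coordinate, as \<open>dw_box_pos\<close> requires.\<close>
  define l where "l i j = (if t i j \<ge> 0 then t i j + \<delta> / 2 else t i j - \<delta>)" for i j
  let ?Ai = "\<lambda>i. \<Pi>\<^sub>E j\<in>{1..d i}. {l i j..l i j + \<delta> / 2}"
  let ?A = "PiE S ?Ai"
  have Ai: "?Ai i \<in> sets (dw (d i))" for i
    unfolding sets_dw by (intro sets_PiM_I_finite) auto
  have A: "?A \<in> sets ?\<nu>" using S Ai by (intro sets_PiM_I_finite) auto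
  have "emeasure ?\<nu> ?A = (\<Prod>i\<in>S. emeasure (dw (d i)) (?Ai i))"
    by (rule product_sigma_finite.emeasure_PiM[OF product_sigma_finite_dw S Ai])
  moreover have "emeasure (dw (d i)) (?Ai i) \<noteq> 0" if "i \<in> S" for i
    using \<delta> by (intro dw_box_pos d that) (auto simp: l_def)
  ultimately have pos: "emeasure ?\<nu> ?A \<noteq> 0" using S by (simp add: prod_zero_iff)
  \<comment> \<open>The minimum with 1 guarantees a finite bound; \<open>enn2real\<close> would turn
    an infinite one into 0.\<close>
  define q where "q = min 1 (ennreal ((\<epsilon>/2)\<^sup>2) * emeasure ?\<nu> ?A)"
  have q: "q \<noteq> 0" "q \<noteq> \<top>" using pos \<epsilon> by (auto simp: q_def min_def)
  define \<kappa> where "\<kappa> = enn2real q"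
  have \<kappa>: "ennreal \<kappa> = q" "\<kappa> > 0"
    using q by (auto simp: \<kappa>_def enn2real_positive_iff less_top zero_less_iff_neq_zero)
  have "cmod (zstat d n S x t) < \<epsilon>"
    if x: "\<And>a i. a \<in> {1..n} \<Longrightarrow> i \<in> S \<Longrightarrow> x a i \<in> unit_cube (d i)" and th: "theta d n S x < \<kappa>" for n x
  proof (rule ccontr)
    assume big: "\<not> cmod (zstat d n S x t) < \<epsilon>"
    have lower: "(\<epsilon>/2)\<^sup>2 \<le> (cmod (zstat d n S x s))\<^sup>2" if s: "s \<in> ?A" for s
    proof -
      have "\<bar>t i j - s i j\<bar> \<le> \<delta>" if "i \<in> S" "j \<in> {1..d i}" for i j
      proof -
        have "s i j \<in> {l i j..l i j + \<delta> / 2}" using s that by (auto simp: PiE_iff)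
        then show ?thesis using \<delta> by (auto simp: l_def split: if_splits)
      qed
      then have "cmod (zstat d n S x t - zstat d n S x s) \<le> ?L * \<delta>"
        using x \<delta> by (intro zstat_lipschitz) auto
      then have "cmod (zstat d n S x s) \<ge> \<epsilon> / 2"
        using big L\<delta> norm_triangle_ineq2[of "zstat d n S x t" "zstat d n S x s"] by linarith
      then show ?thesis using \<epsilon> by (intro power_mono) auto
    qed
    have "ennreal ((\<epsilon>/2)\<^sup>2) * emeasure ?\<nu> ?A = (\<integral>\<^sup>+s. ennreal ((\<epsilon>/2)\<^sup>2) * indicator ?A s \<partial>?\<nu>)"
      using A by (rule nn_integral_cmult_indicator[symmetric])
    also have "\<dots> \<le> (\<integral>\<^sup>+s. ennreal ((cmod (zstat d n S x s))\<^sup>2) \<partial>?\<nu>)"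
      using lower by (intro nn_integral_mono) (auto simp: indicator_def intro: ennreal_leI)
    also have "\<dots> = ennreal (theta d n S x)"
      unfolding theta_zstat by (intro nn_integral_eq_integral zstat_integrable S d x) auto
    also have "\<dots> < ennreal \<kappa>" using th theta_nonneg \<kappa>(2) by (simp add: ennreal_less_iff)
    finally have "ennreal ((\<epsilon>/2)\<^sup>2) * emeasure ?\<nu> ?A < q" using \<kappa> by simp
    then show False unfolding q_def by (simp add: min_def split: if_splits)
  qed
  then show ?thesis using \<kappa>(2) by blast
qed

section \<open>Empirical joint law against the product of the empirical marginals\<close>

definition jexp :: "nat \<Rightarrow> (nat \<Rightarrow> nat) \<Rightarrow> (nat \<Rightarrow> nat \<Rightarrow> real) \<Rightarrow> (nat \<Rightarrow> nat \<Rightarrow> real) \<Rightarrow> complex" where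
  "jexp r d t u = (\<Prod>i=1..r. cexp (d i) (t i) (u i))"

text \<open>Integral of \<open>F\<close> against the empirical joint law minus the one against the
  product of the empirical marginals, which charges all n^r ways of choosing an index for each
  block. The restriction to \<open>{1..r}\<close> places the tuples in the extensional product
  space, on which \<open>F\<close> is later assumed continuous.\<close>

definition dep :: "nat \<Rightarrow> nat \<Rightarrow> (nat \<Rightarrow> nat \<Rightarrow> nat \<Rightarrow> real) \<Rightarrow> ((nat \<Rightarrow> nat \<Rightarrow> real) \<Rightarrow> 'a::real_normed_field) \<Rightarrow> 'a" where
  "dep r n x F = (\<Sum>b=1..n. F (\<lambda>i\<in>{1..r}. x b i)) / of_nat n
     - (\<Sum>\<beta>\<in>PiE {1..r} (\<lambda>_. {1..n}). F (\<lambda>i\<in>{1..r}. x (\<beta> i) i)) / of_nat n ^ r"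

lemma dep_add: "dep r n x (\<lambda>u. F u + G u) = dep r n x F + dep r n x G"
  by (simp add: dep_def sum.distrib add_divide_distrib)

lemma dep_cmult: "dep r n x (\<lambda>u. c * F u) = c * dep r n x F"
  by (simp add: dep_def sum_distrib_left[symmetric] right_diff_distrib)

lemma dep_sum: "dep r n x (\<lambda>u. \<Sum>q\<in>A. F q u) = (\<Sum>q\<in>A. dep r n x (F q))"
proof (induction A rule: infinite_finite_induct)
  case (insert q A)
  then show ?case by (simp add: dep_add)
qed (simp_all add: dep_def)

lemma dep_of_real: "dep r n x (\<lambda>u. complex_of_real (F u)) = complex_of_real (dep r n x F)"
  by (simp add: dep_def)

text \<open>For a product function the sum over the n^r index choices factorizes by distributivity
  into sums over single blocks.\<close>

lemma dep_prod:
  "dep r n x (\<lambda>u. \<Prod>i=1..r. f i (u i)) =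
    (\<Sum>b=1..n. \<Prod>i=1..r. f i (x b i)) / of_nat n - (\<Prod>i=1..r. (\<Sum>b=1..n. f i (x b i)) / of_nat n)"
proof -
  have "(\<Prod>i=1..r. (\<Sum>b=1..n. f i (x b i)) / of_nat n)
      = (\<Prod>i=1..r. \<Sum>b=1..n. f i (x b i)) / of_nat n ^ r"
    by (simp add: prod_dividef)
  also have "(\<Prod>i=1..r. \<Sum>b=1..n. f i (x b i))
     = (\<Sum>\<beta>\<in>PiE {1..r} (\<lambda>_. {1..n}). \<Prod>i=1..r. f i (x (\<beta> i) i))"
    by (rule prod_sum_PiE) auto
  finally have p: "(\<Prod>i=1..r. (\<Sum>b=1..n. f i (x b i)) / of_nat n)
     = (\<Sum>\<beta>\<in>PiE {1..r} (\<lambda>_. {1..n}). \<Prod>i=1..r. f i (x (\<beta> i) i)) / of_nat n ^ r" .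
  have "(\<Prod>i=1..r. f i ((\<lambda>i\<in>{1..r}. y i) i)) = (\<Prod>i=1..r. f i (y i))" for y
    by (intro prod.cong) auto
  then show ?thesis unfolding dep_def p by (simp only:)
qed

text \<open>Both terms are averages, hence the factor 2. This transfers uniform approximation of
  \<open>F\<close> to \<open>dep\<close>, whatever n and the sample.\<close>

lemma dep_bound:
  fixes F :: "(nat \<Rightarrow> nat \<Rightarrow> real) \<Rightarrow> real"
  assumes x: "\<And>a i. a \<in> {1..n} \<Longrightarrow> i \<in> {1..r} \<Longrightarrow> x a i \<in> K i"
    and F: "\<And>u. u \<in> PiE {1..r} K \<Longrightarrow> \<bar>F u\<bar> \<le> e" and e: "e \<ge> 0"
  shows "\<bar>dep r n x F\<bar> \<le> 2 * e"
proof -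
  have 1: "\<bar>(\<Sum>b=1..n. F (\<lambda>i\<in>{1..r}. x b i)) / real n\<bar> \<le> e"
  proof (cases "n = 0")
    case False
    have "\<bar>\<Sum>b=1..n. F (\<lambda>i\<in>{1..r}. x b i)\<bar> \<le> (\<Sum>b=1..n. e)"
      by (intro order_trans[OF sum_abs] sum_mono F) (use x in auto)
    then show ?thesis using False by (simp add: divide_le_eq mult.commute)
  qed (use e in simp)
  have 2: "\<bar>(\<Sum>\<beta>\<in>PiE {1..r} (\<lambda>_. {1..n}). F (\<lambda>i\<in>{1..r}. x (\<beta> i) i)) / real n ^ r\<bar> \<le> e"
  proof (cases "real n ^ r = 0")
    case False
    have "\<bar>\<Sum>\<beta>\<in>PiE {1..r} (\<lambda>_. {1..n}). F (\<lambda>i\<in>{1..r}. x (\<beta> i) i)\<bar> \<le> (\<Sum>\<beta>\<in>PiE {1..r} (\<lambda>_. {1..n}). e)"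
      by (intro order_trans[OF sum_abs] sum_mono F) (use x in \<open>auto simp: PiE_iff\<close>)
    also have "\<dots> = real n ^ r * e" by (simp add: card_PiE)
    finally show ?thesis using False by (simp add: divide_le_eq mult.commute)
  next
    case True
    show ?thesis unfolding True using e by simp
  qed
  show ?thesis unfolding dep_def of_nat_power using 1 2 by linarith
qed

text \<open>Write every factor as its mean minus its deviation and expand over the set
  \<open>S\<close> of deviations chosen. The empty set gives the product of the means, singletons
  vanish by centring, and in the remaining terms the leftover means have modulus at most 1.\<close>

lemma dep_jexp:
  assumes n: "n \<ge> 1"
  shows "cmod (dep r n x (jexp r d t)) \<le> (\<Sum>S | S \<subseteq> {1..r} \<and> card S \<ge> 2. cmod (zstat d n S x t))"
proof -
  let ?I = "{1..r}"
  let ?m = "\<lambda>i. (\<Sum>b=1..n. cexp (d i) (t i) (x b i)) / of_nat n"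
  let ?\<xi> = "\<lambda>b i. cdev n (d i) (\<lambda>a. x a i) (t i) b"
  let ?g = "\<lambda>S. (-1) ^ card S * (\<Prod>i\<in>?I-S. ?m i) * zstat d n S x t"
  have m1: "cmod (?m i) \<le> 1" for i
  proof -
    have "cmod (\<Sum>b=1..n. cexp (d i) (t i) (x b i)) \<le> (\<Sum>b=1..n. 1)"
      by (intro sum_norm_le) simp
    then show ?thesis using n by (simp add: norm_divide)
  qed
  \<comment> \<open>\<open>cdev\<close> is the mean minus the value, so the value is the mean plus
    \<open>- cdev\<close>; the signs collect to (-1)^|S|.\<close>
  have "(\<Prod>i\<in>?I. cexp (d i) (t i) (x b i)) = (\<Sum>S\<in>Pow ?I. (\<Prod>i\<in>S. - ?\<xi> b i) * (\<Prod>i\<in>?I-S. ?m i))" for b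
    by (subst prod_add[symmetric]) (simp_all add: cdev_def)
  then have "(\<Sum>b=1..n. \<Prod>i\<in>?I. cexp (d i) (t i) (x b i)) / of_nat n
      = (\<Sum>b=1..n. \<Sum>S\<in>Pow ?I. (\<Prod>i\<in>S. - ?\<xi> b i) * (\<Prod>i\<in>?I-S. ?m i)) / of_nat n"
    by simp
  also have "\<dots> = (\<Sum>S\<in>Pow ?I. (\<Sum>b=1..n. (\<Prod>i\<in>S. - ?\<xi> b i) * (\<Prod>i\<in>?I-S. ?m i)) / of_nat n)"
    by (subst sum.swap) (simp add: sum_divide_distrib)
  also have "\<dots> = (\<Sum>S\<in>Pow ?I. ?g S)"
  proof (intro sum.cong refl)
    fix S assume "S \<in> Pow ?I"
    have "(\<Prod>i\<in>S. - ?\<xi> b i) = (-1) ^ card S * (\<Prod>i\<in>S. ?\<xi> b i)" for b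
      by (rule prod_uminus)
    then have "(\<Sum>b=1..n. (\<Prod>i\<in>S. - ?\<xi> b i) * (\<Prod>i\<in>?I-S. ?m i))
        = (-1) ^ card S * (\<Sum>b=1..n. \<Prod>i\<in>S. ?\<xi> b i) * (\<Prod>i\<in>?I-S. ?m i)"
      by (simp only: sum_distrib_left sum_distrib_right)
    then show "(\<Sum>b=1..n. (\<Prod>i\<in>S. - ?\<xi> b i) * (\<Prod>i\<in>?I-S. ?m i)) / of_nat n = ?g S"
      unfolding zstat_def by (simp only: times_divide_eq_left times_divide_eq_right mult_1_left mult_ac)
  qed
  also have "\<dots> = ?g {} + (\<Sum>S\<in>Pow ?I - {{}}. ?g S)"
    by (intro sum.remove) auto
  also have "?g {} = (\<Prod>i\<in>?I. ?m i)" using n by (simp add: zstat_def)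
  also have "(\<Sum>S\<in>Pow ?I - {{}}. ?g S) = (\<Sum>S | S \<subseteq> ?I \<and> card S \<ge> 2. ?g S)"
  proof (intro sum.mono_neutral_right ballI)
    fix S assume "S \<in> Pow ?I - {{}} - {S. S \<subseteq> ?I \<and> 2 \<le> card S}"
    then have S: "S \<noteq> {}" "S \<subseteq> ?I" "card S < 2" by auto
    then have "finite S" using finite_subset by blast
    then have "card S \<noteq> 0" using S by simp
    then have "card S = 1" using S by linarith
    then obtain i where "S = {i}" by (rule card_1_singletonE)
    then have "zstat d n S x t = 0" by (simp add: zstat_def sum_cdev[simplified])
    then show "?g S = 0" by simp
  qed auto
  finally have "dep r n x (jexp r d t) = (\<Sum>S | S \<subseteq> ?I \<and> card S \<ge> 2. ?g S)"
    unfolding jexp_def[abs_def] dep_prod[of r n x "\<lambda>i. cexp (d i) (t i)"] by (simp only: add_diff_cancel_left')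
  moreover have "cmod (?g S) \<le> cmod (zstat d n S x t)" for S
  proof -
    have "cmod (\<Prod>i\<in>?I-S. ?m i) \<le> 1"
      unfolding prod_norm[symmetric] by (intro prod_le_1) (use m1 in auto)
    then show ?thesis by (simp add: norm_mult norm_power mult_left_le_one_le)
  qed
  ultimately show ?thesis by (simp add: sum_norm_le)
qed

section \<open>The limit of vanishing statistic\<close>

definition in_cubes :: "nat \<Rightarrow> (nat \<Rightarrow> nat) \<Rightarrow> nat \<Rightarrow> (nat \<Rightarrow> nat \<Rightarrow> nat \<Rightarrow> real) \<Rightarrow> bool" where
  "in_cubes r d n x \<longleftrightarrow> n \<ge> 1 \<and> (\<forall>a\<in>{1..n}. \<forall>i\<in>{1..r}. x a i \<in> unit_cube (d i))"

text \<open>Convergence along this filter means convergence as the statistic tends to 0, uniformly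
  over all n and all samples in the cubes; n is not sent to infinity. As a filter it makes the limit
  rules for sums and multiples available.\<close>

definition small_stat :: "nat \<Rightarrow> (nat \<Rightarrow> nat) \<Rightarrow> (nat \<Rightarrow> real) \<Rightarrow> (nat \<times> (nat \<Rightarrow> nat \<Rightarrow> nat \<Rightarrow> real)) filter" where
  "small_stat r d C = inf (filtercomap (\<lambda>(n, x). JdCov_stat r d n C x) (nhds 0))
     (principal {(n, x). in_cubes r d n x})"

lemma eventually_small_stat:
  "eventually P (small_stat r d C) \<longleftrightarrow>
    (\<exists>\<kappa>>0. \<forall>n x. in_cubes r d n x \<longrightarrow> \<bar>JdCov_stat r d n C x\<bar> < \<kappa> \<longrightarrow> P (n, x))"
    (is "?L \<longleftrightarrow> ?R")
proof
  assume ?L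
  then obtain Q where Q: "eventually Q (nhds 0)"
      "\<And>n x. Q (JdCov_stat r d n C x) \<Longrightarrow> in_cubes r d n x \<Longrightarrow> P (n, x)"
    unfolding small_stat_def eventually_inf_principal eventually_filtercomap by auto
  then obtain \<kappa> where "\<kappa> > 0" "\<And>y. \<bar>y\<bar> < \<kappa> \<Longrightarrow> Q y"
    unfolding eventually_nhds_metric dist_real_def by auto
  then show ?R using Q(2) by (intro exI[of _ \<kappa>]) auto
next
  assume ?R
  then obtain \<kappa> where \<kappa>: "\<kappa> > 0" "\<And>n x. in_cubes r d n x \<Longrightarrow> \<bar>JdCov_stat r d n C x\<bar> < \<kappa> \<Longrightarrow> P (n, x)"
    by auto
  have "eventually (\<lambda>y. \<bar>y\<bar> < \<kappa>) (nhds 0)"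
    unfolding eventually_nhds_metric dist_real_def using \<kappa>(1) by auto
  then show ?L
    unfolding small_stat_def eventually_inf_principal eventually_filtercomap
    using \<kappa>(2) by (intro exI[of _ "\<lambda>y. \<bar>y\<bar> < \<kappa>"]) auto
qed

text \<open>Every summand of the statistic is nonnegative, so one alone is a lower bound. Positivity
  of its weight then lets \<open>zstat_tendsto\<close> treat each \<open>S\<close> with at least two
  elements, and these are all that occur in \<open>dep_jexp\<close>.\<close>

lemma theta_le_JdCov:
  assumes C: "\<And>s. s \<in> {2..r} \<Longrightarrow> C s > 0" and S: "S \<subseteq> {1..r}" "card S \<ge> 2"
  shows "C (card S) * theta d n S x \<le> JdCov_stat r d n C x"
proof -
  have "card S \<le> r" using card_mono[OF _ S(1)] by simp
  then have s: "card S \<in> {2..r}" using S by simp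
  have fin: "finite {S'. S' \<subseteq> {1..r} \<and> card S' = s}" for s
    by (rule finite_subset[of _ "Pow {1..r}"]) auto
  have "theta d n S x \<le> (\<Sum>S' | S' \<subseteq> {1..r} \<and> card S' = card S. theta d n S' x)"
    by (rule member_le_sum[OF _ _ fin]) (use S theta_nonneg in auto)
  then have "C (card S) * theta d n S x \<le> C (card S) * (\<Sum>S' | S' \<subseteq> {1..r} \<and> card S' = card S. theta d n S' x)"
    using C[OF s] by (intro mult_left_mono) auto
  also have "\<dots> \<le> JdCov_stat r d n C x"
    unfolding JdCov_stat_def
    by (rule member_le_sum[OF s, where f = "\<lambda>s. C s * (\<Sum>S' | S' \<subseteq> {1..r} \<and> card S' = s. theta d n S' x)"])
      (auto intro!: mult_nonneg_nonneg sum_nonneg theta_nonneg less_imp_le[OF C])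
  finally show ?thesis .
qed

lemma zstat_tendsto:
  assumes C: "\<And>s. s \<in> {2..r} \<Longrightarrow> C s > 0" and d: "\<And>i. i \<in> {1..r} \<Longrightarrow> d i \<ge> 1"
    and S: "S \<subseteq> {1..r}" "card S \<ge> 2"
  shows "((\<lambda>(n, x). cmod (zstat d n S x t)) \<longlongrightarrow> 0) (small_stat r d C)"
proof (rule tendstoI)
  fix \<epsilon> :: real assume "\<epsilon> > 0"
  have finS: "finite S" using S finite_subset by blast
  have "card S \<in> {2..r}" using card_mono[OF _ S(1)] S by simp
  then have Cs: "C (card S) > 0" by (rule C)
  obtain \<kappa> where \<kappa>: "\<kappa> > 0" "\<And>n x. (\<forall>a\<in>{1..n}. \<forall>i\<in>S. x a i \<in> unit_cube (d i)) \<Longrightarrow> theta d n S x < \<kappa>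
            \<Longrightarrow> cmod (zstat d n S x t) < \<epsilon>"
    using zstat_small[OF finS, of d \<epsilon> t] d S \<open>\<epsilon> > 0\<close> by (metis subsetD)
  show "\<forall>\<^sub>F p in small_stat r d C. dist (case p of (n, x) \<Rightarrow> cmod (zstat d n S x t)) 0 < \<epsilon>"
    unfolding eventually_small_stat
  proof (intro exI[of _ "C (card S) * \<kappa>"] conjI allI impI)
    fix n x assume x: "in_cubes r d n x" and J: "\<bar>JdCov_stat r d n C x\<bar> < C (card S) * \<kappa>"
    have "C (card S) * theta d n S x < C (card S) * \<kappa>"
      using theta_le_JdCov[of r C S d n x, OF C S] J by linarith
    then have "theta d n S x < \<kappa>" using Cs by simp
    then have "cmod (zstat d n S x t) < \<epsilon>" using x S by (intro \<kappa>(2)) (auto simp: in_cubes_def)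
    then show "dist (case (n, x) of (n, x) \<Rightarrow> cmod (zstat d n S x t)) 0 < \<epsilon>" by simp
  qed (use Cs \<kappa> in simp)
qed

lemma dep_jexp_tendsto:
  assumes C: "\<And>s. s \<in> {2..r} \<Longrightarrow> C s > 0" and d: "\<And>i. i \<in> {1..r} \<Longrightarrow> d i \<ge> 1"
  shows "((\<lambda>(n, x). dep r n x (jexp r d t)) \<longlongrightarrow> 0) (small_stat r d C)"
proof (rule Lim_null_comparison)
  show "((\<lambda>p. \<Sum>S | S \<subseteq> {1..r} \<and> card S \<ge> 2. case p of (n, x) \<Rightarrow> cmod (zstat d n S x t)) \<longlongrightarrow> 0) (small_stat r d C)"
  proof (rule tendsto_null_sum)
    fix S assume "S \<in> {S. S \<subseteq> {1..r} \<and> card S \<ge> 2}"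
    then show "((\<lambda>p. case p of (n, x) \<Rightarrow> cmod (zstat d n S x t)) \<longlongrightarrow> 0) (small_stat r d C)"
      using zstat_tendsto[of r C d S t, OF C d] by simp
  qed
  show "\<forall>\<^sub>F p in small_stat r d C. norm (case p of (n, x) \<Rightarrow> dep r n x (jexp r d t))
      \<le> (\<Sum>S | S \<subseteq> {1..r} \<and> card S \<ge> 2. case p of (n, x) \<Rightarrow> cmod (zstat d n S x t))"
    unfolding eventually_small_stat
  proof (intro exI[of _ 1] conjI allI impI)
    fix n x assume "in_cubes r d n x"
    then show "norm (case (n, x) of (n, x) \<Rightarrow> dep r n x (jexp r d t))
      \<le> (\<Sum>S | S \<subseteq> {1..r} \<and> card S \<ge> 2. case (n, x) of (n, x) \<Rightarrow> cmod (zstat d n S x t))"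
      using dep_jexp[of n r x d t] by (simp add: in_cubes_def)
  qed simp
qed

section \<open>Trigonometric polynomials and Stone--Weierstrass\<close>

inductive_set trig_poly :: "nat \<Rightarrow> (nat \<Rightarrow> nat) \<Rightarrow> ((nat \<Rightarrow> nat \<Rightarrow> real) \<Rightarrow> complex) set"
  for r d where
  jexp: "jexp r d t \<in> trig_poly r d"
| add: "F \<in> trig_poly r d \<Longrightarrow> G \<in> trig_poly r d \<Longrightarrow> (\<lambda>u. F u + G u) \<in> trig_poly r d"
| scale: "F \<in> trig_poly r d \<Longrightarrow> (\<lambda>u. c * F u) \<in> trig_poly r d"

lemma jexp_mult: "jexp r d t u * jexp r d s u = jexp r d (\<lambda>i j. t i j + s i j) u"
proof -
  have "cexp k t v * cexp k s v = cexp k (\<lambda>j. t j + s j) v" for k t s v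
    by (simp add: cexp_def vinner_def sum.distrib algebra_simps flip: exp_add)
  then show ?thesis unfolding jexp_def prod.distrib[symmetric] by (intro prod.cong refl)
qed

lemma trig_poly_jexp_mult:
  "F \<in> trig_poly r d \<Longrightarrow> (\<lambda>u. jexp r d t u * F u) \<in> trig_poly r d"
proof (induction rule: trig_poly.induct)
  case (jexp s)
  show ?case unfolding jexp_mult by (rule trig_poly.jexp)
next
  case (add F G)
  then show ?case unfolding distrib_left by (intro trig_poly.add)
next
  case (scale F c)
  then show ?case using trig_poly.scale[OF scale.IH, of c] by (simp add: mult.left_commute)
qed

lemma trig_poly_mult:
  "F \<in> trig_poly r d \<Longrightarrow> G \<in> trig_poly r d \<Longrightarrow> (\<lambda>u. F u * G u) \<in> trig_poly r d"
proof (induction rule: trig_poly.induct)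
  case (jexp t)
  then show ?case by (rule trig_poly_jexp_mult)
next
  case (add F H)
  then have "(\<lambda>u. F u * G u) \<in> trig_poly r d" "(\<lambda>u. H u * G u) \<in> trig_poly r d" by auto
  then show ?case unfolding distrib_right by (rule trig_poly.add)
next
  case (scale F c)
  then show ?case using trig_poly.scale[of "\<lambda>u. F u * G u" r d c] by (simp add: mult.assoc)
qed

lemma continuous_on_coordinate2: "continuous_on A (\<lambda>u :: nat \<Rightarrow> nat \<Rightarrow> real. u i j)"
  using continuous_on_product_then_coordinatewise
    [OF continuous_on_product_then_coordinatewise[OF continuous_on_id], of A i j] .

lemma trig_poly_continuous: "F \<in> trig_poly r d \<Longrightarrow> continuous_on A F"
proof (induction rule: trig_poly.induct)
  case (jexp t)
  show ?case unfolding jexp_def[abs_def] cexp_def vinner_def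
    by (intro continuous_on_prod continuous_on_exp continuous_on_mult continuous_on_of_real
        continuous_on_sum continuous_on_const continuous_on_coordinate2)
next
  case (add F G)
  from add.IH show ?case by (rule continuous_on_add)
next
  case (scale F c)
  from scale.IH show ?case by (rule continuous_on_mult_left)
qed

lemma trig_poly_dep_tendsto:
  assumes C: "\<And>s. s \<in> {2..r} \<Longrightarrow> C s > 0" and d: "\<And>i. i \<in> {1..r} \<Longrightarrow> d i \<ge> 1"
  shows "F \<in> trig_poly r d \<Longrightarrow> ((\<lambda>(n, x). dep r n x F) \<longlongrightarrow> 0) (small_stat r d C)"
proof (induction rule: trig_poly.induct)
  case (jexp t)
  show ?case by (rule dep_jexp_tendsto[of r C d, OF C d])
next
  case (add F G)
  then show ?case using tendsto_add[OF add.IH] by (simp add: dep_add case_prod_beta)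
next
  case (scale F c)
  then show ?case using tendsto_mult_left[OF scale.IH, of c] by (simp add: dep_cmult case_prod_beta)
qed

lemma compact_PiE:
  fixes A :: "'a \<Rightarrow> 'b::topological_space set"
  assumes "\<And>i. i \<in> I \<Longrightarrow> compact (A i)"
  shows "compact (PiE I A)"
proof -
  \<comment> \<open>Outside \<open>I\<close> an extensional function has the single value
    \<open>undefined\<close>; recording this as a singleton factor gives a product over all indices,
    where Tychonoff's theorem applies.\<close>
  have eq: "PiE I A = PiE UNIV (\<lambda>i. if i \<in> I then A i else {undefined})"
    by (auto simp: PiE_iff extensional_def split: if_splits)
  have "compactin (product_topology (\<lambda>i. euclidean) UNIV) (PiE UNIV (\<lambda>i. if i \<in> I then A i else {undefined}))"
    using assms by (auto simp: compactin_PiE)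
  then show ?thesis unfolding eq euclidean_product_topology by simp
qed

lemma compact_unit_cube: "compact (unit_cube k)"
  unfolding unit_cube_def by (intro compact_PiE) auto

text \<open>The ring consists of the real functions whose complex version is a trigonometric
  polynomial; it is closed under products because frequencies add.\<close>

lemma trig_poly_function_ring:
  "function_ring_on {F. (\<lambda>u. complex_of_real (F u)) \<in> trig_poly r d} (PiE {1..r} (\<lambda>i. unit_cube (d i)))"
    (is "function_ring_on ?R ?K")
proof
  show "compact ?K" by (intro compact_PiE compact_unit_cube)
next
  fix F :: "(nat \<Rightarrow> nat \<Rightarrow> real) \<Rightarrow> real" assume "F \<in> ?R"
  then have "continuous_on ?K (\<lambda>u. Re (complex_of_real (F u)))"
    by (intro continuous_on_Re trig_poly_continuous) auto
  then show "continuous_on ?K F" by simp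
next
  fix F G :: "(nat \<Rightarrow> nat \<Rightarrow> real) \<Rightarrow> real" assume "F \<in> ?R" "G \<in> ?R"
  then show "(\<lambda>u. F u + G u) \<in> ?R" "(\<lambda>u. F u * G u) \<in> ?R"
    using trig_poly.add trig_poly_mult by force+
next
  fix c :: real
  have "jexp r d (\<lambda>i j. 0) = (\<lambda>u. 1)" by (simp add: jexp_def cexp_def vinner_def fun_eq_iff)
  then show "(\<lambda>_. c) \<in> ?R"
    using trig_poly.scale[OF trig_poly.jexp[of r d "\<lambda>i j. 0"], of "of_real c"] by simp
next
  fix u v assume u: "u \<in> ?K" and v: "v \<in> ?K" and "u \<noteq> v"
  then obtain i where i: "i \<in> {1..r}" "u i \<noteq> v i" by (metis PiE_ext)
  then have ui: "u i \<in> unit_cube (d i)" "v i \<in> unit_cube (d i)" using u v by (auto simp: PiE_iff)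
  then obtain j where j: "j \<in> {1..d i}" "u i j \<noteq> v i j"
    using i unfolding unit_cube_def by (metis PiE_ext)
  \<comment> \<open>Some coordinate differs, and its sine separates the points, since sin is
    injective on [0,1], which lies inside [-pi/2, pi/2]. The unit frequency at \<open>(i, j)\<close>
    and its negative produce that sine by Euler's formula.\<close>
  define t where "t i' j' = (if i' = i \<and> j' = j then 1 else 0 :: real)" for i' j'
  have jt: "jexp r d (\<lambda>i' j'. s * t i' j') w = exp (\<i> * of_real (s * w i j))" for s w
  proof -
    have "vinner (d i') (\<lambda>j'. s * t i' j') (w i') = (if i' = i then s * w i j else 0)" for i'
      using j by (auto simp: vinner_def t_def sum.delta if_distrib[of "\<lambda>x. s * x"] if_distrib[of "\<lambda>x. x * _"] cong: if_cong)
    then have "cexp (d i') (\<lambda>j'. s * t i' j') (w i') = (if i' = i then exp (\<i> * of_real (s * w i j)) else 1)" for i'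
      by (simp add: cexp_def)
    then show ?thesis using i by (simp add: jexp_def prod.delta)
  qed
  have sin_eq: "(\<lambda>w. complex_of_real (sin (w i j))) = (\<lambda>w. (- \<i> / 2) * jexp r d (\<lambda>i' j'. 1 * t i' j') w + (\<i> / 2) * jexp r d (\<lambda>i' j'. (-1) * t i' j') w)"
  proof
    fix w :: "nat \<Rightarrow> nat \<Rightarrow> real"
    show "complex_of_real (sin (w i j)) = (- \<i> / 2) * jexp r d (\<lambda>i' j'. 1 * t i' j') w + (\<i> / 2) * jexp r d (\<lambda>i' j'. (-1) * t i' j') w"
      unfolding jt by (simp add: sin_of_real[symmetric] sin_exp_eq field_simps)
  qed
  have "(\<lambda>w. (- \<i> / 2) * jexp r d (\<lambda>i' j'. 1 * t i' j') w + (\<i> / 2) * jexp r d (\<lambda>i' j'. (-1) * t i' j') w) \<in> trig_poly r d"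
    by (rule trig_poly.add; rule trig_poly.scale; rule trig_poly.jexp)
  then have "(\<lambda>w. complex_of_real (sin (w i j))) \<in> trig_poly r d" unfolding sin_eq[symmetric] .
  then have "(\<lambda>w. sin (w i j)) \<in> ?R" by simp
  moreover have "sin (u i j) \<noteq> sin (v i j)"
  proof -
    have "u i j \<in> {0..1}" "v i j \<in> {0..1}" using ui j by (auto simp: unit_cube_def PiE_iff)
    moreover have "1 \<le> pi / 2" using pi_gt3 by linarith
    ultimately show ?thesis using sin_inj_pi[of "u i j" "v i j"] j by auto
  qed
  ultimately show "\<exists>F\<in>?R. F u \<noteq> F v" by (intro bexI[of _ "\<lambda>w. sin (w i j)"])
qed

text \<open>Approximation is uniform on the compact product of cubes, so one trigonometric
  polynomial serves all n and samples at once. The error e/4 costs e/2 by \<open>dep_bound\<close>,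
  leaving e/2 for the polynomial.\<close>

lemma dep_tendsto:
  fixes F :: "(nat \<Rightarrow> nat \<Rightarrow> real) \<Rightarrow> real"
  assumes C: "\<And>s. s \<in> {2..r} \<Longrightarrow> C s > 0" and d: "\<And>i. i \<in> {1..r} \<Longrightarrow> d i \<ge> 1"
    and F: "continuous_on (PiE {1..r} (\<lambda>i. unit_cube (d i))) F"
  shows "((\<lambda>(n, x). dep r n x F) \<longlongrightarrow> 0) (small_stat r d C)"
proof (rule tendstoI)
  fix e :: real assume e: "e > 0"
  let ?K = "\<lambda>i. unit_cube (d i)"
  obtain G where G: "(\<lambda>u. complex_of_real (G u)) \<in> trig_poly r d"
      and FG: "\<And>u. u \<in> PiE {1..r} ?K \<Longrightarrow> \<bar>F u - G u\<bar> < e / 4"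
    using function_ring_on.Stone_Weierstrass_basic[OF trig_poly_function_ring F, of "e / 4"] e by auto
  have "\<forall>\<^sub>F p in small_stat r d C. dist (case p of (n, x) \<Rightarrow> dep r n x (\<lambda>u. complex_of_real (G u))) 0 < e / 2"
    using trig_poly_dep_tendsto[of r C d, OF C d G] e by (intro tendstoD) auto
  moreover have "\<forall>\<^sub>F p in small_stat r d C. case p of (n, x) \<Rightarrow> in_cubes r d n x"
    unfolding eventually_small_stat by (intro exI[of _ 1]) simp
  ultimately show "\<forall>\<^sub>F p in small_stat r d C. dist (case p of (n, x) \<Rightarrow> dep r n x F) 0 < e"
  proof eventually_elim
    case (elim p)
    obtain n x where p: "p = (n, x)" by (cases p)
    have "\<bar>dep r n x G\<bar> < e / 2" using elim(1) by (simp add: p dep_of_real)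
    moreover have "\<bar>dep r n x (\<lambda>u. F u - G u)\<bar> \<le> 2 * (e / 4)"
      by (rule dep_bound[where K = ?K]) (use elim(2) FG e in \<open>auto simp: p in_cubes_def intro: less_imp_le\<close>)
    moreover have "dep r n x F = dep r n x (\<lambda>u. F u - G u) + dep r n x G"
      by (simp flip: dep_add)
    ultimately show ?case by (simp add: p)
  qed
qed

section \<open>Partition of unity and optimal assignments\<close>

definition tent :: "real \<Rightarrow> real" where
  "tent y = max 0 (1 - \<bar>y\<bar>)"

text \<open>The induction on \<open>N\<close> carries a closed form that covers also
  \<open>y\<close> beyond \<open>N\<close>, where the sum falls to 0; \<open>sum_tent\<close> takes
  the range in which it equals 1.\<close>

lemma sum_tent_nonneg: "0 \<le> y \<Longrightarrow> (\<Sum>q=0..N. tent (y - real q)) = min 1 (max 0 (real N + 1 - y))"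
proof (induction N)
  case 0
  then show ?case by (simp add: tent_def)
next
  case (Suc N)
  have "(\<Sum>q=0..Suc N. tent (y - real q)) = min 1 (max 0 (real N + 1 - y)) + tent (y - real (Suc N))"
    using Suc by simp
  also have "\<dots> = min 1 (max 0 (real (Suc N) + 1 - y))"
    by (simp add: tent_def min_def max_def abs_if)
  finally show ?case .
qed

lemma sum_tent: "0 \<le> y \<Longrightarrow> y \<le> real N \<Longrightarrow> (\<Sum>q=0..N. tent (y - real q)) = 1"
  by (subst sum_tent_nonneg) auto

text \<open>The index \<open>q\<close> stands for the node q/N with the cube of side 2/N around it.
  Neighbouring cells overlap; this is the price for continuous weights, which can be tested against
  weak convergence and entered into \<open>dep_tendsto\<close>.\<close>

definition tents :: "nat \<Rightarrow> nat \<Rightarrow> (nat \<Rightarrow> nat) \<Rightarrow> (nat \<Rightarrow> real) \<Rightarrow> real" where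
  "tents k N q v = (\<Prod>j=1..k. tent (real N * v j - real (q j)))"

definition cells :: "nat \<Rightarrow> nat \<Rightarrow> (nat \<Rightarrow> nat) set" where
  "cells k N = (PiE {1..k} (\<lambda>_. {0..N}))"

lemma finite_cells: "finite (cells k N)"
  unfolding cells_def by (intro finite_PiE) auto

lemma tents_nonneg: "0 \<le> tents k N q v"
  unfolding tents_def tent_def by (intro prod_nonneg) auto

lemma tents_le_1: "tents k N q v \<le> 1"
  unfolding tents_def tent_def by (intro prod_le_1) auto

lemma tents_support:
  assumes "tents k N q v \<noteq> 0" "j \<in> {1..k}"
  shows "\<bar>real N * v j - real (q j)\<bar> < 1"
proof -
  have "tent (real N * v j - real (q j)) \<noteq> 0"
    using assms unfolding tents_def by (auto simp: prod_zero_iff)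
  then show ?thesis by (simp add: tent_def max_def split: if_splits)
qed

lemma sum_tents:
  assumes "v \<in> unit_cube k"
  shows "(\<Sum>q\<in>cells k N. tents k N q v) = 1"
proof -
  have "(\<Sum>q\<in>cells k N. tents k N q v) = (\<Prod>j=1..k. \<Sum>m=0..N. tent (real N * v j - real m))"
    unfolding cells_def tents_def by (subst prod_sum_PiE) auto
  also have "\<dots> = 1"
  proof (intro prod.neutral ballI)
    fix j assume "j \<in> {1..k}"
    then have "v j \<in> {0..1}" using assms by (auto simp: unit_cube_def PiE_iff)
    then show "(\<Sum>m=0..N. tent (real N * v j - real m)) = 1"
      by (intro sum_tent) (auto simp: mult_left_le)
  qed
  finally show ?thesis .
qed

lemma continuous_on_tents: "continuous_on A (tents k N q)"
proof -
  have c: "continuous_on A (\<lambda>v :: nat \<Rightarrow> real. v j)" for j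
    using continuous_on_product_then_coordinatewise[OF continuous_on_id, of A j] .
  show ?thesis unfolding tents_def[abs_def] tent_def
    by (intro continuous_on_prod continuous_on_max continuous_on_diff continuous_on_rabs
        continuous_on_mult continuous_on_const c)
qed

lemma tents_measurable: "tents k N q \<in> borel_measurable (lborel_vec k)"
proof -
  have "(\<lambda>v. \<Prod>j\<in>{1..k}. max 0 (1 - \<bar>real N * v j - real (q j)\<bar>)) \<in> borel_measurable (PiM {1..k} (\<lambda>_. borel))"
    by measurable
  then show ?thesis
    unfolding tents_def[abs_def] tent_def by (simp only: measurable_cong_sets[OF sets_lborel_vec refl])
qed

text \<open>A tent is at most the indicator of its supporting box of side 2/N; intersecting that box
  with the unit cube can only shrink it.\<close>

lemma tents_uniform_integral_le:
  assumes N: "N \<ge> 1"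
  shows "(\<integral>v. tents k N q v \<partial>uniform_measure (lborel_vec k) (unit_cube k)) \<le> (2 / real N) ^ k"
proof -
  let ?U = "uniform_measure (lborel_vec k) (unit_cube k)"
  let ?box = "\<Pi>\<^sub>E j\<in>{1..k}. {(real (q j) - 1) / N..(real (q j) + 1) / N}"
  have box: "?box \<in> sets (lborel_vec k)" and cube: "unit_cube k \<in> sets (lborel_vec k)"
    unfolding lborel_vec_def unit_cube_def by (intro sets_PiM_I_finite; simp)+
  have c1: "emeasure (lborel_vec k) (unit_cube k) = 1"
    unfolding unit_cube_def by (subst emeasure_lborel_vec_box) auto
  interpret U: prob_space ?U using c1 by (intro prob_space_uniform_measure) auto
  have tm: "tents k N q \<in> borel_measurable ?U"
    using tents_measurable by (simp add: measurable_def uniform_measure_def)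
  have int: "integrable ?U (tents k N q)"
    by (rule U.integrable_const_bound[where B = 1]) (use tm tents_nonneg tents_le_1 in auto)
  have bx: "emeasure (lborel_vec k) ?box = ennreal ((2 / real N) ^ k)"
  proof -
    have "emeasure (lborel_vec k) ?box = ennreal (\<Prod>j=1..k. (real (q j) + 1) / N - (real (q j) - 1) / N)"
      using N by (intro emeasure_lborel_vec_box) (simp add: divide_right_mono)
    also have "(\<Prod>j=1..k. (real (q j) + 1) / N - (real (q j) - 1) / N) = (2 / real N) ^ k"
      by (simp flip: diff_divide_distrib)
    finally show ?thesis .
  qed
  have "(\<integral>v. tents k N q v \<partial>?U) \<le> (\<integral>v. indicator ?box v \<partial>?U)"
  proof (rule integral_mono[OF int])
    show "integrable ?U (indicator ?box :: _ \<Rightarrow> real)"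
      using box by (intro U.integrable_const_bound[where B = 1]) auto
    fix v assume v: "v \<in> space ?U"
    show "tents k N q v \<le> indicator ?box v"
    proof (cases "tents k N q v = 0")
      case False
      have "v j \<in> {(real (q j) - 1) / N..(real (q j) + 1) / N}" if "j \<in> {1..k}" for j
        using tents_support[OF False that] N by (auto simp: field_simps)
      then have "v \<in> ?box" using v by (auto simp: PiE_iff space_lborel_vec)
      then show ?thesis using tents_le_1 by simp
    qed simp
  qed
  also have "\<dots> = measure ?U ?box" using box by simp
  also have "\<dots> \<le> (2 / real N) ^ k"
  proof -
    have "emeasure ?U ?box = emeasure (lborel_vec k) (unit_cube k \<inter> ?box)"
      using box cube by (subst emeasure_uniform_measure) (simp_all add: c1 divide_ennreal_def)
    also have "\<dots> \<le> emeasure (lborel_vec k) ?box" using box by (intro emeasure_mono) auto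
    finally have "ennreal (measure ?U ?box) \<le> ennreal ((2 / real N) ^ k)"
      unfolding bx U.emeasure_eq_measure .
    then show ?thesis by (subst (asm) ennreal_le_iff) auto
  qed
  finally show ?thesis .
qed

lemma integral_grid_empirical:
  fixes f :: "(nat \<Rightarrow> real) \<Rightarrow> real"
  assumes n: "n \<ge> 1" and h: "\<And>a. a \<in> {1..n} \<Longrightarrow> h n k a \<in> unit_cube k"
    and f: "f \<in> borel_measurable (lborel_vec k)"
  shows "(\<integral>v. f v \<partial>grid_empirical h k n) = (\<Sum>a=1..n. f (h n k a)) / real n"
proof -
  have "h n k \<in> measurable (uniform_count_measure {1..n}) (lborel_vec k)"
    using h unfolding measurable_def unit_cube_def
    by (auto simp: space_uniform_count_measure sets_uniform_count_measure space_lborel_vec PiE_iff)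
  then have "(\<integral>v. f v \<partial>grid_empirical h k n) = (\<integral>a. f (h n k a) \<partial>uniform_count_measure {1..n})"
    unfolding grid_empirical_def using f by (rule integral_distr)
  also have "\<dots> = (\<Sum>a=1..n. f (h n k a)) / real n"
    by (subst integral_uniform_count_measure) simp_all
  finally show ?thesis .
qed

text \<open>The factor 2 leaves room for a strict inequality in the limit, and there are only
  finitely many cells, so one threshold for n serves them all.\<close>

lemma grid_tents_eventually:
  assumes w: "weak_conv_vec k (grid_empirical h k) (uniform_measure (lborel_vec k) (unit_cube k))"
    and h: "\<And>n a. a \<in> {1..n} \<Longrightarrow> h n k a \<in> unit_cube k" and N: "N \<ge> 1"
  shows "\<forall>\<^sub>F n in sequentially. \<forall>q\<in>cells k N. (\<Sum>a=1..n. tents k N q (h n k a)) / real n \<le> 2 * (2 / real N) ^ k"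
proof (intro eventually_ball_finite finite_cells ballI)
  fix q assume "q \<in> cells k N"
  have "bounded (tents k N q ` space (lborel_vec k))"
    unfolding bounded_iff using tents_nonneg tents_le_1 by (intro exI[of _ 1]) auto
  then have "(\<lambda>n. \<integral>v. tents k N q v \<partial>grid_empirical h k n) \<longlonglongrightarrow>
      (\<integral>v. tents k N q v \<partial>uniform_measure (lborel_vec k) (unit_cube k))"
    using w continuous_on_tents unfolding weak_conv_vec_def by blast
  moreover have "(\<integral>v. tents k N q v \<partial>uniform_measure (lborel_vec k) (unit_cube k)) < 2 * (2 / real N) ^ k"
    using tents_uniform_integral_le[OF N, of k q] N by (smt (verit) divide_pos_pos of_nat_0_less_iff zero_less_power less_le_trans zero_less_one)
  ultimately have "\<forall>\<^sub>F n in sequentially. (\<integral>v. tents k N q v \<partial>grid_empirical h k n) < 2 * (2 / real N) ^ k"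
    by (rule order_tendstoD)
  then show "\<forall>\<^sub>F n in sequentially. (\<Sum>a=1..n. tents k N q (h n k a)) / real n \<le> 2 * (2 / real N) ^ k"
    using eventually_ge_at_top[of 1]
  proof eventually_elim
    case (elim n)
    then show ?case using integral_grid_empirical[of n h k "tents k N q"] h tents_measurable by simp
  qed
qed

text \<open>Over finitely many permutations the minimum is attained, so the choice behind
  \<open>arg_min\<close> does pick a minimiser.\<close>

lemma opt_assignment:
  fixes h d n X i
  defines "cost \<equiv> \<lambda>\<sigma>. \<Sum>a=1..n. (L2_set (\<lambda>j. X a i j - h n (d i) (\<sigma> a) j) {1..d i})\<^sup>2"
  shows opt_assignment_permutes: "opt_assignment h d n X i permutes {1..n}"
    and opt_assignment_min: "\<And>\<sigma>. \<sigma> permutes {1..n} \<Longrightarrow> cost (opt_assignment h d n X i) \<le> cost \<sigma>"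
proof -
  let ?P = "{\<sigma>. \<sigma> permutes {1..n}}"
  have fin: "finite ?P" by (simp add: finite_permutations)
  have ne: "?P \<noteq> {}" using permutes_id by blast
  obtain \<sigma>0 where "\<sigma>0 \<in> ?P" "\<And>\<sigma>. \<sigma> \<in> ?P \<Longrightarrow> cost \<sigma>0 \<le> cost \<sigma>"
    using ex_min_if_finite[of "cost ` ?P"] fin ne by (auto simp: not_less)
  then have "is_arg_min cost (\<lambda>\<sigma>. \<sigma> permutes {1..n}) \<sigma>0"
    unfolding is_arg_min_def by (auto simp: not_less)
  then have "is_arg_min cost (\<lambda>\<sigma>. \<sigma> permutes {1..n}) (arg_min cost (\<lambda>\<sigma>. \<sigma> permutes {1..n}))"
    unfolding arg_min_def by (rule someI[where P = "is_arg_min cost (\<lambda>\<sigma>. \<sigma> permutes {1..n})"])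
  then have "is_arg_min cost (\<lambda>\<sigma>. \<sigma> permutes {1..n}) (opt_assignment h d n X i)"
    unfolding opt_assignment_def cost_def .
  then show "opt_assignment h d n X i permutes {1..n}"
    and "\<And>\<sigma>. \<sigma> permutes {1..n} \<Longrightarrow> cost (opt_assignment h d n X i) \<le> cost \<sigma>"
    unfolding is_arg_min_def by (auto simp: not_less)
qed

text \<open>Swapping the ranks of \<open>a\<close> and \<open>b\<close> cannot lower the cost. Only
  two summands change, their squared norms cancel, and twice the pairing remains.\<close>

lemma opt_assignment_monotone:
  fixes h d n X i
  defines "\<sigma> \<equiv> opt_assignment h d n X i"
  assumes ab: "a \<in> {1..n}" "b \<in> {1..n}"
  shows "0 \<le> (\<Sum>j=1..d i. (X a i j - X b i j) * (h n (d i) (\<sigma> a) j - h n (d i) (\<sigma> b) j))"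
proof (cases "a = b")
  case False
  define u where "u c j = h n (d i) (\<sigma> c) j" for c j
  define D where "D c e = (\<Sum>j=1..d i. (X c i j - u e j)\<^sup>2)" for c e
  let ?\<tau> = "Transposition.transpose a b"
  have cost: "(L2_set (\<lambda>j. X c i j - h n (d i) ((\<sigma> \<circ> \<rho>) c) j) {1..d i})\<^sup>2 = D c (\<rho> c)" for c \<rho>
    by (simp add: L2_set_def D_def u_def sum_nonneg)
  have "\<sigma> \<circ> ?\<tau> permutes {1..n}"
    unfolding \<sigma>_def by (intro permutes_compose permutes_swap_id ab opt_assignment_permutes)
  then have "(\<Sum>c=1..n. (L2_set (\<lambda>j. X c i j - h n (d i) ((\<sigma> \<circ> id) c) j) {1..d i})\<^sup>2)
      \<le> (\<Sum>c=1..n. (L2_set (\<lambda>j. X c i j - h n (d i) ((\<sigma> \<circ> ?\<tau>) c) j) {1..d i})\<^sup>2)"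
    using opt_assignment_min[of "\<sigma> \<circ> ?\<tau>" n X i h d] unfolding \<sigma>_def by simp
  then have le: "(\<Sum>c=1..n. D c c) \<le> (\<Sum>c=1..n. D c (?\<tau> c))" unfolding cost by simp
  have split: "(\<Sum>c=1..n. g c) = g a + g b + (\<Sum>c\<in>{1..n}-{a}-{b}. g c)" for g :: "nat \<Rightarrow> real"
    using sum.remove[of "{1..n}" a g] sum.remove[of "{1..n}-{a}" b g] ab False by simp
  have "(\<Sum>c\<in>{1..n}-{a}-{b}. D c (?\<tau> c)) = (\<Sum>c\<in>{1..n}-{a}-{b}. D c c)"
    by (intro sum.cong) (auto simp: Transposition.transpose_def)
  then have "D a a + D b b \<le> D a b + D b a"
    using le unfolding split[of "\<lambda>c. D c c"] split[of "\<lambda>c. D c (?\<tau> c)"]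
    by (simp add: Transposition.transpose_def)
  moreover have "D a b + D b a - D a a - D b b = 2 * (\<Sum>j=1..d i. (X a i j - X b i j) * (u a j - u b j))"
    unfolding D_def sum_distrib_left sum.distrib[symmetric] sum_subtractf[symmetric]
    by (intro sum.cong refl) (simp add: power2_eq_square algebra_simps)
  ultimately show ?thesis unfolding u_def by simp
qed simp

section \<open>Threshold crossings of monotone pairings\<close>

text \<open>In such a cell the rank does not decide on which side of the threshold the datum lies.
  The gap \<open>\<eta>\<close> makes every crossing cost a definite amount in the pairing.\<close>

definition bad_cell ::
    "nat \<Rightarrow> nat \<Rightarrow> nat set \<Rightarrow> (nat \<Rightarrow> nat \<Rightarrow> real) \<Rightarrow> (nat \<Rightarrow> nat \<Rightarrow> real) \<Rightarrow> (nat \<Rightarrow> real) \<Rightarrow> real \<Rightarrow> nat \<Rightarrow> (nat \<Rightarrow> nat) \<Rightarrow> bool" where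
  "bad_cell k N A y u c \<eta> j q \<longleftrightarrow>
    (\<exists>a\<in>A. tents k N q (u a) \<noteq> 0 \<and> y a j \<le> c j) \<and> (\<exists>a\<in>A. tents k N q (u a) \<noteq> 0 \<and> c j + \<eta> < y a j)"

text \<open>Going up in direction j by L cells would decrease the j-th coordinate by more than the other
  coordinates can compensate.\<close>

lemma bad_cells_close:
  assumes mono: "\<And>a b. a \<in> A \<Longrightarrow> b \<in> A \<Longrightarrow> 0 \<le> (\<Sum>l=1..k. (y a l - y b l) * (u a l - u b l))"
    and M: "\<And>a l. a \<in> A \<Longrightarrow> l \<in> {1..k} \<Longrightarrow> \<bar>y a l\<bar> \<le> M"
    and N: "N \<ge> 1" and \<eta>: "\<eta> > 0" and L: "real L \<ge> 4 * real k * M / \<eta> + 3"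
    and j: "j \<in> {1..k}" and bad: "bad_cell k N A y u c \<eta> j q" "bad_cell k N A y u c \<eta> j q'"
    and same: "\<And>l. l \<in> {1..k} \<Longrightarrow> l \<noteq> j \<Longrightarrow> q l = q' l" and far: "q j + L \<le> q' j"
  shows False
proof -
  \<comment> \<open>The low datum \<open>a\<close> sits in the upper cell \<open>q'\<close> and the
    high datum \<open>b\<close> in the lower cell \<open>q\<close>, against the order that
    monotonicity prescribes.\<close>
  obtain a where a: "a \<in> A" "tents k N q' (u a) \<noteq> 0" "y a j \<le> c j" using bad(2) unfolding bad_cell_def by auto
  obtain b where b: "b \<in> A" "tents k N q (u b) \<noteq> 0" "c j + \<eta> < y b j" using bad(1) unfolding bad_cell_def by auto
  have M0: "M \<ge> 0" using M[OF a(1) j] by linarith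
  have N0: "real N > 0" using N by simp
  \<comment> \<open>The nodes are at least \<open>L\<close> steps apart in direction
    \<open>j\<close>, and each scaled rank is within 1 of its node, hence
    \<open>L - 2\<close>.\<close>
  have tj: "(y a j - y b j) * (real N * u a j - real N * u b j) \<le> - \<eta> * (real L - 2)"
  proof -
    have "real N * u a j - real N * u b j \<ge> real L - 2"
      using tents_support[OF a(2) j] tents_support[OF b(2) j] far by linarith
    moreover have "real L - 2 \<ge> 0"
    proof -
      have "4 * real k * M / \<eta> \<ge> 0" using M0 \<eta> by simp
      then show ?thesis using L by linarith
    qed
    moreover have "y b j - y a j \<ge> \<eta>" using a(3) b(3) by linarith
    ultimately have "\<eta> * (real L - 2) \<le> (y b j - y a j) * (real N * u a j - real N * u b j)"
      using \<eta> by (intro mult_mono) auto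
    then show ?thesis by (simp add: algebra_simps)
  qed
  \<comment> \<open>In the other directions both cells have the same node index, so the scaled ranks
    differ by at most 2 and the data by at most 2M.\<close>
  have tl: "(y a l - y b l) * (real N * u a l - real N * u b l) \<le> 4 * M" if l: "l \<in> {1..k} - {j}" for l
  proof -
    have "\<bar>real N * u a l - real N * u b l\<bar> \<le> 2"
      using tents_support[OF a(2), of l] tents_support[OF b(2), of l] same[of l] l by auto
    moreover have "\<bar>y a l - y b l\<bar> \<le> 2 * M" using M[OF a(1), of l] M[OF b(1), of l] l by auto
    ultimately have "\<bar>y a l - y b l\<bar> * \<bar>real N * u a l - real N * u b l\<bar> \<le> (2 * M) * 2"
      using M0 by (intro mult_mono) auto
    then show ?thesis unfolding abs_mult[symmetric] by linarith
  qed
  have "(\<Sum>l\<in>{1..k} - {j}. (y a l - y b l) * (real N * u a l - real N * u b l)) \<le> (\<Sum>l\<in>{1..k} - {j}. 4 * M)"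
    by (intro sum_mono tl)
  also have "\<dots> \<le> real k * (4 * M)"
    using M0 j by (simp add: mult_right_mono)
  finally have "(\<Sum>l=1..k. (y a l - y b l) * (real N * u a l - real N * u b l)) \<le> - \<eta> * (real L - 2) + real k * (4 * M)"
    using tj j by (subst sum.remove[of _ j]) auto
  moreover have "(\<Sum>l=1..k. (y a l - y b l) * (real N * u a l - real N * u b l))
      = real N * (\<Sum>l=1..k. (y a l - y b l) * (u a l - u b l))"
    unfolding sum_distrib_left by (intro sum.cong refl) (simp add: algebra_simps)
  moreover have "real N * (\<Sum>l=1..k. (y a l - y b l) * (u a l - u b l)) \<ge> 0"
    using mono[OF a(1) b(1)] N0 by simp
  ultimately have "\<eta> * (real L - 2) \<le> 4 * real k * M" by linarith
  \<comment> \<open>The 3 in the bound for \<open>L\<close>, against the 2 lost above, makes the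
    contradiction strict.\<close>
  moreover have "\<eta> * (real L - 3) \<ge> 4 * real k * M"
    using L \<eta> by (simp add: field_simps)
  ultimately show False using \<eta> by (simp add: algebra_simps)
qed

text \<open>On a line of cells in direction \<open>j\<close> no two bad cells are \<open>L\<close>
  or more apart, so their residues modulo \<open>L\<close> are distinct. Each of the
  \<open>(N + 1) ^ (k - 1)\<close> lines thus carries at most \<open>L\<close> of them.\<close>

lemma card_bad_cells:
  assumes mono: "\<And>a b. a \<in> A \<Longrightarrow> b \<in> A \<Longrightarrow> 0 \<le> (\<Sum>l=1..k. (y a l - y b l) * (u a l - u b l))"
    and M: "\<And>a l. a \<in> A \<Longrightarrow> l \<in> {1..k} \<Longrightarrow> \<bar>y a l\<bar> \<le> M"
    and N: "N \<ge> 1" and \<eta>: "\<eta> > 0" and L: "real L \<ge> 4 * real k * M / \<eta> + 3" "L \<ge> 1"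
    and j: "j \<in> {1..k}"
  shows "card {q \<in> cells k N. bad_cell k N A y u c \<eta> j q} \<le> L * (N + 1) ^ (k - 1)"
proof -
  let ?B = "{q \<in> cells k N. bad_cell k N A y u c \<eta> j q}"
  let ?\<phi> = "\<lambda>q. (q j mod L, restrict q ({1..k} - {j}))"
  let ?T = "{..<L} \<times> PiE ({1..k} - {j}) (\<lambda>_. {0..N})"
  have close: "\<not> q j + L \<le> q' j"
    if "q \<in> ?B" "q' \<in> ?B" "\<And>l. l \<in> {1..k} - {j} \<Longrightarrow> q l = q' l" for q q'
  proof
    assume far: "q j + L \<le> q' j"
    show False
      by (rule bad_cells_close[of A y u k M N \<eta> L j c q q'])
        (use mono M N \<eta> L(1) j far that in \<open>simp_all\<close>)
  qed
  have "inj_on ?\<phi> ?B"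
  proof (rule inj_onI)
    fix q q' assume q: "q \<in> ?B" and q': "q' \<in> ?B" and eq: "?\<phi> q = ?\<phi> q'"
    have l: "q l = q' l" if "l \<in> {1..k} - {j}" for l
      using eq that by (metis prod.inject restrict_apply')
    have "q j mod L = q' j mod L" using eq by simp
    have "q j = q' j"
    proof (rule ccontr)
      assume "q j \<noteq> q' j"
      then consider "q j < q' j" | "q' j < q j" by linarith
      then show False
      proof cases
        case 1
        then have "L dvd q' j - q j" using \<open>q j mod L = q' j mod L\<close> by (metis less_imp_le mod_eq_dvd_iff_nat)
        then have "L \<le> q' j - q j" using 1 by (intro dvd_imp_le) auto
        then show False using close[OF q q' l] 1 by linarith
      next
        case 2
        then have "L dvd q j - q' j" using \<open>q j mod L = q' j mod L\<close> by (metis less_imp_le mod_eq_dvd_iff_nat)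
        then have "L \<le> q j - q' j" using 2 by (intro dvd_imp_le) auto
        then show False using close[OF q' q l[symmetric]] 2 by linarith
      qed
    qed
    show "q = q'"
    proof (rule PiE_ext)
      show "q \<in> PiE {1..k} (\<lambda>_. {0..N})" "q' \<in> PiE {1..k} (\<lambda>_. {0..N})" using q q' by (auto simp: cells_def)
      fix i assume "i \<in> {1..k}"
      then show "q i = q' i" using l[of i] \<open>q j = q' j\<close> by (cases "i = j") auto
    qed
  qed
  moreover have "?\<phi> ` ?B \<subseteq> ?T"
    using L(2) by (intro image_subsetI) (auto simp: cells_def PiE_iff restrict_PiE_iff)
  moreover have "finite ?T" by (intro finite_cartesian_product finite_PiE) auto
  ultimately have "card ?B \<le> card ?T" by (intro card_inj_on_le)
  also have "card ?T = L * (N + 1) ^ (k - 1)"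
    using j by (simp add: card_cartesian_product card_PiE)
  finally show ?thesis .
qed

definition below :: "nat \<Rightarrow> (nat \<Rightarrow> real) \<Rightarrow> (nat \<Rightarrow> real) \<Rightarrow> real" where
  "below k c v = (if \<forall>j\<in>{1..k}. v j \<le> c j then 1 else 0)"

text \<open>The two conditions are those of the crossing bound: bounded coordinates, and an excess
  of more than \<open>\<eta>\<close> whenever a coordinate exceeds its threshold.\<close>

definition typical :: "nat \<Rightarrow> real \<Rightarrow> real \<Rightarrow> (nat \<Rightarrow> real) \<Rightarrow> (nat \<Rightarrow> real) \<Rightarrow> bool" where
  "typical k M \<eta> c v \<longleftrightarrow> (\<forall>j\<in>{1..k}. \<bar>v j\<bar> \<le> M \<and> \<not> (c j < v j \<and> v j \<le> c j + \<eta>))"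

text \<open>\<open>F\<close> marks the cells that meet a typical point of the orthant. In a cell
  that is bad in no direction this is correct for every typical point there: one outside the orthant
  exceeds some threshold by more than \<open>\<eta>\<close>, and together with the marking point it
  would make the cell bad.\<close>

lemma below_cell_approx:
  assumes A: "A = {a \<in> {1..n}. typical k M \<eta> c (y a)}"
    and a: "a \<in> {1..n}" and u: "u a \<in> unit_cube k"
    and F: "\<And>q. F q = (if \<exists>a\<in>A. tents k N q (u a) \<noteq> 0 \<and> below k c (y a) = 1 then 1 else 0)"
  shows "\<bar>below k c (y a) - (\<Sum>q\<in>cells k N. tents k N q (u a) * F q)\<bar>
    \<le> (if a \<in> A then 0 else 1) + (\<Sum>q\<in>{q \<in> cells k N. \<exists>j\<in>{1..k}. bad_cell k N A y u c \<eta> j q}. tents k N q (u a))"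
proof -
  let ?f = "below k c (y a)" and ?w = "\<lambda>q. tents k N q (u a)"
  let ?B = "{q \<in> cells k N. \<exists>j\<in>{1..k}. bad_cell k N A y u c \<eta> j q}"
  have f01: "?f \<in> {0, 1}" "F q \<in> {0, 1}" for q by (auto simp: below_def F)
  \<comment> \<open>The tents at \<open>u a\<close> sum to 1, so the error is a weighted average of
    the errors on single cells.\<close>
  have "?f - (\<Sum>q\<in>cells k N. ?w q * F q) = (\<Sum>q\<in>cells k N. ?w q * (?f - F q))"
    using sum_tents[OF u, of N] by (simp add: right_diff_distrib sum_subtractf sum_distrib_right[symmetric])
  then have le: "\<bar>?f - (\<Sum>q\<in>cells k N. ?w q * F q)\<bar> \<le> (\<Sum>q\<in>cells k N. ?w q * \<bar>?f - F q\<bar>)"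
    using sum_abs[of "\<lambda>q. ?w q * (?f - F q)" "cells k N"] by (simp add: abs_mult tents_nonneg)
  have d1: "\<bar>?f - F q\<bar> \<le> 1" for q using f01(1) f01(2)[of q] by auto
  show ?thesis
  proof (cases "a \<in> A")
    case False
    have "(\<Sum>q\<in>cells k N. ?w q * \<bar>?f - F q\<bar>) \<le> (\<Sum>q\<in>cells k N. ?w q)"
      by (intro sum_mono mult_left_le d1 tents_nonneg)
    also have "\<dots> = 1" by (rule sum_tents[OF u])
    also have "\<dots> \<le> 1 + (\<Sum>q\<in>?B. ?w q)" by (simp add: sum_nonneg tents_nonneg)
    finally show ?thesis using le False by simp
  next
    case True
    have "?w q * \<bar>?f - F q\<bar> \<le> (if q \<in> ?B then ?w q else 0)" if q: "q \<in> cells k N" for q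
    proof (cases "q \<in> ?B \<or> ?w q = 0")
      case True
      then show ?thesis using mult_left_le[OF d1[of q] tents_nonneg[of k N q "u a"]] by auto
    next
      case False
      then have good: "\<And>j. j \<in> {1..k} \<Longrightarrow> \<not> bad_cell k N A y u c \<eta> j q" and w: "?w q \<noteq> 0" using q by auto
      have "?f = F q"
      proof (cases "?f = 1")
        case True
        then show ?thesis using \<open>a \<in> A\<close> w by (auto simp: F)
      next
        case f: False
        then obtain j where j: "j \<in> {1..k}" "\<not> y a j \<le> c j" by (auto simp: below_def split: if_splits)
        then have gt: "c j + \<eta> < y a j" using \<open>a \<in> A\<close> unfolding A typical_def by force
        have "F q \<noteq> 1"
        proof
          assume "F q = 1"
          then obtain b where b: "b \<in> A" "tents k N q (u b) \<noteq> 0" "below k c (y b) = 1"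
            by (auto simp: F split: if_splits)
          then have "y b j \<le> c j" using j by (auto simp: below_def split: if_splits)
          then have "bad_cell k N A y u c \<eta> j q" unfolding bad_cell_def using b \<open>a \<in> A\<close> w gt by blast
          then show False using good j by blast
        qed
        then show ?thesis using f f01(1) f01(2)[of q] by auto
      qed
      then show ?thesis by (simp add: tents_nonneg)
    qed
    then have "(\<Sum>q\<in>cells k N. ?w q * \<bar>?f - F q\<bar>) \<le> (\<Sum>q\<in>cells k N. if q \<in> ?B then ?w q else 0)"
      by (intro sum_mono)
    also have "\<dots> = (\<Sum>q\<in>?B. ?w q)"
      using finite_cells by (subst sum.inter_restrict[symmetric]) (auto intro!: sum.cong)
    finally show ?thesis using le True by simp
  qed
qed

text \<open>The bad cells number O(N^(k-1)) and each carries O(N^(-k)) of the ranks; with N + 1 at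
  most 2N the product is at most k L 4^k / N.\<close>

lemma cell_scale_exists:
  fixes \<epsilon> :: real
  assumes k: "k \<ge> 1" and \<epsilon>: "\<epsilon> > 0"
  shows "\<exists>N\<ge>1. real (k * (L * (N + 1) ^ (k - 1))) * (2 * (2 / real N) ^ k) \<le> \<epsilon>"
proof -
  obtain N0 :: nat where N0: "real N0 \<ge> real k * real L * 4 ^ k / \<epsilon>" using real_arch_simple by blast
  define N where "N = max 1 N0"
  have N: "N \<ge> 1" "real N \<ge> real k * real L * 4 ^ k / \<epsilon>" using N0 by (auto simp: N_def)
  then have Npos: "real N > 0" by simp
  have "(real N + 1) ^ (k - 1) \<le> (2 * real N) ^ (k - 1)" using N by (intro power_mono) auto
  then have "real k * (real L * (real N + 1) ^ (k - 1)) * (2 * (2 / real N) ^ k)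
      \<le> real k * (real L * (2 * real N) ^ (k - 1)) * (2 * (2 / real N) ^ k)"
    using Npos by (intro mult_right_mono mult_left_mono) auto
  also have "\<dots> = real k * real L * 4 ^ k / real N"
  proof -
    obtain m where m: "k = Suc m" using k by (cases k) auto
    have "(2 * real N) ^ m * (2 / real N) ^ m = (2 * real N * (2 / real N)) ^ m"
      by (rule power_mult_distrib[symmetric])
    also have "2 * real N * (2 / real N) = 4" using Npos by simp
    finally have p: "(2 * real N) ^ m * (2 / real N) ^ m = 4 ^ m" .
    have e: "K * (real L * x) * (2 * (2 / real N * y)) = K * real L * (x * y) * (4 / real N)" for K x y
      by simp
    have "real k * (real L * (2 * real N) ^ (k - 1)) * (2 * (2 / real N) ^ k) = real k * real L * 4 ^ m * (4 / real N)"
      unfolding p[symmetric] m power_Suc diff_Suc_1 by (rule e)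
    then show ?thesis by (simp add: m)
  qed
  also have "\<dots> \<le> \<epsilon>" using N(2) Npos \<epsilon> by (simp add: field_simps)
  finally show ?thesis using N(1) by (intro exI[of _ N]) (simp add: add.commute)
qed

text \<open>The order of choices matters: \<open>N\<close> precedes n and the sample, whereas the
  marking \<open>F\<close> may depend on both. So finitely many tents, fixed in advance, serve all
  samples.\<close>

lemma rank_determines_below:
  assumes k: "d i \<ge> 1" and \<epsilon>: "\<epsilon> > 0" and \<eta>: "\<eta> > 0"
    and w: "weak_conv_vec (d i) (grid_empirical h (d i)) (uniform_measure (lborel_vec (d i)) (unit_cube (d i)))"
    and h: "\<And>n a. a \<in> {1..n} \<Longrightarrow> h n (d i) a \<in> unit_cube (d i)"
  shows "\<exists>N\<ge>1. \<forall>\<^sub>F n in sequentially. \<forall>X. \<exists>F. (\<forall>q. F q \<in> {0..1}) \<and>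
     (\<Sum>a=1..n. \<bar>below (d i) c (X a i)
        - (\<Sum>q\<in>cells (d i) N. tents (d i) N q (h n (d i) (opt_assignment h d n X i a)) * F q)\<bar>) / real n
      \<le> real (card {a \<in> {1..n}. \<not> typical (d i) M \<eta> c (X a i)}) / real n + \<epsilon>"
proof -
  let ?k = "d i"
  obtain L0 :: nat where L0: "real L0 \<ge> 4 * real ?k * M / \<eta> + 3" using real_arch_simple by blast
  define L where "L = max 1 L0"
  have L: "real L \<ge> 4 * real ?k * M / \<eta> + 3" "L \<ge> 1" using L0 by (auto simp: L_def)
  obtain N where N: "N \<ge> 1" "real (?k * (L * (N + 1) ^ (?k - 1))) * (2 * (2 / real N) ^ ?k) \<le> \<epsilon>"
    using cell_scale_exists[OF k \<epsilon>] by blast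
  show ?thesis
  proof (intro exI[of _ N] conjI N(1))
    show "\<forall>\<^sub>F n in sequentially. \<forall>X. \<exists>F. (\<forall>q. F q \<in> {0..1}) \<and>
     (\<Sum>a=1..n. \<bar>below ?k c (X a i)
        - (\<Sum>q\<in>cells ?k N. tents ?k N q (h n ?k (opt_assignment h d n X i a)) * F q)\<bar>) / real n
      \<le> real (card {a \<in> {1..n}. \<not> typical ?k M \<eta> c (X a i)}) / real n + \<epsilon>"
    proof (rule eventually_mono)
      show "\<forall>\<^sub>F n in sequentially. \<forall>q\<in>cells ?k N.
          (\<Sum>a=1..n. tents ?k N q (h n ?k a)) / real n \<le> 2 * (2 / real N) ^ ?k"
        by (rule grid_tents_eventually[OF w _ N(1)]) (rule h)
      fix n assume elim: "\<forall>q\<in>cells ?k N.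
          (\<Sum>a=1..n. tents ?k N q (h n ?k a)) / real n \<le> 2 * (2 / real N) ^ ?k"
      show "\<forall>X. \<exists>F. (\<forall>q. F q \<in> {0..1}) \<and>
        (\<Sum>a=1..n. \<bar>below ?k c (X a i)
          - (\<Sum>q\<in>cells ?k N. tents ?k N q (h n ?k (opt_assignment h d n X i a)) * F q)\<bar>) / real n
        \<le> real (card {a \<in> {1..n}. \<not> typical ?k M \<eta> c (X a i)}) / real n + \<epsilon>"
      proof
        fix X
        let ?\<sigma> = "opt_assignment h d n X i"
        let ?u = "\<lambda>a. h n ?k (?\<sigma> a)" and ?y = "\<lambda>a. X a i"
        define A where "A = {a \<in> {1..n}. typical ?k M \<eta> c (?y a)}"
        let ?B = "{q \<in> cells ?k N. \<exists>j\<in>{1..?k}. bad_cell ?k N A ?y ?u c \<eta> j q}"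
        define F :: "_ \<Rightarrow> real" where
          "F q = (if \<exists>a\<in>A. tents ?k N q (?u a) \<noteq> 0 \<and> below ?k c (?y a) = 1 then 1 else 0)" for q
        have \<sigma>: "?\<sigma> permutes {1..n}" by (rule opt_assignment_permutes)
        have u: "?u a \<in> unit_cube ?k" if "a \<in> {1..n}" for a
          using h permutes_in_image[OF \<sigma>] that by blast
        have "card ?B \<le> card (\<Union>j\<in>{1..?k}. {q \<in> cells ?k N. bad_cell ?k N A ?y ?u c \<eta> j q})"
          by (intro card_mono) (auto simp: finite_cells)
        also have "\<dots> \<le> (\<Sum>j\<in>{1..?k}. card {q \<in> cells ?k N. bad_cell ?k N A ?y ?u c \<eta> j q})"
          by (rule card_UN_le) simp
        also have "\<dots> \<le> (\<Sum>j\<in>{1..?k}. L * (N + 1) ^ (?k - 1))"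
        proof (rule sum_mono)
          fix j assume j: "j \<in> {1..?k}"
          show "card {q \<in> cells ?k N. bad_cell ?k N A ?y ?u c \<eta> j q} \<le> L * (N + 1) ^ (?k - 1)"
          proof (rule card_bad_cells[OF _ _ N(1) \<eta> L j])
            fix a b assume "a \<in> A" "b \<in> A"
            then show "0 \<le> (\<Sum>l=1..?k. (?y a l - ?y b l) * (?u a l - ?u b l))"
              unfolding A_def by (intro opt_assignment_monotone) auto
          qed (auto simp: A_def typical_def)
        qed
        finally have cB: "card ?B \<le> ?k * (L * (N + 1) ^ (?k - 1))" by simp
        \<comment> \<open>The ranks of a sample are a rearrangement of the whole grid, so the tent
          means over the ranks equal those over the grid.\<close>
        have mean: "(\<Sum>a=1..n. tents ?k N q (?u a)) / real n \<le> 2 * (2 / real N) ^ ?k" if "q \<in> cells ?k N" for q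
        proof -
          have "(\<Sum>a=1..n. tents ?k N q (?u a)) = (\<Sum>a=1..n. tents ?k N q (h n ?k a))"
            using sum.permute[OF \<sigma>, of "\<lambda>a. tents ?k N q (h n ?k a)"] by (simp only: o_def)
          then show ?thesis using elim that by simp
        qed
        have "(\<Sum>a=1..n. \<bar>below ?k c (?y a) - (\<Sum>q\<in>cells ?k N. tents ?k N q (?u a) * F q)\<bar>)
            \<le> (\<Sum>a=1..n. (if a \<in> A then 0 else 1) + (\<Sum>q\<in>?B. tents ?k N q (?u a)))"
          by (intro sum_mono below_cell_approx[OF A_def _ u F_def])
        also have "\<dots> = real (card {a \<in> {1..n}. \<not> typical ?k M \<eta> c (?y a)}) + (\<Sum>q\<in>?B. \<Sum>a=1..n. tents ?k N q (?u a))"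
        proof -
          have "(\<Sum>a=1..n. if a \<in> A then 0 else 1) = (\<Sum>a=1..n. if \<not> typical ?k M \<eta> c (?y a) then 1 else 0 :: real)"
            by (intro sum.cong) (auto simp: A_def)
          also have "\<dots> = real (card {a \<in> {1..n}. \<not> typical ?k M \<eta> c (?y a)})"
            by (subst sum.inter_filter[symmetric]) auto
          finally show ?thesis unfolding sum.distrib by (subst sum.swap) simp
        qed
        finally have "(\<Sum>a=1..n. \<bar>below ?k c (?y a) - (\<Sum>q\<in>cells ?k N. tents ?k N q (?u a) * F q)\<bar>) / real n
            \<le> (real (card {a \<in> {1..n}. \<not> typical ?k M \<eta> c (?y a)}) + (\<Sum>q\<in>?B. \<Sum>a=1..n. tents ?k N q (?u a))) / real n"
          by (rule divide_right_mono) simp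
        also have "\<dots> = real (card {a \<in> {1..n}. \<not> typical ?k M \<eta> c (?y a)}) / real n
            + (\<Sum>q\<in>?B. (\<Sum>a=1..n. tents ?k N q (?u a)) / real n)"
          by (simp add: add_divide_distrib sum_divide_distrib)
        also have "(\<Sum>q\<in>?B. (\<Sum>a=1..n. tents ?k N q (?u a)) / real n) \<le> (\<Sum>q\<in>?B. 2 * (2 / real N) ^ ?k)"
          by (intro sum_mono mean) auto
        also have "\<dots> \<le> real (?k * (L * (N + 1) ^ (?k - 1))) * (2 * (2 / real N) ^ ?k)"
          using cB unfolding sum_constant by (intro mult_right_mono) (auto simp del: of_nat_mult)
        also have "\<dots> \<le> \<epsilon>" by (rule N(2))
        finally show "\<exists>F. (\<forall>q. F q \<in> {0..1}) \<and>
          (\<Sum>a=1..n. \<bar>below ?k c (?y a) - (\<Sum>q\<in>cells ?k N. tents ?k N q (?u a) * F q)\<bar>) / real n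
          \<le> real (card {a \<in> {1..n}. \<not> typical ?k M \<eta> c (?y a)}) / real n + \<epsilon>"
          by (intro exI[of _ F]) (auto simp: F_def)
      qed
    qed
  qed
qed

section \<open>Factorization of orthant frequencies\<close>

text \<open>Bounding the sum over all tent products controls any later combination of them with
  coefficients in [0,1], even sample-dependent ones. \<open>\<kappa>\<close> depends on
  \<open>N\<close> but on neither n nor the sample.\<close>

lemma small_stat_cells:
  assumes C: "\<And>s. s \<in> {2..r} \<Longrightarrow> C s > 0" and d: "\<And>i. i \<in> {1..r} \<Longrightarrow> d i \<ge> 1" and \<epsilon>: "\<epsilon> > 0"
  shows "\<exists>\<kappa>>0. \<forall>n x. in_cubes r d n x \<longrightarrow> JdCov_stat r d n C x < \<kappa> \<longrightarrow>
    (\<Sum>q\<in>PiE {1..r} (\<lambda>i. cells (d i) (N i)). \<bar>dep r n x (\<lambda>u. \<Prod>i=1..r. tents (d i) (N i) (q i) (u i))\<bar>) \<le> \<epsilon>"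
proof -
  let ?Q = "PiE {1..r} (\<lambda>i. cells (d i) (N i))"
  let ?G = "\<lambda>q u. \<Prod>i=1..r. tents (d i) (N i) (q i) (u i)"
  have fin: "finite ?Q" by (intro finite_PiE finite_cells) simp
  have cont: "continuous_on A (?G q)" for A q
  proof (rule continuous_on_prod)
    fix i
    have "continuous_on A (\<lambda>u :: nat \<Rightarrow> nat \<Rightarrow> real. u i)"
      using continuous_on_product_then_coordinatewise[OF continuous_on_id, of A i] .
    then show "continuous_on A (\<lambda>u. tents (d i) (N i) (q i) (u i))"
      by (rule continuous_on_compose2[OF continuous_on_tents[of UNIV]]) simp
  qed
  have "((\<lambda>(n, x). dep r n x (?G q)) \<longlongrightarrow> 0) (small_stat r d C)" for q
    by (rule dep_tendsto[of r C d, OF C d cont])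
  then have "((\<lambda>p. \<Sum>q\<in>?Q. \<bar>case p of (n, x) \<Rightarrow> dep r n x (?G q)\<bar>) \<longlongrightarrow> 0) (small_stat r d C)"
    by (intro tendsto_null_sum tendsto_rabs_zero)
  then have "\<forall>\<^sub>F p in small_stat r d C. (\<Sum>q\<in>?Q. \<bar>case p of (n, x) \<Rightarrow> dep r n x (?G q)\<bar>) < \<epsilon>"
    using \<epsilon> by (rule order_tendstoD)
  then obtain \<kappa> where "\<kappa> > 0" "\<And>n x. in_cubes r d n x \<Longrightarrow> \<bar>JdCov_stat r d n C x\<bar> < \<kappa> \<Longrightarrow>
      (\<Sum>q\<in>?Q. \<bar>dep r n x (?G q)\<bar>) < \<epsilon>"
    unfolding eventually_small_stat by auto
  moreover have "\<bar>JdCov_stat r d n C x\<bar> = JdCov_stat r d n C x" for n x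
    using JdCov_stat_nonneg[of r C d n x, OF C] by simp
  ultimately show ?thesis by (intro exI[of _ \<kappa>]) (auto intro: less_imp_le)
qed

text \<open>Blocks outside \<open>J\<close> receive the constant 1, so one product over all blocks
  describes the joint orthant events of every subfamily, as independence requires.\<close>

definition restr_below :: "nat set \<Rightarrow> (nat \<Rightarrow> nat) \<Rightarrow> (nat \<Rightarrow> nat \<Rightarrow> real) \<Rightarrow> nat \<Rightarrow> (nat \<Rightarrow> real) \<Rightarrow> real" where
  "restr_below J d c i v = (if i \<in> J then below (d i) (c i) v else 1)"

lemma restr_below_range: "0 \<le> restr_below J d c i v" "restr_below J d c i v \<le> 1"
  by (auto simp: restr_below_def below_def)

lemma mean_le:
  fixes f :: "nat \<Rightarrow> real"
  assumes "\<And>a. a \<in> {1..n} \<Longrightarrow> f a \<le> c" "c \<ge> 0"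
  shows "(\<Sum>a=1..n. f a) / real n \<le> c"
proof (cases "n = 0")
  case False
  have "(\<Sum>a=1..n. f a) \<le> (\<Sum>a=1..n. c)" by (intro sum_mono assms)
  then show ?thesis using False by (simp add: divide_le_eq mult.commute)
qed (use assms in simp)

text \<open>Telescoping of products of numbers in [0,1], for both orders of averaging and
  multiplying.\<close>

lemma mean_prod_diff:
  fixes f g :: "nat \<Rightarrow> nat \<Rightarrow> real"
  assumes f: "\<And>i a. i \<in> {1..r} \<Longrightarrow> a \<in> {1..n} \<Longrightarrow> f i a \<in> {0..1}"
    and g: "\<And>i a. i \<in> {1..r} \<Longrightarrow> a \<in> {1..n} \<Longrightarrow> g i a \<in> {0..1}"
    and e: "\<And>i. i \<in> {1..r} \<Longrightarrow> (\<Sum>a=1..n. \<bar>f i a - g i a\<bar>) / real n \<le> e i"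
  shows "\<bar>(\<Sum>a=1..n. \<Prod>i=1..r. f i a) / real n - (\<Sum>a=1..n. \<Prod>i=1..r. g i a) / real n\<bar> \<le> (\<Sum>i=1..r. e i)"
    and "\<bar>(\<Prod>i=1..r. (\<Sum>a=1..n. f i a) / real n) - (\<Prod>i=1..r. (\<Sum>a=1..n. g i a) / real n)\<bar> \<le> (\<Sum>i=1..r. e i)"
proof -
  have "\<bar>(\<Sum>a=1..n. \<Prod>i=1..r. f i a) - (\<Sum>a=1..n. \<Prod>i=1..r. g i a)\<bar> \<le> (\<Sum>a=1..n. \<Sum>i=1..r. \<bar>f i a - g i a\<bar>)"
    unfolding sum_subtractf[symmetric]
  proof (intro order_trans[OF sum_abs] sum_mono)
    fix a assume a: "a \<in> {1..n}"
    show "\<bar>(\<Prod>i=1..r. f i a) - (\<Prod>i=1..r. g i a)\<bar> \<le> (\<Sum>i=1..r. \<bar>f i a - g i a\<bar>)"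
      using norm_prod_diff[of "{1..r}" "\<lambda>i. f i a" "\<lambda>i. g i a"] f[OF _ a] g[OF _ a] by auto
  qed
  also have "\<dots> = (\<Sum>i=1..r. \<Sum>a=1..n. \<bar>f i a - g i a\<bar>)" by (rule sum.swap)
  finally have "\<bar>(\<Sum>a=1..n. \<Prod>i=1..r. f i a) - (\<Sum>a=1..n. \<Prod>i=1..r. g i a)\<bar> / real n
      \<le> (\<Sum>i=1..r. \<Sum>a=1..n. \<bar>f i a - g i a\<bar>) / real n"
    by (rule divide_right_mono) simp
  also have "\<dots> = (\<Sum>i=1..r. (\<Sum>a=1..n. \<bar>f i a - g i a\<bar>) / real n)" by (rule sum_divide_distrib)
  also have "\<dots> \<le> (\<Sum>i=1..r. e i)" by (intro sum_mono e)
  finally show "\<bar>(\<Sum>a=1..n. \<Prod>i=1..r. f i a) / real n - (\<Sum>a=1..n. \<Prod>i=1..r. g i a) / real n\<bar> \<le> (\<Sum>i=1..r. e i)"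
    unfolding diff_divide_distrib[symmetric] abs_divide by simp
  have m: "\<bar>(\<Sum>a=1..n. F a) / real n\<bar> \<le> 1" if "\<And>a. a \<in> {1..n} \<Longrightarrow> F a \<in> {0..1}" for F :: "nat \<Rightarrow> real"
  proof -
    have "(\<Sum>a=1..n. F a) \<ge> 0" using that by (intro sum_nonneg) auto
    then show ?thesis using mean_le[of n F 1] that by auto
  qed
  have "\<bar>(\<Prod>i=1..r. (\<Sum>a=1..n. f i a) / real n) - (\<Prod>i=1..r. (\<Sum>a=1..n. g i a) / real n)\<bar>
      \<le> (\<Sum>i=1..r. \<bar>(\<Sum>a=1..n. f i a) / real n - (\<Sum>a=1..n. g i a) / real n\<bar>)"
    using norm_prod_diff[of "{1..r}" "\<lambda>i. (\<Sum>a=1..n. f i a) / real n" "\<lambda>i. (\<Sum>a=1..n. g i a) / real n"]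
      m f g by simp
  also have "\<dots> \<le> (\<Sum>i=1..r. e i)"
  proof (rule sum_mono)
    fix i assume i: "i \<in> {1..r}"
    have "\<bar>(\<Sum>a=1..n. f i a) / real n - (\<Sum>a=1..n. g i a) / real n\<bar> = \<bar>\<Sum>a=1..n. f i a - g i a\<bar> / real n"
      by (simp add: sum_subtractf flip: diff_divide_distrib)
    also have "\<dots> \<le> (\<Sum>a=1..n. \<bar>f i a - g i a\<bar>) / real n"
      by (intro divide_right_mono sum_abs) simp
    finally show "\<bar>(\<Sum>a=1..n. f i a) / real n - (\<Sum>a=1..n. g i a) / real n\<bar> \<le> e i" using e[OF i] by linarith
  qed
  finally show "\<bar>(\<Prod>i=1..r. (\<Sum>a=1..n. f i a) / real n) - (\<Prod>i=1..r. (\<Sum>a=1..n. g i a) / real n)\<bar> \<le> (\<Sum>i=1..r. e i)" .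
qed

text \<open>Replace each orthant indicator by its function of the rank: this costs the sum of the
  cell errors once in the mean of products and once in the product of means. The \<open>dep\<close>
  of the product of rank functions is a combination of tent products and costs the last
  \<open>\<epsilon>\<close>.\<close>

lemma small_stat_factorizes:
  fixes h :: "nat \<Rightarrow> nat \<Rightarrow> nat \<Rightarrow> nat \<Rightarrow> real" and M \<eta> :: "nat \<Rightarrow> real"
  assumes C: "\<And>s. s \<in> {2..r} \<Longrightarrow> C s > 0" and d: "\<And>i. i \<in> {1..r} \<Longrightarrow> d i \<ge> 1"
    and \<epsilon>: "\<epsilon> > 0" and \<eta>: "\<And>i. \<eta> i > 0"
    and h: "\<And>n i a. i \<in> {1..r} \<Longrightarrow> a \<in> {1..n} \<Longrightarrow> h n (d i) a \<in> unit_cube (d i)"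
    and w: "\<And>i. i \<in> {1..r} \<Longrightarrow>
           weak_conv_vec (d i) (grid_empirical h (d i)) (uniform_measure (lborel_vec (d i)) (unit_cube (d i)))"
  shows "\<exists>\<kappa>>0. \<forall>\<^sub>F n in sequentially. \<forall>X. RJdCov_stat h r d n C X < \<kappa> \<longrightarrow>
     \<bar>(\<Sum>a=1..n. \<Prod>i=1..r. restr_below J d c i (X a i)) / real n
        - (\<Prod>i=1..r. (\<Sum>a=1..n. restr_below J d c i (X a i)) / real n)\<bar>
     \<le> 2 * (\<Sum>i=1..r. real (card {a \<in> {1..n}. \<not> typical (d i) (M i) (\<eta> i) (c i) (X a i)}) / real n + \<epsilon>) + \<epsilon>"
proof -
  let ?u = "\<lambda>n X a i. h n (d i) (opt_assignment h d n X i a)"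
  let ?e = "\<lambda>n X i. real (card {a \<in> {1..n}. \<not> typical (d i) (M i) (\<eta> i) (c i) (X a i)}) / real n + \<epsilon>"
  define P where "P N i n \<longleftrightarrow> (\<forall>X. \<exists>F. (\<forall>q. F q \<in> {0..1}) \<and>
     (\<Sum>a=1..n. \<bar>below (d i) (c i) (X a i) - (\<Sum>q\<in>cells (d i) N. tents (d i) N q (?u n X a i) * F q)\<bar>) / real n
      \<le> ?e n X i)" for N i n
  have "\<forall>i\<in>{1..r}. \<exists>N. \<forall>\<^sub>F n in sequentially. P N i n"
  proof
    fix i assume i: "i \<in> {1..r}"
    have "\<exists>N\<ge>1. \<forall>\<^sub>F n in sequentially. P N i n"
      unfolding P_def by (rule rank_determines_below[where M = "M i"]) (use d[OF i] \<epsilon> \<eta> w[OF i] h[OF i] in simp_all)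
    then show "\<exists>N. \<forall>\<^sub>F n in sequentially. P N i n" by blast
  qed
  from bchoice[OF this] obtain N where N: "\<forall>i\<in>{1..r}. \<forall>\<^sub>F n in sequentially. P (N i) i n" ..
  then have ev: "\<forall>\<^sub>F n in sequentially. \<forall>i\<in>{1..r}. P (N i) i n"
    by (intro eventually_ball_finite) auto
  obtain \<kappa> where \<kappa>: "\<kappa> > 0" "\<And>n x. in_cubes r d n x \<Longrightarrow> JdCov_stat r d n C x < \<kappa> \<Longrightarrow>
      (\<Sum>q\<in>PiE {1..r} (\<lambda>i. cells (d i) (N i)). \<bar>dep r n x (\<lambda>u. \<Prod>i=1..r. tents (d i) (N i) (q i) (u i))\<bar>) \<le> \<epsilon>"
    using small_stat_cells[of r C d \<epsilon> N, OF C d \<epsilon>] by blast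
  show ?thesis
  proof (intro exI[of _ \<kappa>] conjI \<kappa>(1))
    show "\<forall>\<^sub>F n in sequentially. \<forall>X. RJdCov_stat h r d n C X < \<kappa> \<longrightarrow>
     \<bar>(\<Sum>a=1..n. \<Prod>i=1..r. restr_below J d c i (X a i)) / real n
        - (\<Prod>i=1..r. (\<Sum>a=1..n. restr_below J d c i (X a i)) / real n)\<bar>
     \<le> 2 * (\<Sum>i=1..r. ?e n X i) + \<epsilon>"
      using ev eventually_ge_at_top[of 1]
    proof eventually_elim
      case (elim n)
      show ?case
      proof (intro allI impI)
        fix X assume small: "RJdCov_stat h r d n C X < \<kappa>"
        let ?x = "?u n X"
        have cube: "?x a i \<in> unit_cube (d i)" if "a \<in> {1..n}" "i \<in> {1..r}" for a i
          using h[OF that(2)] permutes_in_image[OF opt_assignment_permutes[of h d n X i]] that(1) by blast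
        define Q where "Q i F \<longleftrightarrow> (\<forall>q. F q \<in> {0..1}) \<and>
           (\<Sum>a=1..n. \<bar>restr_below J d c i (X a i) - (\<Sum>q\<in>cells (d i) (N i). tents (d i) (N i) q (?x a i) * F q)\<bar>) / real n
           \<le> ?e n X i" for i and F :: "(nat \<Rightarrow> nat) \<Rightarrow> real"
        have "\<forall>i\<in>{1..r}. \<exists>F. Q i F"
        proof
        fix i assume i: "i \<in> {1..r}"
        have "\<exists>F. (\<forall>q. F q \<in> {0..1}) \<and>
           (\<Sum>a=1..n. \<bar>restr_below J d c i (X a i) - (\<Sum>q\<in>cells (d i) (N i). tents (d i) (N i) q (?x a i) * F q)\<bar>) / real n
           \<le> ?e n X i"
        proof (cases "i \<in> J")
          case True
          then have r: "restr_below J d c i = below (d i) (c i)" by (simp add: restr_below_def fun_eq_iff)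
          have "P (N i) i n" using elim(1) i by blast
          then show ?thesis unfolding P_def r by (rule spec)
        next
          case False
          \<comment> \<open>For a block outside \<open>J\<close> the marking constantly 1 is exact,
            since the tents sum to 1.\<close>
          have "(\<Sum>a=1..n. \<bar>restr_below J d c i (X a i) - (\<Sum>q\<in>cells (d i) (N i). tents (d i) (N i) q (?x a i) * 1)\<bar>) = 0"
            using False cube i by (intro sum.neutral) (auto simp: restr_below_def sum_tents)
          then show ?thesis using \<epsilon> by (intro exI[of _ "\<lambda>q. 1"]) simp
        qed
        then show "\<exists>F. Q i F" unfolding Q_def .
        qed
        from bchoice[OF this] obtain F where FQ: "\<forall>i\<in>{1..r}. Q i (F i)" ..
        have F01: "\<And>i q. i \<in> {1..r} \<Longrightarrow> F i q \<in> {0..1}" and F: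
          "\<And>i. i \<in> {1..r} \<Longrightarrow> (\<Sum>a=1..n. \<bar>restr_below J d c i (X a i)
              - (\<Sum>q\<in>cells (d i) (N i). tents (d i) (N i) q (?x a i) * F i q)\<bar>) / real n \<le> ?e n X i"
          using FQ unfolding Q_def by blast+
        let ?g = "\<lambda>i v. \<Sum>q\<in>cells (d i) (N i). tents (d i) (N i) q v * F i q"
        let ?f = "\<lambda>i a. restr_below J d c i (X a i)"
        have g01: "?g i (?x a i) \<in> {0..1}" if "i \<in> {1..r}" "a \<in> {1..n}" for i a
        proof -
          have "?g i (?x a i) \<le> (\<Sum>q\<in>cells (d i) (N i). tents (d i) (N i) q (?x a i))"
            using F01[OF that(1)] by (intro sum_mono mult_left_le tents_nonneg) auto
          moreover have "?g i (?x a i) \<ge> 0"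
            using F01[OF that(1)] by (intro sum_nonneg mult_nonneg_nonneg tents_nonneg) auto
          ultimately show ?thesis using sum_tents[OF cube[OF that(2,1)]] by auto
        qed
        have f01: "?f i a \<in> {0..1}" for i a using restr_below_range by auto
        \<comment> \<open>The dependence on the sample goes into coefficients that are products of
          values of \<open>F\<close> in [0,1]; the functions given to \<open>dep\<close> are tent
          products fixed before n.\<close>
        have Q: "(\<Prod>i=1..r. ?g i (u i)) = (\<Sum>q\<in>PiE {1..r} (\<lambda>i. cells (d i) (N i)).
            (\<Prod>i=1..r. F i (q i)) * (\<Prod>i=1..r. tents (d i) (N i) (q i) (u i)))" for u
          by (subst prod_sum_PiE) (simp_all add: finite_cells prod.distrib mult.commute)
        let ?D = "\<lambda>q. dep r n ?x (\<lambda>u. \<Prod>i=1..r. tents (d i) (N i) (q i) (u i))"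
        have eq: "dep r n ?x (\<lambda>u. \<Prod>i=1..r. ?g i (u i))
            = (\<Sum>q\<in>PiE {1..r} (\<lambda>i. cells (d i) (N i)). (\<Prod>i=1..r. F i (q i)) * ?D q)"
          unfolding Q dep_sum dep_cmult ..
        have "\<bar>(\<Prod>i=1..r. F i (q i)) * ?D q\<bar> \<le> \<bar>?D q\<bar>" for q
        proof -
          have "\<bar>\<Prod>i=1..r. F i (q i)\<bar> \<le> 1" unfolding abs_prod using F01 by (intro prod_le_1) auto
          then show ?thesis unfolding abs_mult by (intro mult_left_le_one_le) auto
        qed
        then have "\<bar>\<Sum>q\<in>PiE {1..r} (\<lambda>i. cells (d i) (N i)). (\<Prod>i=1..r. F i (q i)) * ?D q\<bar>
            \<le> (\<Sum>q\<in>PiE {1..r} (\<lambda>i. cells (d i) (N i)). \<bar>?D q\<bar>)"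
          by (intro order_trans[OF sum_abs] sum_mono)
        also have "\<dots> \<le> \<epsilon>"
        proof (rule \<kappa>(2))
          show "in_cubes r d n ?x" using elim(2) cube by (simp add: in_cubes_def)
          show "JdCov_stat r d n C ?x < \<kappa>" using small unfolding RJdCov_stat_def .
        qed
        finally have "\<bar>dep r n ?x (\<lambda>u. \<Prod>i=1..r. ?g i (u i))\<bar> \<le> \<epsilon>" unfolding eq .
        then have D: "\<bar>(\<Sum>a=1..n. \<Prod>i=1..r. ?g i (?x a i)) / real n - (\<Prod>i=1..r. (\<Sum>a=1..n. ?g i (?x a i)) / real n)\<bar> \<le> \<epsilon>"
          unfolding dep_prod[of r n ?x ?g] by simp
        have "\<bar>(\<Sum>a=1..n. \<Prod>i=1..r. ?f i a) / real n - (\<Sum>a=1..n. \<Prod>i=1..r. ?g i (?x a i)) / real n\<bar> \<le> (\<Sum>i=1..r. ?e n X i)"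
          by (rule mean_prod_diff(1)[OF f01 g01 F])
        moreover have "\<bar>(\<Prod>i=1..r. (\<Sum>a=1..n. ?f i a) / real n) - (\<Prod>i=1..r. (\<Sum>a=1..n. ?g i (?x a i)) / real n)\<bar> \<le> (\<Sum>i=1..r. ?e n X i)"
          by (rule mean_prod_diff(2)[OF f01 g01 F])
        ultimately show "\<bar>(\<Sum>a=1..n. \<Prod>i=1..r. ?f i a) / real n - (\<Prod>i=1..r. (\<Sum>a=1..n. ?f i a) / real n)\<bar>
            \<le> 2 * (\<Sum>i=1..r. ?e n X i) + \<epsilon>"
          using D by linarith
      qed
    qed
  qed
qed

section \<open>Dependence and the law of large numbers\<close>

text \<open>Hoeffding's inequality gives a bound for each n on its own product space, so the samples
  of different sizes are never put on a common space.\<close>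

lemma lln_bounded:
  fixes f :: "'a \<Rightarrow> real"
  assumes \<mu>: "prob_space \<mu>" and f: "f \<in> borel_measurable \<mu>" "\<And>x. f x \<in> {0..1}" and \<epsilon>: "\<epsilon> > 0"
  shows "(\<lambda>n. measure (PiM {1..n} (\<lambda>_. \<mu>))
      {X \<in> space (PiM {1..n} (\<lambda>_. \<mu>)). \<epsilon> \<le> \<bar>(\<Sum>a=1..n. f (X a)) / real n - (\<integral>x. f x \<partial>\<mu>)\<bar>}) \<longlonglongrightarrow> 0"
proof (rule tendsto_sandwich[OF _ _ tendsto_const])
  interpret \<mu>: prob_space \<mu> by (rule \<mu>)
  let ?E = "\<lambda>n. {X \<in> space (PiM {1..n} (\<lambda>_. \<mu>)). \<epsilon> \<le> \<bar>(\<Sum>a=1..n. f (X a)) / real n - (\<integral>x. f x \<partial>\<mu>)\<bar>}"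
  show "\<forall>\<^sub>F n in sequentially. 0 \<le> measure (PiM {1..n} (\<lambda>_. \<mu>)) (?E n)" by simp
  show "\<forall>\<^sub>F n in sequentially. measure (PiM {1..n} (\<lambda>_. \<mu>)) (?E n) \<le> 2 * exp (- 2 * real n * \<epsilon>\<^sup>2)"
    using eventually_ge_at_top[of 1]
  proof eventually_elim
    case (elim n)
    let ?M = "PiM {1..n} (\<lambda>_. \<mu>)"
    interpret P: prob_space ?M by (intro prob_space_PiM \<mu>)
    have comp: "distr ?M \<mu> (\<lambda>X. X a) = \<mu>" if "a \<in> {1..n}" for a
      using distr_PiM_component[of "{1..n}" "\<lambda>_. \<mu>" a] \<mu> that by simp
    \<comment> \<open>Restriction to \<open>{1..n}\<close> is the identity on this space, so the
      joint law of the coordinates is the product of their laws, the criterion for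
      independence.\<close>
    have "distr ?M ?M (\<lambda>X. \<lambda>a\<in>{1..n}. X a) = distr ?M ?M (\<lambda>X. X)"
      by (intro distr_cong) (auto simp: space_PiM PiE_iff extensional_restrict)
    also have "\<dots> = PiM {1..n} (\<lambda>a. distr ?M \<mu> (\<lambda>X. X a))"
      by (simp only: distr_id2[OF refl]) (intro PiM_cong refl comp[symmetric])
    finally have "P.indep_vars (\<lambda>_. \<mu>) (\<lambda>a X. X a) {1..n}"
      using elim by (subst P.indep_vars_iff_distr_eq_PiM') auto
    then have ind: "P.indep_vars (\<lambda>_. borel) (\<lambda>a X. f (X a)) {1..n}"
      by (rule P.indep_vars_compose2) (rule f)
    define m where "m = (\<Sum>a\<in>{1..n}. P.expectation (\<lambda>X. f (X a)))"
    interpret H: Hoeffding_ineq ?M "{1..n}" "\<lambda>a X. f (X a)" "\<lambda>_. 0" "\<lambda>_. 1" m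
      unfolding m_def by unfold_locales (use ind f(2) in auto)
    have "P.expectation (\<lambda>X. f (X a)) = (\<integral>x. f x \<partial>\<mu>)" if a: "a \<in> {1..n}" for a
    proof -
      have "(\<integral>x. f x \<partial>\<mu>) = (\<integral>x. f x \<partial>distr ?M \<mu> (\<lambda>X. X a))" by (simp only: comp[OF a])
      also have "\<dots> = P.expectation (\<lambda>X. f (X a))"
        by (rule integral_distr) (use a f in \<open>auto intro: measurable_component_singleton\<close>)
      finally show ?thesis ..
    qed
    then have m: "m = real n * (\<integral>x. f x \<partial>\<mu>)" by (simp add: m_def)
    have n0: "real n > 0" using elim by simp
    have "?E n = {X \<in> space ?M. real n * \<epsilon> \<le> \<bar>(\<Sum>a\<in>{1..n}. f (X a)) - m\<bar>}"
    proof (rule Collect_cong, rule conj_cong[OF refl])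
      fix X
      have "(\<Sum>a=1..n. f (X a)) / real n - (\<integral>x. f x \<partial>\<mu>) = ((\<Sum>a\<in>{1..n}. f (X a)) - m) / real n"
        using n0 by (simp add: m field_simps)
      then show "(\<epsilon> \<le> \<bar>(\<Sum>a=1..n. f (X a)) / real n - (\<integral>x. f x \<partial>\<mu>)\<bar>)
          = (real n * \<epsilon> \<le> \<bar>(\<Sum>a\<in>{1..n}. f (X a)) - m\<bar>)"
        using n0 by (simp add: abs_divide pos_le_divide_eq mult.commute)
    qed
    then have "P.prob (?E n) \<le> 2 * exp (-2 * (real n * \<epsilon>)\<^sup>2 / (\<Sum>a\<in>{1..n}. (1 - 0)\<^sup>2))"
      using H.Hoeffding_ineq_abs_ge[of "real n * \<epsilon>"] n0 \<epsilon> by simp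
    also have "-2 * (real n * \<epsilon>)\<^sup>2 / (\<Sum>a\<in>{1..n}. (1 - 0)\<^sup>2) = - 2 * real n * \<epsilon>\<^sup>2"
      using n0 by (simp add: power2_eq_square)
    finally show ?case .
  qed
  show "(\<lambda>n. 2 * exp (- 2 * real n * \<epsilon>\<^sup>2)) \<longlonglongrightarrow> 0"
    using \<epsilon> by real_asymp
qed

section \<open>Orthants generate the sigma-algebras of the blocks\<close>

lemma measurable_block:
  assumes "sets \<mu> = sets (lborel_blocks r d)" "i \<in> {1..r}"
  shows "(\<lambda>x. x i) \<in> measurable \<mu> (lborel_vec (d i))"
  unfolding measurable_cong_sets[OF assms(1) refl] lborel_blocks_def
  using assms(2) by (rule measurable_component_singleton)

lemma measurable_vec_coordinate:
  "j \<in> {1..k} \<Longrightarrow> (\<lambda>v. v j) \<in> borel_measurable (lborel_vec k)"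
  unfolding measurable_cong_sets[OF sets_lborel_vec refl] by (rule measurable_component_singleton)

lemma below_measurable: "below k c \<in> borel_measurable (lborel_vec k)"
proof -
  note [measurable] = measurable_vec_coordinate
  have "{v \<in> space (lborel_vec k). \<forall>j\<in>{1..k}. v j \<le> c j} \<in> sets (lborel_vec k)"
    by (intro sets.sets_Collect_finite_All) (simp, measurable)
  then show ?thesis unfolding below_def[abs_def] by (intro measurable_If) auto
qed

lemma restr_below_measurable: "restr_below J d c i \<in> borel_measurable (lborel_vec (d i))"
proof (cases "i \<in> J")
  case True
  then have "restr_below J d c i = below (d i) (c i)" by (simp add: restr_below_def fun_eq_iff)
  then show ?thesis using below_measurable by simp
next
  case False
  then have "restr_below J d c i = (\<lambda>_. 1)" by (simp add: restr_below_def fun_eq_iff)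
  then show ?thesis by simp
qed

definition orthant :: "(nat \<Rightarrow> nat \<Rightarrow> real) measure \<Rightarrow> (nat \<Rightarrow> nat) \<Rightarrow> nat \<Rightarrow> (nat \<Rightarrow> real) \<Rightarrow> (nat \<Rightarrow> nat \<Rightarrow> real) set" where
  "orthant \<mu> d i c = {x \<in> space \<mu>. \<forall>j\<in>{1..d i}. x i j \<le> c j}"

lemma orthant_sets:
  assumes s: "sets \<mu> = sets (lborel_blocks r d)" and i: "i \<in> {1..r}"
  shows "orthant \<mu> d i c \<in> sets \<mu>"
proof -
  have "(\<lambda>x. x i j) \<in> borel_measurable \<mu>" if "j \<in> {1..d i}" for j
    using measurable_compose[OF measurable_block[OF s i] measurable_vec_coordinate[OF that]] .
  note [measurable] = this
  show ?thesis unfolding orthant_def by (intro sets.sets_Collect_finite_All) (simp, measurable)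
qed

text \<open>An orthant bounds all coordinates of the block at once; letting the other bounds run
  through the naturals exhausts the half-space of coordinate \<open>j\<close>.\<close>

lemma coordinate_measurable_orthants:
  assumes j: "j \<in> {1..d i}"
  shows "(\<lambda>x. x i j) \<in> borel_measurable (sigma (space \<mu>) (range (orthant \<mu> d i)))"
proof (rule borel_measurableI_le)
  fix y :: real
  let ?S = "sigma (space \<mu>) (range (orthant \<mu> d i))"
  have sub: "range (orthant \<mu> d i) \<subseteq> Pow (space \<mu>)" by (auto simp: orthant_def)
  have "{x \<in> space \<mu>. x i j \<le> y} = (\<Union>m::nat. orthant \<mu> d i (\<lambda>l. if l = j then y else real m))"
  proof (intro set_eqI iffI)
    fix x assume x: "x \<in> {x \<in> space \<mu>. x i j \<le> y}"
    obtain m :: nat where m: "real m \<ge> (\<Sum>l=1..d i. \<bar>x i l\<bar>)" using real_arch_simple by blast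
    have "x i l \<le> real m" if "l \<in> {1..d i}" for l
      using member_le_sum[of l "{1..d i}" "\<lambda>l. \<bar>x i l\<bar>"] that m by auto
    then show "x \<in> (\<Union>m::nat. orthant \<mu> d i (\<lambda>l. if l = j then y else real m))"
      using x by (auto simp: orthant_def intro!: exI[of _ m])
  next
    fix x assume "x \<in> (\<Union>m::nat. orthant \<mu> d i (\<lambda>l. if l = j then y else real m))"
    then obtain m :: nat where "x \<in> orthant \<mu> d i (\<lambda>l. if l = j then y else real m)" by blast
    then have "x \<in> space \<mu>" "x i j \<le> (if j = j then y else real m)" using j unfolding orthant_def by blast+
    then show "x \<in> {x \<in> space \<mu>. x i j \<le> y}" by simp
  qed
  also have "\<dots> \<in> sets ?S"
    by (intro sets.countable_UN) (auto simp: sets_measure_of[OF sub])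
  finally show "{x \<in> space ?S. x i j \<le> y} \<in> sets ?S"
    by (simp add: space_measure_of[OF sub])
qed

text \<open>For each block the orthants are closed under intersection and generate the sigma-algebra
  of the block; the product formula for all \<open>J\<close> is independence of these generators,
  and it extends to the generated sigma-algebras.\<close>

lemma eq_PiM_if_orthants_factorize:
  assumes \<mu>: "prob_space \<mu>" and s: "sets \<mu> = sets (lborel_blocks r d)"
    and fac: "\<And>J c. J \<subseteq> {1..r} \<Longrightarrow> (\<integral>x. (\<Prod>i=1..r. restr_below J d c i (x i)) \<partial>\<mu>)
        = (\<Prod>i=1..r. \<integral>x. restr_below J d c i (x i) \<partial>\<mu>)"
  shows "\<mu> = PiM {1..r} (marginal d \<mu>)"
\<comment> \<open>With no blocks the space is a single point; the product criterion for independent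
  variables used below is for a nonempty index set.\<close>
proof (cases "r = 0")
  case True
  interpret \<mu>: prob_space \<mu> by (rule \<mu>)
  have sp: "sets \<mu> = sets (PiM {} (marginal d \<mu>))"
    using True s by (simp add: lborel_blocks_def sets_PiM_empty)
  have "space \<mu> = {\<lambda>_. undefined}" using sets_eq_imp_space_eq[OF sp] by (simp add: space_PiM_empty)
  interpret E: prob_space "PiM {} (marginal d \<mu>)" by (rule prob_space_PiM) simp
  show ?thesis unfolding True
  proof (rule measure_eqI)
    show "sets \<mu> = sets (PiM {1..0} (marginal d \<mu>))" using sp by simp
    fix A assume "A \<in> sets \<mu>"
    then have "A = {} \<or> A = space \<mu>" using sp by (auto simp: sets_PiM_empty \<open>space \<mu> = _\<close>)
    then show "emeasure \<mu> A = emeasure (PiM {1..0} (marginal d \<mu>)) A"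
      using \<mu>.emeasure_space_1 E.emeasure_space_1 sets_eq_imp_space_eq[OF sp] by auto
  qed
next
  case False
  interpret \<mu>: prob_space \<mu> by (rule \<mu>)
  have ind: "\<mu>.indep_sets (\<lambda>i. range (orthant \<mu> d i)) {1..r}"
  proof (rule \<mu>.indep_setsI)
    show "range (orthant \<mu> d i) \<subseteq> \<mu>.events" if "i \<in> {1..r}" for i
      using orthant_sets[OF s that] by auto
    fix A J assume J: "J \<noteq> {}" "J \<subseteq> {1..r}" "finite J" and "\<forall>j\<in>J. A j \<in> range (orthant \<mu> d j)"
    then have "\<forall>j\<in>J. \<exists>c. A j = orthant \<mu> d j c" by auto
    from bchoice[OF this] obtain c where c: "\<forall>j\<in>J. A j = orthant \<mu> d j (c j)" ..
    have A: "A i \<in> sets \<mu>" if "i \<in> J" for i using c orthant_sets[OF s] J that by auto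
    have rb: "restr_below J d c i (x i) = (if i \<in> J then indicator (A i) x else 1)" if "x \<in> space \<mu>" for i x
      using c that by (auto simp: restr_below_def below_def orthant_def indicator_def)
    have "(\<Prod>i=1..r. restr_below J d c i (x i)) = indicator (\<Inter>j\<in>J. A j) x" if x: "x \<in> space \<mu>" for x
    proof -
      have "(\<Prod>i=1..r. restr_below J d c i (x i)) = (\<Prod>i=1..r. if i \<in> J then indicator (A i) x else 1)"
        by (intro prod.cong refl rb x)
      also have "\<dots> = (\<Prod>i\<in>{1..r} \<inter> J. indicator (A i) x)"
        by (rule prod.inter_restrict[symmetric]) simp
      also have "{1..r} \<inter> J = J" using J by auto
      also have "(\<Prod>i\<in>J. indicator (A i) x) = (indicator (\<Inter>j\<in>J. A j) x :: real)"
      proof (cases "\<forall>i\<in>J. x \<in> A i")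
        case False
        then obtain i where "i \<in> J" "x \<notin> A i" by blast
        then show ?thesis using J(3) by (subst prod_zero) (auto simp: indicator_def)
      qed (auto simp: indicator_def)
      finally show ?thesis .
    qed
    then have "(\<integral>x. (\<Prod>i=1..r. restr_below J d c i (x i)) \<partial>\<mu>) = (\<integral>x. indicator (\<Inter>j\<in>J. A j) x \<partial>\<mu>)"
      by (intro Bochner_Integration.integral_cong refl)
    also have "\<dots> = \<mu>.prob (\<Inter>j\<in>J. A j)"
    proof -
      have "(\<Inter>j\<in>J. A j) \<in> sets \<mu>" using J A by (intro sets.finite_INT) auto
      then show ?thesis by simp
    qed
    finally have "\<mu>.prob (\<Inter>j\<in>J. A j) = (\<Prod>i=1..r. \<integral>x. restr_below J d c i (x i) \<partial>\<mu>)"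
      using fac[OF J(2), of c] by simp
    also have "\<dots> = (\<Prod>i=1..r. if i \<in> J then \<mu>.prob (A i) else 1)"
    proof (intro prod.cong refl)
      fix i assume "i \<in> {1..r}"
      have "(\<integral>x. restr_below J d c i (x i) \<partial>\<mu>) = (\<integral>x. (if i \<in> J then indicator (A i) x else 1) \<partial>\<mu>)"
        by (intro Bochner_Integration.integral_cong refl rb)
      also have "\<dots> = (if i \<in> J then \<mu>.prob (A i) else 1)"
        using A[of i] by (auto simp: \<mu>.prob_space)
      finally show "(\<integral>x. restr_below J d c i (x i) \<partial>\<mu>) = (if i \<in> J then \<mu>.prob (A i) else 1)" .
    qed
    also have "\<dots> = (\<Prod>i\<in>{1..r} \<inter> J. \<mu>.prob (A i))"
      by (rule prod.inter_restrict[symmetric]) simp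
    also have "{1..r} \<inter> J = J" using J by auto
    finally show "\<mu>.prob (\<Inter>j\<in>J. A j) = (\<Prod>j\<in>J. \<mu>.prob (A j))" .
  qed
  have stable: "Int_stable (range (orthant \<mu> d i))" for i
  proof (rule Int_stableI)
    fix A B assume "A \<in> range (orthant \<mu> d i)" "B \<in> range (orthant \<mu> d i)"
    then obtain c c' where "A = orthant \<mu> d i c" "B = orthant \<mu> d i c'" by auto
    then have "A \<inter> B = orthant \<mu> d i (\<lambda>j. min (c j) (c' j))" by (auto simp: orthant_def)
    then show "A \<inter> B \<in> range (orthant \<mu> d i)" by simp
  qed
  have gen: "{(\<lambda>x. x i) -` A \<inter> space \<mu> |A. A \<in> sets (lborel_vec (d i))} \<subseteq> sigma_sets (space \<mu>) (range (orthant \<mu> d i))"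
    if i: "i \<in> {1..r}" for i
  proof -
    let ?S = "sigma (space \<mu>) (range (orthant \<mu> d i))"
    have sub: "range (orthant \<mu> d i) \<subseteq> Pow (space \<mu>)" by (auto simp: orthant_def)
    have spS: "space ?S = space \<mu>" by (simp add: space_measure_of[OF sub])
    have xi: "x i \<in> space (lborel_vec (d i))" if "x \<in> space \<mu>" for x
      using measurable_space[OF measurable_block[OF s i] that] .
    have "(\<lambda>x. x i) \<in> measurable ?S (PiM {1..d i} (\<lambda>_. borel))"
    proof (rule measurable_PiM_single')
      show "(\<lambda>x. x i j) \<in> borel_measurable ?S" if "j \<in> {1..d i}" for j
        by (rule coordinate_measurable_orthants[of j d i \<mu>, OF that])
      show "(\<lambda>x. x i) \<in> space ?S \<rightarrow> (\<Pi>\<^sub>E j\<in>{1..d i}. space borel)"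
        using xi unfolding spS space_lborel_vec by auto
    qed
    then have "(\<lambda>x. x i) \<in> measurable ?S (lborel_vec (d i))"
      by (simp only: measurable_cong_sets[OF refl sets_lborel_vec])
    then show ?thesis
      using measurable_sets[of "\<lambda>x. x i" ?S "lborel_vec (d i)"] by (auto simp: spS sets_measure_of[OF sub])
  qed
  have "\<mu>.indep_sets (\<lambda>i. sigma_sets (space \<mu>) (range (orthant \<mu> d i))) {1..r}"
    by (rule \<mu>.indep_sets_sigma[OF ind stable])
  then have "\<mu>.indep_sets (\<lambda>i. {(\<lambda>x. x i) -` A \<inter> space \<mu> |A. A \<in> sets (lborel_vec (d i))}) {1..r}"
    by (rule \<mu>.indep_sets_mono_sets) (rule gen)
  then have iv: "\<mu>.indep_vars (\<lambda>i. lborel_vec (d i)) (\<lambda>i x. x i) {1..r}"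
    unfolding \<mu>.indep_vars_def2 using measurable_block[OF s] by blast
  have "\<mu> = distr \<mu> (lborel_blocks r d) (\<lambda>x. x)" using distr_id2[OF s[symmetric]] by simp
  also have "\<dots> = distr \<mu> (lborel_blocks r d) (\<lambda>x. \<lambda>i\<in>{1..r}. x i)"
    using sets_eq_imp_space_eq[OF s]
    by (intro distr_cong refl) (simp add: lborel_blocks_def space_PiM PiE_iff extensional_restrict)
  also have "\<dots> = PiM {1..r} (\<lambda>i. distr \<mu> (lborel_vec (d i)) (\<lambda>x. x i))"
    unfolding lborel_blocks_def
    by (rule \<mu>.indep_vars_iff_distr_eq_PiM'[THEN iffD1, OF _ _ iv]) (use False measurable_block[OF s] in auto)
  also have "\<dots> = PiM {1..r} (marginal d \<mu>)"
    by (intro PiM_cong refl) (simp add: marginal_def)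
  finally show ?thesis .
qed

lemma typical_sets:
  "{v \<in> space (lborel_vec k). typical k M \<eta> c v} \<in> sets (lborel_vec k)"
proof -
  note [measurable] = measurable_vec_coordinate
  show ?thesis unfolding typical_def by (intro sets.sets_Collect_finite_All) (simp, measurable)
qed

text \<open>The exceptional sets shrink to the empty set as the bound grows and the strip narrows,
  because the strip leaves out \<open>c j\<close> itself: each coordinate of a fixed point is either
  at or below its threshold or a positive distance above it.\<close>

lemma atypical_small:
  assumes P: "prob_space P" and s: "sets P = sets (lborel_vec k)" and \<epsilon>: "\<epsilon> > 0"
  shows "\<exists>M \<eta>. \<eta> > 0 \<and> measure P {v \<in> space P. \<not> typical k M \<eta> c v} < \<epsilon>"
proof -
  interpret P: prob_space P by (rule P)
  let ?A = "\<lambda>m::nat. {v \<in> space P. \<not> typical k (real m) (1 / real (Suc m)) c v}"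
  have meas: "?A m \<in> sets P" for m
  proof -
    have "?A m = space P - {v \<in> space (lborel_vec k). typical k (real m) (1 / real (Suc m)) c v}"
      using sets_eq_imp_space_eq[OF s] by auto
    then show ?thesis using typical_sets s by auto
  qed
  have dec: "decseq ?A"
  proof (rule decseq_SucI)
    fix m
    have "1 / real (Suc (Suc m)) \<le> 1 / real (Suc m)" by (simp add: field_simps)
    then show "?A (Suc m) \<subseteq> ?A m" by (fastforce simp: typical_def)
  qed
  have "(\<Inter>m. ?A m) = {}"
  proof (rule ccontr)
    assume "(\<Inter>m. ?A m) \<noteq> {}"
    then obtain v where v: "\<And>m. \<not> typical k (real m) (1 / real (Suc m)) c v" by auto
    \<comment> \<open>Taking \<open>m\<close> at least every \<open>g j\<close> bounds
      \<open>v j\<close>, and for a coordinate above its threshold it gives an excess of at least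
      1/m, more than the width 1/(m+1).\<close>
    define g where "g j = max \<bar>v j\<bar> (if v j > c j then 1 / (v j - c j) else 0)" for j
    obtain m :: nat where m: "real m \<ge> (\<Sum>j=1..k. g j)" using real_arch_simple by blast
    have gm: "g j \<le> real m" if "j \<in> {1..k}" for j
    proof -
      have "0 \<le> g l" for l by (auto simp: g_def)
      then have "g j \<le> (\<Sum>j=1..k. g j)" using that by (intro member_le_sum) auto
      then show ?thesis using m by linarith
    qed
    have "typical k (real m) (1 / real (Suc m)) c v"
      unfolding typical_def
    proof (intro ballI conjI notI)
      fix j assume j: "j \<in> {1..k}"
      show "\<bar>v j\<bar> \<le> real m" using gm[OF j] by (simp add: g_def)
      assume "c j < v j \<and> v j \<le> c j + 1 / real (Suc m)"
      then have c: "v j - c j > 0" "v j - c j \<le> 1 / real (Suc m)" by auto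
      then have "real (Suc m) \<le> 1 / (v j - c j)" by (simp add: field_simps)
      also have "\<dots> \<le> g j" using c by (simp add: g_def)
      finally show False using gm[OF j] by simp
    qed
    then show False using v by blast
  qed
  then have "(\<lambda>m. P.prob (?A m)) \<longlonglongrightarrow> 0"
    using P.finite_Lim_measure_decseq[of ?A] meas dec by auto
  then have "\<forall>\<^sub>F m in sequentially. P.prob (?A m) < \<epsilon>" using \<epsilon> by (rule order_tendstoD)
  then obtain m where "P.prob (?A m) < \<epsilon>" unfolding eventually_sequentially by blast
  then show ?thesis by (intro exI[of _ "real m"] exI[of _ "1 / real (Suc m)"]) simp
qed

lemma sample_coordinate_measurable:
  assumes "sets \<mu> = sets (lborel_blocks r d)" "a \<in> {1..n}" "i \<in> {1..r}" "j \<in> {1..d i}"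
  shows "(\<lambda>X. X a i j) \<in> borel_measurable (PiM {1..n} (\<lambda>_. \<mu>))"
  using measurable_compose[OF measurable_compose
      [OF measurable_component_singleton[OF assms(2)] measurable_block[OF assms(1,3)]]
      measurable_vec_coordinate[OF assms(4)]] .

text \<open>Dependence makes some product formula for orthants fail by a gap
  \<open>\<Delta>\<close>. If the statistic were small and the relevant empirical means all near
  their expectations, the formula would hold with an error below \<open>\<Delta>\<close>; so
  smallness forces one of 2r + 1 deviations, each of vanishing probability.\<close>

lemma rank_stat_tail:
  fixes h :: "nat \<Rightarrow> nat \<Rightarrow> nat \<Rightarrow> nat \<Rightarrow> real" and \<mu> :: "(nat \<Rightarrow> nat \<Rightarrow> real) measure"
  assumes C: "\<And>s. s \<in> {2..r} \<Longrightarrow> C s > 0" and d: "\<And>i. i \<in> {1..r} \<Longrightarrow> d i \<ge> 1"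
    and h: "\<And>n i a. i \<in> {1..r} \<Longrightarrow> a \<in> {1..n} \<Longrightarrow> h n (d i) a \<in> unit_cube (d i)"
    and w: "\<And>i. i \<in> {1..r} \<Longrightarrow>
           weak_conv_vec (d i) (grid_empirical h (d i)) (uniform_measure (lborel_vec (d i)) (unit_cube (d i)))"
    and \<mu>: "prob_space \<mu>" and s: "sets \<mu> = sets (lborel_blocks r d)"
    and dep: "\<mu> \<noteq> PiM {1..r} (marginal d \<mu>)"
  shows "\<exists>\<kappa>>0. (\<lambda>n. measure (PiM {1..n} (\<lambda>_. \<mu>))
      {X \<in> space (PiM {1..n} (\<lambda>_. \<mu>)). RJdCov_stat h r d n C X < \<kappa>}) \<longlonglongrightarrow> 0"
proof -
  interpret \<mu>: prob_space \<mu> by (rule \<mu>)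
  obtain J c where J: "(\<integral>x. (\<Prod>i=1..r. restr_below J d c i (x i)) \<partial>\<mu>)
      \<noteq> (\<Prod>i=1..r. \<integral>x. restr_below J d c i (x i) \<partial>\<mu>)"
    using eq_PiM_if_orthants_factorize[OF \<mu> s] dep by blast
  let ?f = "\<lambda>i x. restr_below J d c i (x i)"
  let ?g = "\<lambda>x. \<Prod>i=1..r. ?f i x"
  define \<Delta> where "\<Delta> = \<bar>(\<integral>x. ?g x \<partial>\<mu>) - (\<Prod>i=1..r. \<integral>x. ?f i x \<partial>\<mu>)\<bar>"
  have \<Delta>: "\<Delta> > 0" using J by (simp add: \<Delta>_def)
  \<comment> \<open>The total error below is (2 + 7r) times \<open>\<epsilon>\<close>: 2 from the
    joint mean and the last term of the factorization, r from the marginal means, and 6r from twice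
    the sum over blocks of an atypical fraction of at most 2 \<open>\<epsilon>\<close> plus a cell
    error \<open>\<epsilon>\<close>. The 3 makes it strictly less than
    \<open>\<Delta>\<close>.\<close>
  define \<epsilon> where "\<epsilon> = \<Delta> / (3 + 7 * real r)"
  have \<epsilon>: "\<epsilon> > 0" using \<Delta> by (simp add: \<epsilon>_def)
  have \<epsilon>\<Delta>: "(2 + 7 * real r) * \<epsilon> < \<Delta>"
  proof -
    have "(3 + 7 * real r) * \<epsilon> = \<Delta>" unfolding \<epsilon>_def by (simp add: add_nonneg_eq_0_iff)
    then show ?thesis using \<epsilon> by (simp add: algebra_simps)
  qed
  have marg: "prob_space (marginal d \<mu> i)" "sets (marginal d \<mu> i) = sets (lborel_vec (d i))" if "i \<in> {1..r}" for i
    using \<mu>.prob_space_distr[OF measurable_block[OF s that]] by (simp_all add: marginal_def)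
  have "\<forall>i\<in>{1..r}. \<exists>p. snd p > 0 \<and>
      measure (marginal d \<mu> i) {v \<in> space (marginal d \<mu> i). \<not> typical (d i) (fst p) (snd p) (c i) v} < \<epsilon>"
  proof
    fix i assume i: "i \<in> {1..r}"
    obtain M \<eta> where "\<eta> > 0" "measure (marginal d \<mu> i) {v \<in> space (marginal d \<mu> i). \<not> typical (d i) M \<eta> (c i) v} < \<epsilon>"
      using atypical_small[OF marg[OF i] \<epsilon>] by blast
    then show "\<exists>p. snd p > 0 \<and>
      measure (marginal d \<mu> i) {v \<in> space (marginal d \<mu> i). \<not> typical (d i) (fst p) (snd p) (c i) v} < \<epsilon>"
      by (intro exI[of _ "(M, \<eta>)"]) simp
  qed
  from bchoice[OF this] obtain p where p: "\<forall>i\<in>{1..r}. snd (p i) > 0 \<and>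
      measure (marginal d \<mu> i) {v \<in> space (marginal d \<mu> i). \<not> typical (d i) (fst (p i)) (snd (p i)) (c i) v} < \<epsilon>" ..
  define M where "M i = fst (p i)" for i
  \<comment> \<open>The value 1 outside the index range makes \<open>\<eta>\<close> positive
    everywhere, as \<open>small_stat_factorizes\<close> asks.\<close>
  define \<eta> where "\<eta> i = (if i \<in> {1..r} then snd (p i) else 1)" for i
  have \<eta>: "\<eta> i > 0" for i using p by (simp add: \<eta>_def)
  let ?t = "\<lambda>i x. if typical (d i) (M i) (\<eta> i) (c i) (x i) then 0 else 1 :: real"
  have f_meas: "?f i \<in> borel_measurable \<mu>" if "i \<in> {1..r}" for i
    by (rule measurable_compose[OF measurable_block[OF s that] restr_below_measurable[of J d c i]])
  have g_meas: "?g \<in> borel_measurable \<mu>" by (intro borel_measurable_prod f_meas)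
  have t_meas: "?t i \<in> borel_measurable \<mu>" if "i \<in> {1..r}" for i
  proof (rule measurable_compose[OF measurable_block[OF s that]])
    show "(\<lambda>v. if typical (d i) (M i) (\<eta> i) (c i) v then 0 else 1 :: real) \<in> borel_measurable (lborel_vec (d i))"
      using typical_sets by (intro measurable_If) auto
  qed
  have t_mean: "(\<integral>x. ?t i x \<partial>\<mu>) < \<epsilon>" if i: "i \<in> {1..r}" for i
  proof -
    let ?A = "{v \<in> space (marginal d \<mu> i). \<not> typical (d i) (M i) (\<eta> i) (c i) v}"
    have sp: "space (marginal d \<mu> i) = space (lborel_vec (d i))" by (simp add: marginal_def)
    have "?A = space (lborel_vec (d i)) - {v \<in> space (lborel_vec (d i)). typical (d i) (M i) (\<eta> i) (c i) v}"
      unfolding sp by auto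
    then have A: "?A \<in> sets (lborel_vec (d i))" using typical_sets by auto
    have "(\<integral>x. ?t i x \<partial>\<mu>) = (\<integral>x. indicator ((\<lambda>x. x i) -` ?A \<inter> space \<mu>) x \<partial>\<mu>)"
      using measurable_space[OF measurable_block[OF s i]]
      by (intro Bochner_Integration.integral_cong refl) (auto simp: indicator_def sp)
    also have "\<dots> = measure \<mu> ((\<lambda>x. x i) -` ?A \<inter> space \<mu>)"
      using measurable_sets[OF measurable_block[OF s i] A] by simp
    also have "\<dots> = measure (marginal d \<mu> i) ?A"
      unfolding marginal_def by (rule measure_distr[symmetric, OF measurable_block[OF s i] A[unfolded marginal_def]])
    also have "\<dots> < \<epsilon>" using p i by (simp add: M_def \<eta>_def)
    finally show ?thesis .
  qed
  obtain \<kappa> where \<kappa>: "\<kappa> > 0" and fac: "\<forall>\<^sub>F n in sequentially. \<forall>X. RJdCov_stat h r d n C X < \<kappa> \<longrightarrow>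
     \<bar>(\<Sum>a=1..n. \<Prod>i=1..r. ?f i (X a)) / real n - (\<Prod>i=1..r. (\<Sum>a=1..n. ?f i (X a)) / real n)\<bar>
     \<le> 2 * (\<Sum>i=1..r. real (card {a \<in> {1..n}. \<not> typical (d i) (M i) (\<eta> i) (c i) (X a i)}) / real n + \<epsilon>) + \<epsilon>"
    using small_stat_factorizes[of r C d \<epsilon> \<eta> h J c M, OF C d \<epsilon> \<eta> h w] by blast
  let ?P = "\<lambda>n. PiM {1..n} (\<lambda>_. \<mu>)"
  let ?bad = "\<lambda>f n. {X \<in> space (?P n). \<epsilon> \<le> \<bar>(\<Sum>a=1..n. f (X a)) / real n - (\<integral>x. f x \<partial>\<mu>)\<bar>}"
  have lln: "(\<lambda>n. measure (?P n) (?bad f n)) \<longlonglongrightarrow> 0"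
    if "f \<in> borel_measurable \<mu>" "\<And>x. f x \<in> {0..1}" for f :: "_ \<Rightarrow> real"
    by (rule lln_bounded[OF \<mu> that \<epsilon>])
  have f01: "?f i x \<in> {0..1}" for i x using restr_below_range by auto
  have g01: "?g x \<in> {0..1}" for x
    using restr_below_range by (auto intro!: prod_nonneg prod_le_1)
  let ?U = "\<lambda>n. ?bad ?g n \<union> ((\<Union>i\<in>{1..r}. ?bad (?f i) n) \<union> (\<Union>i\<in>{1..r}. ?bad (?t i) n))"
  let ?b = "\<lambda>n. measure (?P n) (?bad ?g n) + ((\<Sum>i\<in>{1..r}. measure (?P n) (?bad (?f i) n))
     + (\<Sum>i\<in>{1..r}. measure (?P n) (?bad (?t i) n)))"
  have bad_sets: "?bad f n \<in> sets (?P n)" if f: "f \<in> borel_measurable \<mu>" for f :: "_ \<Rightarrow> real" and n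
  proof -
    have "(\<lambda>X. f (X a)) \<in> borel_measurable (?P n)" if "a \<in> {1..n}" for a
      by (rule measurable_compose[OF measurable_component_singleton[OF that] f])
    then have "(\<lambda>X. \<bar>(\<Sum>a=1..n. f (X a)) / real n - (\<integral>x. f x \<partial>\<mu>)\<bar>) \<in> borel_measurable (?P n)"
      by (intro borel_measurable_abs borel_measurable_diff borel_measurable_divide borel_measurable_sum
          borel_measurable_const)
    then show ?thesis by measurable
  qed
  have sub: "{X \<in> space (?P n). RJdCov_stat h r d n C X < \<kappa>} \<subseteq> ?U n"
    if fac: "\<forall>X. RJdCov_stat h r d n C X < \<kappa> \<longrightarrow>
     \<bar>(\<Sum>a=1..n. \<Prod>i=1..r. ?f i (X a)) / real n - (\<Prod>i=1..r. (\<Sum>a=1..n. ?f i (X a)) / real n)\<bar>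
     \<le> 2 * (\<Sum>i=1..r. real (card {a \<in> {1..n}. \<not> typical (d i) (M i) (\<eta> i) (c i) (X a i)}) / real n + \<epsilon>) + \<epsilon>"
    for n
  proof
    fix X assume X: "X \<in> {X \<in> space (?P n). RJdCov_stat h r d n C X < \<kappa>}"
    show "X \<in> ?U n"
    proof (rule ccontr)
      assume "X \<notin> ?U n"
      then have good: "\<bar>(\<Sum>a=1..n. ?g (X a)) / real n - (\<integral>x. ?g x \<partial>\<mu>)\<bar> < \<epsilon>"
        "\<And>i. i \<in> {1..r} \<Longrightarrow> \<bar>(\<Sum>a=1..n. ?f i (X a)) / real n - (\<integral>x. ?f i x \<partial>\<mu>)\<bar> < \<epsilon>"
        "\<And>i. i \<in> {1..r} \<Longrightarrow> \<bar>(\<Sum>a=1..n. ?t i (X a)) / real n - (\<integral>x. ?t i x \<partial>\<mu>)\<bar> < \<epsilon>"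
        using X by (auto simp: not_le)
      have "real (card {a \<in> {1..n}. \<not> typical (d i) (M i) (\<eta> i) (c i) (X a i)}) / real n \<le> 2 * \<epsilon>"
        if i: "i \<in> {1..r}" for i
      proof -
        have "(\<Sum>a=1..n. ?t i (X a)) = real (card {a \<in> {1..n}. \<not> typical (d i) (M i) (\<eta> i) (c i) (X a i)})"
        proof -
          have "(\<Sum>a=1..n. ?t i (X a)) = (\<Sum>a=1..n. if \<not> typical (d i) (M i) (\<eta> i) (c i) (X a i) then 1 else 0)"
            by (intro sum.cong) auto
          then show ?thesis by (subst (asm) sum.inter_filter[symmetric]) auto
        qed
        then show ?thesis using good(3)[OF i] t_mean[OF i] by (simp only:)
      qed
      then have "(\<Sum>i=1..r. real (card {a \<in> {1..n}. \<not> typical (d i) (M i) (\<eta> i) (c i) (X a i)}) / real n + \<epsilon>)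
          \<le> (\<Sum>i=1..r. 3 * \<epsilon>)"
        by (intro sum_mono) fastforce
      also have "\<dots> = 3 * (real r * \<epsilon>)" by simp
      finally have "\<bar>(\<Sum>a=1..n. ?g (X a)) / real n - (\<Prod>i=1..r. (\<Sum>a=1..n. ?f i (X a)) / real n)\<bar>
          \<le> 2 * (3 * (real r * \<epsilon>)) + \<epsilon>"
        using fac X by fastforce
      moreover have "\<bar>(\<Prod>i=1..r. (\<Sum>a=1..n. ?f i (X a)) / real n) - (\<Prod>i=1..r. \<integral>x. ?f i x \<partial>\<mu>)\<bar> \<le> real r * \<epsilon>"
      proof -
        have "norm ((\<Sum>a=1..n. ?f i (X a)) / real n) \<le> 1" for i
          using mean_le[of n "\<lambda>a. ?f i (X a)" 1] restr_below_range[of J d c i]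
          by (simp add: sum_nonneg)
        moreover have "norm (\<integral>x. ?f i x \<partial>\<mu>) \<le> 1" if "i \<in> {1..r}" for i
        proof -
          have "(\<integral>x. ?f i x \<partial>\<mu>) \<le> 1"
            by (rule \<mu>.integral_le_const[OF \<mu>.integrable_const_bound[of _ 1]])
              (use f_meas[OF that] restr_below_range[of J d c i] in auto)
          moreover have "(\<integral>x. ?f i x \<partial>\<mu>) \<ge> 0"
            by (intro Bochner_Integration.integral_nonneg restr_below_range)
          ultimately show ?thesis by simp
        qed
        ultimately have "\<bar>(\<Prod>i=1..r. (\<Sum>a=1..n. ?f i (X a)) / real n) - (\<Prod>i=1..r. \<integral>x. ?f i x \<partial>\<mu>)\<bar>
            \<le> (\<Sum>i=1..r. \<bar>(\<Sum>a=1..n. ?f i (X a)) / real n - (\<integral>x. ?f i x \<partial>\<mu>)\<bar>)"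
          using norm_prod_diff[of "{1..r}" "\<lambda>i. (\<Sum>a=1..n. ?f i (X a)) / real n" "\<lambda>i. \<integral>x. ?f i x \<partial>\<mu>"]
          unfolding real_norm_def by blast
        also have "\<dots> \<le> (\<Sum>i=1..r. \<epsilon>)" using good(2) by (intro sum_mono less_imp_le)
        finally show ?thesis by simp
      qed
      ultimately have "\<Delta> \<le> \<epsilon> + real r * \<epsilon> + (2 * (3 * (real r * \<epsilon>)) + \<epsilon>)"
        unfolding \<Delta>_def using good(1) by linarith
      then show False using \<epsilon>\<Delta> by (simp add: algebra_simps)
    qed
  qed
  have le: "\<forall>\<^sub>F n in sequentially. measure (?P n) {X \<in> space (?P n). RJdCov_stat h r d n C X < \<kappa>} \<le> ?b n"
    using fac
  proof eventually_elim
    case (elim n)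
    interpret P: prob_space "?P n" by (intro prob_space_PiM \<mu>)
    have m: "?bad ?g n \<in> sets (?P n)" "(\<Union>i\<in>{1..r}. ?bad (?f i) n) \<in> sets (?P n)" "(\<Union>i\<in>{1..r}. ?bad (?t i) n) \<in> sets (?P n)"
      by (intro bad_sets sets.finite_UN finite_atLeastAtMost g_meas f_meas t_meas; assumption)+
    have "P.prob {X \<in> space (?P n). RJdCov_stat h r d n C X < \<kappa>} \<le> P.prob (?U n)"
      by (rule P.finite_measure_mono[OF sub[OF elim]]) (intro sets.Un m)
    also have "\<dots> \<le> P.prob (?bad ?g n) + P.prob ((\<Union>i\<in>{1..r}. ?bad (?f i) n) \<union> (\<Union>i\<in>{1..r}. ?bad (?t i) n))"
      by (intro measure_Un_le sets.Un m)
    also have "P.prob ((\<Union>i\<in>{1..r}. ?bad (?f i) n) \<union> (\<Union>i\<in>{1..r}. ?bad (?t i) n))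
        \<le> P.prob (\<Union>i\<in>{1..r}. ?bad (?f i) n) + P.prob (\<Union>i\<in>{1..r}. ?bad (?t i) n)"
      by (intro measure_Un_le m)
    also have "P.prob (\<Union>i\<in>{1..r}. ?bad (?f i) n) \<le> (\<Sum>i\<in>{1..r}. P.prob (?bad (?f i) n))"
      by (rule P.finite_measure_subadditive_finite) (auto intro!: bad_sets[OF f_meas, simplified])
    also have "P.prob (\<Union>i\<in>{1..r}. ?bad (?t i) n) \<le> (\<Sum>i\<in>{1..r}. P.prob (?bad (?t i) n))"
      by (rule P.finite_measure_subadditive_finite) (auto intro!: bad_sets[OF t_meas, simplified])
    finally show ?case by simp
  qed
  have "?b \<longlonglongrightarrow> 0 + ((\<Sum>i\<in>{1..r}. 0) + (\<Sum>i\<in>{1..r}. 0))"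
  proof (intro tendsto_add tendsto_sum)
    show "(\<lambda>n. measure (?P n) (?bad ?g n)) \<longlonglongrightarrow> 0" by (rule lln[OF g_meas]) (rule g01)
    show "(\<lambda>n. measure (?P n) (?bad (?f i) n)) \<longlonglongrightarrow> 0" if "i \<in> {1..r}" for i
      by (rule lln[OF f_meas[OF that]]) (rule f01)
    show "(\<lambda>n. measure (?P n) (?bad (?t i) n)) \<longlonglongrightarrow> 0" if "i \<in> {1..r}" for i
      by (rule lln[OF t_meas[OF that]]) simp
  qed
  then have b0: "?b \<longlonglongrightarrow> 0" by simp
  have "(\<lambda>n. measure (?P n) {X \<in> space (?P n). RJdCov_stat h r d n C X < \<kappa>}) \<longlonglongrightarrow> 0"
    by (rule tendsto_sandwich[OF _ le tendsto_const b0]) simp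
  then show ?thesis using \<kappa> by blast
qed

section \<open>Measurability and power of the test\<close>

text \<open>Preimages under \<open>f\<close> are finite unions of level sets of \<open>V\<close>,
  however complicated the passage from \<open>V\<close> to \<open>f\<close> may be.\<close>

lemma measurable_finite_factor:
  assumes W: "finite W" "\<And>x. x \<in> space M \<Longrightarrow> V x \<in> W"
    and V: "\<And>w. w \<in> W \<Longrightarrow> {x \<in> space M. V x = w} \<in> sets M"
    and f: "\<And>x y. x \<in> space M \<Longrightarrow> y \<in> space M \<Longrightarrow> V x = V y \<Longrightarrow> f x = f y"
    and range: "\<And>x. x \<in> space M \<Longrightarrow> f x \<in> space N"
  shows "f \<in> measurable M N"
proof (rule measurableI)
  fix A assume "A \<in> sets N"
  have "f -` A \<inter> space M = (\<Union>w\<in>{V x |x. x \<in> space M \<and> f x \<in> A}. {x \<in> space M. V x = w})"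
  proof (intro set_eqI iffI)
    fix x assume "x \<in> (\<Union>w\<in>{V x |x. x \<in> space M \<and> f x \<in> A}. {x \<in> space M. V x = w})"
    then obtain y where "y \<in> space M" "f y \<in> A" "x \<in> space M" "V x = V y" by auto
    then show "x \<in> f -` A \<inter> space M" using f[of x y] by simp
  qed auto
  moreover have "{V x |x. x \<in> space M \<and> f x \<in> A} \<subseteq> W" using W(2) by auto
  ultimately show "f -` A \<inter> space M \<in> sets M"
    using V W(1) by (auto intro!: sets.finite_UN intro: finite_subset)
qed (rule range)

definition transport_cost ::
    "(nat \<Rightarrow> nat \<Rightarrow> nat \<Rightarrow> nat \<Rightarrow> real) \<Rightarrow> (nat \<Rightarrow> nat) \<Rightarrow> nat \<Rightarrow> (nat \<Rightarrow> nat \<Rightarrow> nat \<Rightarrow> real) \<Rightarrow> nat \<Rightarrow> (nat \<Rightarrow> nat) \<Rightarrow> real" where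
  "transport_cost h d n X i \<sigma> = (\<Sum>a=1..n. (L2_set (\<lambda>j. X a i j - h n (d i) (\<sigma> a) j) {1..d i})\<^sup>2)"

text \<open>The optimal assignments are functions of the sample only through the finitely many comparisons
  between transport costs, which makes them measurable although they are chosen by \<open>arg_min\<close>.\<close>

definition cost_order ::
    "nat \<Rightarrow> (nat \<Rightarrow> nat \<Rightarrow> nat \<Rightarrow> nat \<Rightarrow> real) \<Rightarrow> (nat \<Rightarrow> nat) \<Rightarrow> nat \<Rightarrow> (nat \<Rightarrow> nat \<Rightarrow> nat \<Rightarrow> real)
      \<Rightarrow> (nat \<times> (nat \<Rightarrow> nat) \<times> (nat \<Rightarrow> nat)) set" where
  "cost_order r h d n X = {(i, \<sigma>, \<rho>). i \<in> {1..r} \<and> \<sigma> permutes {1..n} \<and> \<rho> permutes {1..n} \<and>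
     transport_cost h d n X i \<sigma> \<le> transport_cost h d n X i \<rho>}"

definition cost_index :: "nat \<Rightarrow> nat \<Rightarrow> (nat \<times> (nat \<Rightarrow> nat) \<times> (nat \<Rightarrow> nat)) set" where
  "cost_index r n = {1..r} \<times> {\<sigma>. \<sigma> permutes {1..n}} \<times> {\<sigma>. \<sigma> permutes {1..n}}"

lemma finite_cost_index: "finite (cost_index r n)"
  unfolding cost_index_def by (intro finite_cartesian_product finite_permutations) auto

lemma cost_order_range: "cost_order r h d n X \<in> Pow (cost_index r n)"
  by (auto simp: cost_order_def cost_index_def)

lemma opt_assignment_transport_cost:
  "opt_assignment h d n X i = arg_min (transport_cost h d n X i) (\<lambda>\<sigma>. \<sigma> permutes {1..n})"
  unfolding opt_assignment_def transport_cost_def[abs_def] ..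

text \<open>\<open>arg_min\<close> is a choice applied to the predicate of being a minimiser. Equal
  comparisons give the same predicate, hence the same chosen permutation, however ties are
  resolved.\<close>

lemma opt_assignment_cost_order:
  assumes "cost_order r h d n X = cost_order r h d n Y" "i \<in> {1..r}"
  shows "opt_assignment h d n X i = opt_assignment h d n Y i"
proof -
  have le: "transport_cost h d n X i \<sigma> \<le> transport_cost h d n X i \<rho> \<longleftrightarrow> transport_cost h d n Y i \<sigma> \<le> transport_cost h d n Y i \<rho>"
    if "\<sigma> permutes {1..n}" "\<rho> permutes {1..n}" for \<sigma> \<rho>
  proof -
    have "(i, \<sigma>, \<rho>) \<in> cost_order r h d n X \<longleftrightarrow> (i, \<sigma>, \<rho>) \<in> cost_order r h d n Y" using assms(1) by simp
    then show ?thesis using that assms(2) by (simp add: cost_order_def)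
  qed
  have "is_arg_min (transport_cost h d n X i) (\<lambda>\<sigma>. \<sigma> permutes {1..n}) = is_arg_min (transport_cost h d n Y i) (\<lambda>\<sigma>. \<sigma> permutes {1..n})"
    unfolding is_arg_min_def fun_eq_iff using le by (metis not_le)
  then show ?thesis
    unfolding opt_assignment_transport_cost arg_min_def by (rule arg_cong)
qed

lemma theta_cong:
  assumes "\<And>a i. a \<in> {1..n} \<Longrightarrow> i \<in> S \<Longrightarrow> x a i = y a i"
  shows "theta d n S x = theta d n S y"
proof -
  have "cdev n (d i) (\<lambda>a. x a i) (t i) b = cdev n (d i) (\<lambda>a. y a i) (t i) b"
    if "i \<in> S" "b \<in> {1..n}" for i b and t :: "nat \<Rightarrow> nat \<Rightarrow> real"
  proof -
    have "(\<Sum>a=1..n. cexp (d i) (t i) (x a i)) = (\<Sum>a=1..n. cexp (d i) (t i) (y a i))"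
      by (intro sum.cong refl) (simp add: assms that)
    then show ?thesis by (simp only: cdev_def assms[OF that(2,1)])
  qed
  then have "zstat d n S x t = zstat d n S y t" for t
    unfolding zstat_def by (intro arg_cong2[where f = times] refl sum.cong prod.cong) simp
  then show ?thesis unfolding theta_zstat by simp
qed

lemma JdCov_stat_cong:
  assumes "\<And>a i. a \<in> {1..n} \<Longrightarrow> i \<in> {1..r} \<Longrightarrow> x a i = y a i"
  shows "JdCov_stat r d n C x = JdCov_stat r d n C y"
  unfolding JdCov_stat_def
  by (intro sum.cong refl arg_cong2[where f = times] theta_cong assms) auto

lemma RJdCov_stat_cost_order:
  assumes "cost_order r h d n X = cost_order r h d n Y"
  shows "RJdCov_stat h r d n C X = RJdCov_stat h r d n C Y"
  unfolding RJdCov_stat_def by (intro JdCov_stat_cong) (simp add: opt_assignment_cost_order[OF assms])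

lemma cost_order_sets:
  assumes s: "sets \<mu> = sets (lborel_blocks r d)" and W: "W \<subseteq> cost_index r n"
  shows "{X \<in> space (PiM {1..n} (\<lambda>_. \<mu>)). cost_order r h d n X = W} \<in> sets (PiM {1..n} (\<lambda>_. \<mu>))"
proof -
  let ?P = "PiM {1..n} (\<lambda>_. \<mu>)"
  have cost: "(\<lambda>X. transport_cost h d n X i \<sigma>) \<in> borel_measurable ?P" if "i \<in> {1..r}" for i \<sigma>
  proof -
    have "(\<lambda>X. \<Sum>a=1..n. \<Sum>j=1..d i. (X a i j - h n (d i) (\<sigma> a) j)\<^sup>2) \<in> borel_measurable ?P"
      by (intro borel_measurable_sum borel_measurable_power borel_measurable_diff borel_measurable_const
          sample_coordinate_measurable[OF s] that)
    then show ?thesis unfolding transport_cost_def L2_set_def by (simp add: sum_nonneg)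
  qed
  have "{X \<in> space ?P. cost_order r h d n X = W}
      = {X \<in> space ?P. \<forall>q\<in>cost_index r n. (case q of (i, \<sigma>, \<rho>) \<Rightarrow>
          transport_cost h d n X i \<sigma> \<le> transport_cost h d n X i \<rho>) \<longleftrightarrow> q \<in> W}"
    using W by (auto simp: cost_order_def cost_index_def)
  also have "\<dots> \<in> sets ?P"
  proof (intro sets.sets_Collect_finite_All finite_cost_index)
    fix q assume "q \<in> cost_index r n"
    then obtain i \<sigma> \<rho> where q: "q = (i, \<sigma>, \<rho>)" "i \<in> {1..r}" by (auto simp: cost_index_def)
    have "{X \<in> space ?P. transport_cost h d n X i \<sigma> \<le> transport_cost h d n X i \<rho>} \<in> sets ?P"
      using cost[OF q(2)] by measurable
    then show "{X \<in> space ?P. (case q of (i, \<sigma>, \<rho>) \<Rightarrow>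
          transport_cost h d n X i \<sigma> \<le> transport_cost h d n X i \<rho>) \<longleftrightarrow> q \<in> W} \<in> sets ?P"
      by (cases "q \<in> W") (auto simp: q(1) intro: sets.sets_Collect_neg)
  qed
  finally show ?thesis .
qed

lemma RJdCov_stat_measurable:
  assumes s: "sets \<mu> = sets (lborel_blocks r d)"
  shows "RJdCov_stat h r d n C \<in> borel_measurable (PiM {1..n} (\<lambda>_. \<mu>))"
proof (rule measurable_finite_factor)
  show "finite (Pow (cost_index r n))" by (simp add: finite_cost_index)
  show "cost_order r h d n X \<in> Pow (cost_index r n)" for X by (rule cost_order_range)
  show "{X \<in> space (PiM {1..n} (\<lambda>_. \<mu>)). cost_order r h d n X = w} \<in> sets (PiM {1..n} (\<lambda>_. \<mu>))"
    if "w \<in> Pow (cost_index r n)" for w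
    using that by (intro cost_order_sets[OF s]) simp
  show "RJdCov_stat h r d n C X = RJdCov_stat h r d n C Y" if "cost_order r h d n X = cost_order r h d n Y" for X Y
    by (rule RJdCov_stat_cost_order[OF that])
qed simp

definition resamples :: "nat \<Rightarrow> nat \<Rightarrow> nat \<Rightarrow> (nat \<times> nat \<Rightarrow> nat \<Rightarrow> nat) measure" where
  "resamples r B n = PiM ({1..B} \<times> {1..r}) (\<lambda>_. uniform_count_measure {\<pi>. \<pi> permutes {1..n}})"

definition tie_breaks :: "nat \<Rightarrow> (nat \<Rightarrow> nat) measure" where
  "tie_breaks B = uniform_count_measure {\<tau>. \<tau> permutes {0..B}}"

lemma sets_resamples: "sets (resamples r B n) = Pow (space (resamples r B n))"
  unfolding resamples_def
  by (simp add: sets_PiM_uniform_count finite_permutations space_PiM space_uniform_count_measure)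

lemma finite_resamples: "finite (space (resamples r B n))"
  unfolding resamples_def space_PiM space_uniform_count_measure
  by (intro finite_PiE finite_permutations) auto

lemma sets_tie_breaks: "sets (tie_breaks B) = Pow (space (tie_breaks B))"
  by (simp add: tie_breaks_def sets_uniform_count_measure space_uniform_count_measure)

lemma finite_tie_breaks: "finite (space (tie_breaks B))"
  by (simp add: tie_breaks_def space_uniform_count_measure finite_permutations)

lemma resampling_law_eq:
  "resampling_law r B n \<mu> = PiM {1..n} (\<lambda>_. \<mu>) \<Otimes>\<^sub>M (resamples r B n \<Otimes>\<^sub>M tie_breaks B)"
  unfolding resampling_law_def resamples_def tie_breaks_def ..

lemma resampling_test_measurable:
  assumes s: "sets \<mu> = sets (lborel_blocks r d)"
  shows "resampling_test h r d C \<alpha> B n \<in> borel_measurable (resampling_law r B n \<mu>)"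
proof (rule measurable_finite_factor)
  let ?V = "\<lambda>(X, \<pi>, \<tau>). (cost_order r h d n X, \<pi> :: nat \<times> nat \<Rightarrow> nat \<Rightarrow> nat, \<tau> :: nat \<Rightarrow> nat)"
  let ?W = "Pow (cost_index r n) \<times> space (resamples r B n) \<times> space (tie_breaks B)"
  show "finite ?W" by (simp add: finite_cost_index finite_resamples finite_tie_breaks)
  show "?V \<omega> \<in> ?W" if "\<omega> \<in> space (resampling_law r B n \<mu>)" for \<omega>
  proof -
    obtain X \<pi> \<tau> where "\<omega> = (X, \<pi>, \<tau>)" by (cases \<omega>)
    then show ?thesis
      using that cost_order_range[of r h d n X] by (simp add: resampling_law_eq space_pair_measure)
  qed
  show "{\<omega> \<in> space (resampling_law r B n \<mu>). ?V \<omega> = w} \<in> sets (resampling_law r B n \<mu>)" if w: "w \<in> ?W" for w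
  proof -
    obtain v \<pi> \<tau> where w': "w = (v, \<pi>, \<tau>)" by (cases w)
    have "{\<omega> \<in> space (resampling_law r B n \<mu>). ?V \<omega> = w}
        = {X \<in> space (PiM {1..n} (\<lambda>_. \<mu>)). cost_order r h d n X = v} \<times> ({\<pi>} \<times> {\<tau>})"
      using w by (auto simp: w' resampling_law_eq space_pair_measure)
    also have "\<dots> \<in> sets (resampling_law r B n \<mu>)"
      unfolding resampling_law_eq using w
      by (intro pair_measureI cost_order_sets[OF s]) (auto simp: w' sets_resamples sets_tie_breaks)
    finally show ?thesis .
  qed
  show "resampling_test h r d C \<alpha> B n \<omega> = resampling_test h r d C \<alpha> B n \<omega>'" if "?V \<omega> = ?V \<omega>'" for \<omega> \<omega>'
  proof -
    obtain X \<pi> \<tau> where w1: "\<omega> = (X, \<pi>, \<tau>)" by (cases \<omega>)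
    obtain Y \<pi>' \<tau>' where w2: "\<omega>' = (Y, \<pi>', \<tau>')" by (cases \<omega>')
    have eq: "cost_order r h d n X = cost_order r h d n Y" and w: "\<omega> = (X, \<pi>, \<tau>)" "\<omega>' = (Y, \<pi>, \<tau>)"
      using that by (simp_all add: w1 w2)
    show ?thesis unfolding w resampling_test_def prod.case RJdCov_stat_cost_order[OF eq] ..
  qed
qed simp

section \<open>Lower bound for the power\<close>

lemma prob_space_resampling_law:
  "prob_space \<mu> \<Longrightarrow> prob_space (resampling_law r B n \<mu>)"
  unfolding resampling_law_def
  by (intro prob_space_pair prob_space_PiM prob_space_permutations) auto

lemma resampling_test_range: "resampling_test h r d C \<alpha> B n \<omega> \<in> {0..1}"
  by (cases \<omega>) (auto simp: resampling_test_def Let_def)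

lemma resampling_test_rejects:
  assumes \<alpha>: "0 < \<alpha>" "real B \<ge> 1 / \<alpha> - 1"
    and less: "\<And>b. b \<in> {1..B} \<Longrightarrow> resampled_stat h r d n C (\<lambda>i. \<pi> (b, i)) < RJdCov_stat h r d n C X"
  shows "resampling_test h r d C \<alpha> B n (X, \<pi>, \<tau>) = 1"
proof -
  let ?T = "\<lambda>b. if b = 0 then RJdCov_stat h r d n C X else resampled_stat h r d n C (\<lambda>i. \<pi> (b, i))"
  have "{b \<in> {1..B}. ?T b > ?T 0 \<or> ?T b = ?T 0 \<and> \<tau> b < \<tau> 0} = {}"
    using less by force
  then have "desc_rank B ?T \<tau> = 1" unfolding desc_rank_def by simp
  moreover have "1 / (real B + 1) \<le> \<alpha>"
  proof -
    have "1 / \<alpha> \<le> real B + 1" using \<alpha>(2) by simp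
    then show ?thesis using \<alpha>(1) by (simp add: field_simps)
  qed
  ultimately show ?thesis unfolding resampling_test_def by (simp add: Let_def)
qed

text \<open>If the statistic is at least \<open>\<kappa>\<close> and all resampled ones lie below
  \<open>\<kappa>\<close>, it has rank 1 whatever the tie-breaking order. Sample and resamples are
  independent, so this event is a product; the union bound over the \<open>B\<close> resamples gives
  the last error term.\<close>

lemma resampling_test_power:
  assumes \<mu>: "prob_space \<mu>" and s: "sets \<mu> = sets (lborel_blocks r d)"
    and d: "\<And>i. i \<in> {1..r} \<Longrightarrow> d i \<ge> 1"
    and h: "\<And>i a. i \<in> {1..r} \<Longrightarrow> a \<in> {1..n} \<Longrightarrow> h n (d i) a \<in> unit_cube (d i)"
    and C: "\<And>s. s \<in> {2..r} \<Longrightarrow> C s > 0" and \<alpha>: "0 < \<alpha>" "real B \<ge> 1 / \<alpha> - 1"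
    and \<kappa>: "\<kappa> > 0" and n: "n \<ge> 2"
  shows "1 - measure (PiM {1..n} (\<lambda>_. \<mu>)) {X \<in> space (PiM {1..n} (\<lambda>_. \<mu>)). RJdCov_stat h r d n C X < \<kappa>}
      - real B * (2 / n * resample_const r d C / \<kappa>)
    \<le> (\<integral>\<omega>. resampling_test h r d C \<alpha> B n \<omega> \<partial>resampling_law r B n \<mu>)"
proof -
  let ?P = "PiM {1..n} (\<lambda>_. \<mu>)" and ?Q = "resamples r B n" and ?\<T> = "tie_breaks B"
  interpret P: prob_space ?P by (intro prob_space_PiM \<mu>)
  interpret Q: prob_space ?Q unfolding resamples_def by (intro prob_space_PiM prob_space_permutations) simp
  interpret \<T>: prob_space ?\<T> unfolding tie_breaks_def by (intro prob_space_permutations) simp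
  interpret QT: pair_prob_space ?Q ?\<T> ..
  interpret L: prob_space "resampling_law r B n \<mu>" by (rule prob_space_resampling_law[OF \<mu>])
  let ?A' = "{X \<in> space ?P. RJdCov_stat h r d n C X < \<kappa>}"
  let ?D' = "\<Union>b\<in>{1..B}. {\<pi> \<in> space ?Q. \<kappa> \<le> resampled_stat h r d n C (\<lambda>i. \<pi> (b, i))}"
  let ?A = "space ?P - ?A'" and ?D = "space ?Q - ?D'"
  have [measurable]: "RJdCov_stat h r d n C \<in> borel_measurable ?P"
    by (rule RJdCov_stat_measurable[OF s])
  have A': "?A' \<in> sets ?P" by measurable
  have A: "?A \<in> sets ?P" using A' by (rule sets.compl_sets)
  have D': "?D' \<in> sets ?Q" and D: "?D \<in> sets ?Q" by (auto simp: sets_resamples)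
  let ?G = "?A \<times> (?D \<times> space ?\<T>)"
  have G: "?G \<in> sets (resampling_law r B n \<mu>)"
    unfolding resampling_law_eq using A D by (intro pair_measureI sets.top)
  have "emeasure (resampling_law r B n \<mu>) ?G = emeasure ?P ?A * (emeasure ?Q ?D * emeasure ?\<T> (space ?\<T>))"
    unfolding resampling_law_eq using A D
    by (subst QT.emeasure_pair_measure_Times) (auto simp: \<T>.emeasure_pair_measure_Times intro!: pair_measureI)
  then have "L.prob ?G = P.prob ?A * Q.prob ?D"
    unfolding L.emeasure_eq_measure P.emeasure_eq_measure Q.emeasure_eq_measure \<T>.emeasure_space_1
    by (simp add: ennreal_mult[symmetric])
  moreover have "P.prob ?A = 1 - P.prob ?A'" by (rule P.prob_compl[OF A'])
  moreover have "Q.prob ?D \<ge> 1 - real B * (2 / n * resample_const r d C / \<kappa>)"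
  proof -
    have "Q.prob ?D' \<le> (\<Sum>b\<in>{1..B}. Q.prob {\<pi> \<in> space ?Q. \<kappa> \<le> resampled_stat h r d n C (\<lambda>i. \<pi> (b, i))})"
      by (rule Q.finite_measure_subadditive_finite) (auto simp: sets_resamples)
    also have "\<dots> \<le> (\<Sum>b\<in>{1..B}. 2 / n * resample_const r d C / \<kappa>)"
      unfolding resamples_def by (intro sum_mono resampled_stat_tail n d h C \<kappa>)
    finally have "Q.prob ?D' \<le> real B * (2 / n * resample_const r d C / \<kappa>)" by simp
    then show ?thesis using Q.prob_compl[OF D'] by linarith
  qed
  \<comment> \<open>Expanding (1 - p)(1 - q) >= 0 turns the product of two probabilities near 1 into
    a bound linear in the errors.\<close>
  moreover have "P.prob ?A * Q.prob ?D \<ge> P.prob ?A + Q.prob ?D - 1"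
  proof -
    have "(1 - P.prob ?A) * (1 - Q.prob ?D) \<ge> 0" 
      using P.prob_le_1[of ?A] Q.prob_le_1[of ?D] by (intro mult_nonneg_nonneg) linarith+
    then show ?thesis by (simp add: algebra_simps)
  qed
  ultimately have "1 - P.prob ?A' - real B * (2 / n * resample_const r d C / \<kappa>) \<le> L.prob ?G" by linarith
  also have "L.prob ?G = (\<integral>\<omega>. indicator ?G \<omega> \<partial>resampling_law r B n \<mu>)" using G by simp
  also have "\<dots> \<le> (\<integral>\<omega>. resampling_test h r d C \<alpha> B n \<omega> \<partial>resampling_law r B n \<mu>)"
  proof (rule integral_mono)
    show "integrable (resampling_law r B n \<mu>) (indicator ?G :: _ \<Rightarrow> real)"
      using G by (intro L.integrable_const_bound[where B = 1]) auto
    show "integrable (resampling_law r B n \<mu>) (resampling_test h r d C \<alpha> B n)"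
      using resampling_test_measurable[OF s] resampling_test_range
      by (intro L.integrable_const_bound[where B = 1]) auto
    fix \<omega>
    show "indicator ?G \<omega> \<le> resampling_test h r d C \<alpha> B n \<omega>"
    proof (cases "\<omega> \<in> ?G")
      case True
      then obtain X \<pi> \<tau> where w: "\<omega> = (X, \<pi>, \<tau>)" "X \<in> ?A" "\<pi> \<in> ?D" by auto
      have "resampling_test h r d C \<alpha> B n (X, \<pi>, \<tau>) = 1"
      proof (rule resampling_test_rejects[OF \<alpha>])
        fix b assume "b \<in> {1..B}"
        then have "resampled_stat h r d n C (\<lambda>i. \<pi> (b, i)) < \<kappa>" using w(3) by force
        also have "\<kappa> \<le> RJdCov_stat h r d n C X" using w(2) by force
        finally show "resampled_stat h r d n C (\<lambda>i. \<pi> (b, i)) < RJdCov_stat h r d n C X" .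
      qed
      then show ?thesis by (simp add: w(1))
    next
      case False
      then show ?thesis using resampling_test_range[of h r d C \<alpha> B n \<omega>] by simp
    qed
  qed
  finally show ?thesis .
qed

theorem theorem3p11:
  fixes r B :: nat and d :: "nat \<Rightarrow> nat" and C :: "nat \<Rightarrow> real" and \<alpha> :: real
    and h :: "nat \<Rightarrow> nat \<Rightarrow> nat \<Rightarrow> nat \<Rightarrow> real"
    and \<mu> :: "(nat \<Rightarrow> nat \<Rightarrow> real) measure"
  assumes "\<And>i. i \<in> {1..r} \<Longrightarrow> d i \<ge> 1"
    and "prob_space \<mu>"
    and "sets \<mu> = sets (lborel_blocks r d)"
    and "absolutely_continuous (lborel_blocks r d) \<mu>"
    and "\<And>i. i \<in> {1..r} \<Longrightarrow> absolutely_continuous (lborel_vec (d i)) (marginal d \<mu> i)"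
    and "\<And>n i a. i \<in> {1..r} \<Longrightarrow> a \<in> {1..n} \<Longrightarrow> h n (d i) a \<in> unit_cube (d i)"
    and "\<And>i. i \<in> {1..r} \<Longrightarrow>
           weak_conv_vec (d i) (grid_empirical h (d i))
             (uniform_measure (lborel_vec (d i)) (unit_cube (d i)))"
    and "\<And>s. s \<in> {2..r} \<Longrightarrow> C s > 0"
    and "0 < \<alpha>" and "\<alpha> < 1"
    and "real B \<ge> 1 / \<alpha> - 1"
    and "\<mu> \<noteq> PiM {1..r} (marginal d \<mu>)"
  shows "(\<lambda>n. \<integral>\<omega>. resampling_test h r d C \<alpha> B n \<omega> \<partial>(resampling_law r B n \<mu>)) \<longlonglongrightarrow> 1"
proof -
  note d = assms(1) and \<mu> = assms(2) and s = assms(3) and h = assms(6) and w = assms(7)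
    and C = assms(8) and \<alpha> = assms(9,11) and dep = assms(12)
  let ?P = "\<lambda>n. PiM {1..n} (\<lambda>_. \<mu>)"
  obtain \<kappa> where \<kappa>: "\<kappa> > 0"
    and tail: "(\<lambda>n. measure (?P n) {X \<in> space (?P n). RJdCov_stat h r d n C X < \<kappa>}) \<longlonglongrightarrow> 0"
    using rank_stat_tail[of r C d h \<mu>, OF C d h w \<mu> s dep] by blast
  \<comment> \<open>One \<open>\<kappa>\<close> serves both sides: the first error tends to 0 by
    dependence, the second like 1/n since \<open>B\<close> and \<open>\<kappa>\<close> are
    fixed.\<close>
  let ?low = "\<lambda>n. 1 - measure (?P n) {X \<in> space (?P n). RJdCov_stat h r d n C X < \<kappa>}
      - real B * (2 / real n * resample_const r d C / \<kappa>)"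
  show ?thesis
  proof (rule tendsto_sandwich[where f = ?low and h = "\<lambda>_. 1"])
    show "\<forall>\<^sub>F n in sequentially. ?low n \<le> (\<integral>\<omega>. resampling_test h r d C \<alpha> B n \<omega> \<partial>resampling_law r B n \<mu>)"
      using eventually_ge_at_top[of 2]
    proof eventually_elim
      case (elim n)
      show ?case by (rule resampling_test_power[OF \<mu> s d h C \<alpha> \<kappa> elim])
    qed
    show "\<forall>\<^sub>F n in sequentially. (\<integral>\<omega>. resampling_test h r d C \<alpha> B n \<omega> \<partial>resampling_law r B n \<mu>) \<le> 1"
    proof (rule always_eventually, rule allI)
      fix n
      interpret L: prob_space "resampling_law r B n \<mu>" by (rule prob_space_resampling_law[OF \<mu>])
      have "integrable (resampling_law r B n \<mu>) (resampling_test h r d C \<alpha> B n)"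
        using resampling_test_measurable[OF s] resampling_test_range
        by (intro L.integrable_const_bound[where B = 1]) auto
      then show "(\<integral>\<omega>. resampling_test h r d C \<alpha> B n \<omega> \<partial>resampling_law r B n \<mu>) \<le> 1"
        by (rule L.integral_le_const) (use resampling_test_range in auto)
    qed
    have "(\<lambda>n. 2 / real n * resample_const r d C / \<kappa>) \<longlonglongrightarrow> 0"
      using lim_const_over_n[of "2 * resample_const r d C / \<kappa>"] by (simp add: field_simps)
    then have "?low \<longlonglongrightarrow> 1 - 0 - real B * 0"
      by (intro tendsto_diff tendsto_mult tendsto_const tail)
    then show "?low \<longlonglongrightarrow> 1" by simp
  qed (rule tendsto_const)
qed

end
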